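(* Consider two single-server FIFO queues in tandem with i.i.d. interarrival times of mean $a$ and service times $\{\sigma_n^{(i)}\}$ of mean $b^{(i)}$ at station $i=1,2$, as specified in the context. Assume that $v_i^2=\mathrm{Var}(\sigma^{(i)})$ is finite for $i=1,2$ and put $v=\sqrt{v_1^2+v_2^2}$. Assume $a>b^{(1)}=b^{(2)}\equiv b$ and $\mathbf{P}(\sigma^{(i)}>x)\sim d^{(i)}\overline{F}(x)$ as $x\to\infty$, $i=1,2$, with $d^{(i)}\ge 0$, $d^{(1)}+d^{(2)}>0$, where both $F$ and $F^s$ are subexponential. Then, as $x\to\infty$, the stationary waiting time $W^{(2)}$ at the second queue satisfies $$\mathbf{P}(W^{(2)}>x)=2d^{(1)}\int_0^\infty\overline{F}(x+y(a-b))\,\overline{\Phi}\Bigl(\frac{x}{v\sqrt{y}}\Bigr)dy+\frac{d^{(2)}}{a-b}\overline{F}^s(x)+o(\overline{F}^s(x)),$$ where $\overline{\Phi}$ is the tail of the standard normal distribution. In particular, if either (i) $d^{(2)}>0$, or (ii) $d^{(2)}=0$, $d^{(1)}>0$ and $\liminf_{x\to\infty}\overline{F}^s(x^2)/\overline{F}^s(x)>0$, then $$\mathbf{P}(W^{(2)}>x)\sim2d^{(1)}\int_0^\infty\overline{F}(x+y(a-b))\,\overline{\Phi}\Bigl(\frac{x}{v\sqrt{y}}\Bigr)dy+\frac{d^{(2)}}{a-b}\overline{F}^s(x).$$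
   Context: For $c>0$, $f\sim cg$ means $f(x)/g(x)\to c$ as $x\to\infty$; $f\sim cg$ with $c=0$ means $f(x)=o(g(x))$. $F$ is a distribution function on $\mathbb{R}^+$ with finite mean, $\overline{F}=1-F$, and $F^s$ is the integrated tail distribution, with tail $\overline{F}^s(x)=\min\{1,\int_x^\infty\overline{F}(u)\,du\}$. Tandem queue: customer $n\in\mathbb{Z}$ arrives at station 1 at time $T_n$, $\tau_n=T_{n+1}-T_n\ge 0$. The sequences $\{\tau_n\}$, $\{\sigma_n^{(1)}\}$, $\{\sigma_n^{(2)}\}$ are mutually independent, and each consists of i.i.d. nonnegative random variables with means $a$, $b^{(1)}$, $b^{(2)}$. Customers are served in order of arrival at station 1, then at station 2, by a single server at each station. The stationary waiting time of customer $n$ at station 1 is $W_n^{(1)}=\sup_{k\ge0}\sum_{i=1}^k(\sigma_{n-i}^{(1)}-\tau_{n-i})$; the time between the arrivals of customers $n$ and $n+1$ at station 2 is $\tau_n^{(2)}=-\min(0,W_n^{(1)}+\sigma_n^{(1)}-\tau_n)+\sigma_{n+1}^{(1)}$; and the stationary waiting time of customer $0$ at station 2 is $W^{(2)}=W_0^{(2)}=\sup_{k\ge0}\sum_{i=1}^k(\sigma_{-i}^{(2)}-\tau_{-i}^{(2)})$. *)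

theory Defs
  imports "HOL-Probability.Probability" "HOL-Library.Landau_Symbols"
begin

definition tail :: "real measure \<Rightarrow> real \<Rightarrow> real" where
  "tail F x = 1 - cdf F x"

text \<open>\<open>tail_equiv c f g\<close> stands for \<open>f \<sim> c g\<close> as the argument tends to infinity, where
  \<open>c = 0\<close> is read as \<open>f = o(g)\<close>.\<close>

definition tail_equiv :: "real \<Rightarrow> (real \<Rightarrow> real) \<Rightarrow> (real \<Rightarrow> real) \<Rightarrow> bool" where
  "tail_equiv c f g \<longleftrightarrow>
     (if c = 0 then f \<in> o(g) else ((\<lambda>x. f x / g x) \<longlongrightarrow> c) at_top)"

definition distribution_nonneg :: "real measure \<Rightarrow> bool" where
  "distribution_nonneg F \<longleftrightarrow> real_distribution F \<and> (AE x in F. 0 \<le> x)"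

definition subexponential :: "real measure \<Rightarrow> bool" where
  "subexponential F \<longleftrightarrow>
     distribution_nonneg F \<and> (\<forall>x. tail F x > 0) \<and> tail_equiv 2 (tail (F \<star> F)) (tail F)"

definition int_tail :: "real measure \<Rightarrow> real \<Rightarrow> real" where
  "int_tail F x = min 1 (LBINT u:{x..}. tail F u)"

text \<open>For \<open>x < 0\<close> the formula \<open>int_tail F x\<close> may be less than \<open>1\<close>; the integrated tail distribution
  lives on the nonnegative half-line, with an atom at \<open>0\<close> if \<open>F\<close> has mean less than \<open>1\<close>.\<close>

definition int_tail_distribution :: "real measure \<Rightarrow> real measure" where
  "int_tail_distribution F = interval_measure (\<lambda>x. if x < 0 then 0 else 1 - int_tail F x)"

definition (in prob_space) iid_nonneg :: "(int \<Rightarrow> 'a \<Rightarrow> real) \<Rightarrow> bool" where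
  "iid_nonneg X \<longleftrightarrow>
     indep_vars (\<lambda>_. borel) X UNIV \<and>
     (\<forall>n. distr M borel (X n) = distr M borel (X 0)) \<and>
     (\<forall>n. AE \<omega> in M. 0 \<le> X n \<omega>)"

text \<open>Interarrival times \<open>\<tau>\<close> with mean \<open>a\<close>, and service times \<open>\<sigma>1\<close>, \<open>\<sigma>2\<close> at the two stations
  with means \<open>b1\<close>, \<open>b2\<close>. The last assumption is mutual independence of the three sequences, as
  random elements of the space of two-sided real sequences.\<close>

locale tandem_queue = prob_space M for M :: "'a measure" +
  fixes \<tau> \<sigma>1 \<sigma>2 :: "int \<Rightarrow> 'a \<Rightarrow> real" and a b1 b2 :: real
  assumes iid_\<tau>: "iid_nonneg \<tau>" and iid_\<sigma>1: "iid_nonneg \<sigma>1" and iid_\<sigma>2: "iid_nonneg \<sigma>2"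
    and mean_\<tau>: "integrable M (\<tau> 0)" "expectation (\<tau> 0) = a"
    and mean_\<sigma>1: "integrable M (\<sigma>1 0)" "expectation (\<sigma>1 0) = b1"
    and mean_\<sigma>2: "integrable M (\<sigma>2 0)" "expectation (\<sigma>2 0) = b2"
    and indep: "indep_vars (\<lambda>_. PiM UNIV (\<lambda>_. borel)) (\<lambda>j \<omega> n. ([\<tau>, \<sigma>1, \<sigma>2] ! j) n \<omega>) {..<3::nat}"

text \<open>The suprema are taken in the extended reals.\<close>

definition stationary_wait ::
    "(int \<Rightarrow> 'a \<Rightarrow> real) \<Rightarrow> (int \<Rightarrow> 'a \<Rightarrow> real) \<Rightarrow> int \<Rightarrow> 'a \<Rightarrow> ereal" where
  "stationary_wait \<sigma> \<tau> n \<omega> =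
     (SUP k::nat. ereal (\<Sum>i=1..k. \<sigma> (n - int i) \<omega> - \<tau> (n - int i) \<omega>))"

text \<open>Interarrival times at the second station. The minimum is a real number, as
  \<open>stationary_wait \<sigma>1 \<tau> n \<omega> \<ge> 0\<close> (take \<open>k = 0\<close> in the supremum).\<close>

definition interarrival2 ::
    "(int \<Rightarrow> 'a \<Rightarrow> real) \<Rightarrow> (int \<Rightarrow> 'a \<Rightarrow> real) \<Rightarrow> int \<Rightarrow> 'a \<Rightarrow> real" where
  "interarrival2 \<sigma>1 \<tau> n \<omega> =
     - real_of_ereal (min 0 (stationary_wait \<sigma>1 \<tau> n \<omega> + ereal (\<sigma>1 n \<omega>) - ereal (\<tau> n \<omega>)))
     + \<sigma>1 (n + 1) \<omega>"

definition wait2 ::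
    "(int \<Rightarrow> 'a \<Rightarrow> real) \<Rightarrow> (int \<Rightarrow> 'a \<Rightarrow> real) \<Rightarrow> (int \<Rightarrow> 'a \<Rightarrow> real) \<Rightarrow> 'a \<Rightarrow> ereal" where
  "wait2 \<tau> \<sigma>1 \<sigma>2 = stationary_wait \<sigma>2 (interarrival2 \<sigma>1 \<tau>) 0"

lemma tail_integrable:
  assumes F: "distribution_nonneg F" and "integrable F (\<lambda>x. x)"
  shows "set_integrable lborel {0..} (tail F)"
proof -
  interpret real_distribution F using F by (simp add: distribution_nonneg_def)
  interpret lb: pair_sigma_finite lborel F
    by unfold_locales
  have mono: "mono (\<lambda>x. - tail F x)"
    by (auto simp: mono_def tail_def cdf_nondecreasing)
  have meas [measurable]: "tail F \<in> borel_measurable borel"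
    using borel_measurable_uminus[OF borel_measurable_mono[OF mono]] by simp
  have tl: "tail F x = measure F {x<..}" for x
  proof -
    have "UNIV - {..x} = {x<..}" by auto
    then show ?thesis using prob_compl[of "{..x}"] by (simp add: tail_def cdf_def)
  qed
  have nn: "0 \<le> tail F x" for x by (simp add: tl)
  have "(\<integral>\<^sup>+x. ennreal (indicator {0..} x *\<^sub>R tail F x) \<partial>lborel)
      = (\<integral>\<^sup>+x. (\<integral>\<^sup>+y. indicator {z. 0 \<le> fst z \<and> fst z < snd z} (x, y) \<partial>F) \<partial>lborel)"
  proof (intro nn_integral_cong)
    fix x :: real
    have "(\<integral>\<^sup>+y. indicator {z. 0 \<le> fst z \<and> fst z < snd z} (x, y) \<partial>F)
        = (\<integral>\<^sup>+y. indicator {0..} x * indicator {x<..} y \<partial>F)"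
      by (intro nn_integral_cong) (auto simp: indicator_def)
    also have "\<dots> = indicator {0..} x * emeasure F {x<..}"
      by (subst nn_integral_cmult) auto
    also have "\<dots> = ennreal (indicator {0..} x *\<^sub>R tail F x)"
      by (auto simp: indicator_def tl emeasure_eq_measure)
    finally show "ennreal (indicator {0..} x *\<^sub>R tail F x)
        = (\<integral>\<^sup>+y. indicator {z. 0 \<le> fst z \<and> fst z < snd z} (x, y) \<partial>F)" by simp
  qed
  also have "\<dots> = (\<integral>\<^sup>+y. (\<integral>\<^sup>+x. indicator {z. 0 \<le> fst z \<and> fst z < snd z} (x, y) \<partial>lborel) \<partial>F)"
    by (rule lb.Fubini'[symmetric]) measurable
  also have "\<dots> = (\<integral>\<^sup>+y. ennreal (norm y) \<partial>F)"
  proof (intro nn_integral_cong_AE)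
    have "AE x in F. 0 \<le> x" using F by (simp add: distribution_nonneg_def)
    then show "AE y in F. (\<integral>\<^sup>+x. indicator {z. 0 \<le> fst z \<and> fst z < snd z} (x, y) \<partial>lborel)
        = ennreal (norm y)"
    proof eventually_elim
      case (elim y)
      have "(\<integral>\<^sup>+x. indicator {z. 0 \<le> fst z \<and> fst z < snd z} (x, y) \<partial>lborel)
          = (\<integral>\<^sup>+x. indicator {0..<y} x \<partial>lborel)"
        by (intro nn_integral_cong) (auto simp: indicator_def)
      then show ?case using elim by simp
    qed
  qed
  also have "\<dots> < \<infinity>"
    using assms(2) by (simp add: integrable_iff_bounded)
  finally have fin: "(\<integral>\<^sup>+x. ennreal (indicator {0..} x *\<^sub>R tail F x) \<partial>lborel) < \<infinity>" .
  then show ?thesis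
    unfolding set_integrable_def
    by (intro integrableI_nonneg) (auto simp: nn)
qed

lemma int_tail_distribution:
  assumes F: "distribution_nonneg F" and "integrable F (\<lambda>x. x)"
  shows "distribution_nonneg (int_tail_distribution F)"
    and "\<And>x. 0 \<le> x \<Longrightarrow> tail (int_tail_distribution F) x = int_tail F x"
    and "\<And>x. x < 0 \<Longrightarrow> tail (int_tail_distribution F) x = 1"
proof -
  interpret real_distribution F using F by (simp add: distribution_nonneg_def)
  define g where "g x = (LBINT u:{x..}. tail F u)" for x
  define G where "G x = (if x < 0 then 0 else 1 - int_tail F x)" for x
  have nn: "0 \<le> tail F x" "tail F x \<le> 1" for x
    using cdf_bounded_prob[of x] cdf_nonneg[of x] by (auto simp: tail_def)
  have int0: "set_integrable lborel A (tail F)" if "A \<in> sets borel" "A \<subseteq> {0..}" for A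
    using set_integrable_subset[OF tail_integrable[OF assms], of A] that by simp
  have split: "g x = (LBINT u:{x..<y}. tail F u) + g y" if "0 \<le> x" "x \<le> y" for x y
  proof -
    have "{x..} = {x..<y} \<union> {y..}" using that by auto
    then show ?thesis unfolding g_def
      using set_integral_Un[of "{x..<y}" "{y..}" lborel "tail F"] int0[of "{x..<y}"] int0[of "{y..}"] that
      by (simp add: ivl_disj_int subset_iff)
  qed
  have inc: "0 \<le> (LBINT u:{x..<y}. tail F u)" "(LBINT u:{x..<y}. tail F u) \<le> y - x"
    if "0 \<le> x" "x \<le> y" for x y
  proof -
    show "0 \<le> (LBINT u:{x..<y}. tail F u)"
      unfolding set_lebesgue_integral_def by (intro integral_nonneg_AE) (auto simp: nn)
    have one: "set_integrable lborel {x..<y} (\<lambda>_. 1 :: real)"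
      unfolding set_integrable_def using that by (auto intro!: integrable_real_indicator)
    have "(LBINT u:{x..<y}. tail F u) \<le> (LBINT u:{x..<y}. 1)"
      using int0[of "{x..<y}"] that one by (intro set_integral_mono) (auto simp: nn subset_iff)
    also have "\<dots> = y - x" using that by (simp add: set_lebesgue_integral_def)
    finally show "(LBINT u:{x..<y}. tail F u) \<le> y - x" .
  qed
  have g_nn: "0 \<le> g x" for x
    unfolding g_def set_lebesgue_integral_def by (intro integral_nonneg_AE) (auto simp: nn)
  have it: "int_tail F x = min 1 (g x)" for x by (simp add: int_tail_def g_def)
  have lip: "\<bar>g x - g y\<bar> \<le> \<bar>y - x\<bar>" if "0 \<le> x" "0 \<le> y" for x y
    using split[of x y] split[of y x] inc[of x y] inc[of y x] that by (cases "x \<le> y") linarith+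
  have g_cont: "continuous_on {0..} g"
    unfolding continuous_on_iff
  proof (intro ballI allI impI)
    fix x e :: real assume "x \<in> {0..}" "0 < e"
    moreover have "dist (g x') (g x) < e" if "x' \<in> {0..}" "dist x' x < e" for x'
      using lip[of x' x] that \<open>x \<in> {0..}\<close> by (simp add: dist_real_def)
    ultimately show "\<exists>d>0. \<forall>x'\<in>{0..}. dist x' x < d \<longrightarrow> dist (g x') (g x) < e"
      by blast
  qed
  have mono_G: "G x \<le> G y" if "x \<le> y" for x y
  proof (cases "x < 0")
    case True
    then show ?thesis using g_nn by (simp add: G_def it)
  next
    case False
    then have "g y \<le> g x" using split[of x y] inc(1)[of x y] that by linarith
    then show ?thesis using that False by (simp add: G_def it min_def)
  qed
  have cont_G: "continuous (at_right x) G" for x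
  proof (cases "x < 0")
    case True
    have "eventually (\<lambda>y. y \<in> {x<..<0}) (at_right x)"
      using True by (rule eventually_at_right_real)
    then have ev: "eventually (\<lambda>y. G y = G x) (at_right x)"
      by eventually_elim (use True in \<open>auto simp: G_def\<close>)
    have "(G \<longlongrightarrow> G x) (at_right x)"
      using tendsto_cong[OF ev] by simp
    then show ?thesis by (simp add: continuous_within)
  next
    case False
    have "(g \<longlongrightarrow> g x) (at x within {0..})"
      using g_cont False by (auto simp: continuous_on_def)
    then have gx: "(g \<longlongrightarrow> g x) (at_right x)"
      by (rule tendsto_within_subset) (use False in auto)
    have "((\<lambda>y. 1 - min 1 (g y)) \<longlongrightarrow> 1 - min 1 (g x)) (at_right x)"
      by (intro tendsto_intros gx)
    moreover have "eventually (\<lambda>y. 1 - min 1 (g y) = G y) (at_right x)"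
      using eventually_at_right_less[of x]
      by eventually_elim (use False in \<open>auto simp: G_def it\<close>)
    ultimately have "(G \<longlongrightarrow> 1 - min 1 (g x)) (at_right x)"
      by (rule Lim_transform_eventually)
    then show ?thesis using False by (simp add: continuous_within G_def it)
  qed
  have G_bot: "(G \<longlongrightarrow> 0) at_bot"
    by (rule tendsto_eventually)
      (auto simp: eventually_at_bot_linorder G_def intro!: exI[of _ "-1"])
  have "((\<lambda>y. LBINT u:{0..y}. tail F u) \<longlongrightarrow> (LBINT u:{0..}. tail F u)) at_top"
    by (rule tendsto_set_lebesgue_integral_at_top) (use tail_integrable[OF assms] in auto)
  moreover have "(LBINT u:{0..y}. tail F u) = (LBINT u:{0..<y}. tail F u)" for y
  proof -
    have *: "AE u in lborel. u \<noteq> y" by (rule AE_lborel_singleton)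
    have meas: "set_borel_measurable lborel A (tail F)" if "A \<in> sets borel" "A \<subseteq> {0..}" for A
      using int0[OF that] by (auto simp: set_borel_measurable_def set_integrable_def)
    show ?thesis
    proof (rule set_integral_cong_set)
      show "AE u in lborel. (u \<in> {0..<y}) = (u \<in> {0..y})"
        using * by eventually_elim auto
    qed (rule meas; auto)+
  qed
  ultimately have "((\<lambda>y. LBINT u:{0..<y}. tail F u) \<longlongrightarrow> g 0) at_top"
    by (simp add: g_def)
  from tendsto_diff[OF tendsto_const[of "g 0"] this]
  have "((\<lambda>y. g 0 - (LBINT u:{0..<y}. tail F u)) \<longlongrightarrow> 0) at_top" by simp
  moreover have "eventually (\<lambda>y. g 0 - (LBINT u:{0..<y}. tail F u) = g y) at_top"
    using eventually_ge_at_top[of 0] by eventually_elim (use split in auto)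
  ultimately have "(g \<longlongrightarrow> 0) at_top"
    by (rule Lim_transform_eventually)
  then have "((\<lambda>y. 1 - min 1 (g y)) \<longlongrightarrow> 1 - min 1 0) at_top"
    by (intro tendsto_intros)
  moreover have "eventually (\<lambda>y. 1 - min 1 (g y) = G y) at_top"
    using eventually_ge_at_top[of 0] by eventually_elim (auto simp: G_def it)
  ultimately have G_top: "(G \<longlongrightarrow> 1) at_top"
    by (simp add: Lim_transform_eventually)
  have GI: "int_tail_distribution F = interval_measure G"
    by (simp add: int_tail_distribution_def G_def [abs_def])
  have rd: "real_distribution (interval_measure G)"
    by (rule real_distribution_interval_measure) (fact mono_G cont_G G_bot G_top)+
  have cdf: "cdf (interval_measure G) = G"
    by (rule cdf_interval_measure) (fact mono_G cont_G G_bot G_top)+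
  show "tail (int_tail_distribution F) x = int_tail F x" if "0 \<le> x" for x
    using that by (simp add: tail_def GI cdf G_def)
  show "tail (int_tail_distribution F) x = 1" if "x < 0" for x
    using that by (simp add: tail_def GI cdf G_def)
  interpret H: real_distribution "interval_measure G" by (rule rd)
  have "(cdf (interval_measure G) \<longlongrightarrow> measure (interval_measure G) {..<0}) (at_left 0)"
    by (rule H.cdf_at_left)
  moreover have "eventually (\<lambda>y. G y = 0) (at_left 0)"
    by (auto simp: eventually_at_filter G_def)
  then have "(G \<longlongrightarrow> 0) (at_left 0)" by (rule tendsto_eventually)
  ultimately have "measure (interval_measure G) {..<0} = 0"
    using tendsto_unique[OF trivial_limit_at_left_real] unfolding cdf by blast
  then have "{..<0} \<in> null_sets (interval_measure G)"
    by (auto simp: null_sets_def H.emeasure_eq_measure)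
  then have "AE x in interval_measure G. 0 \<le> x"
    by (rule AE_I') auto
  then show "distribution_nonneg (int_tail_distribution F)"
    using rd by (simp add: distribution_nonneg_def GI)
qed

end

theory Submission
  imports Defs
begin

text \<open>Reverse time, so that index \<open>i\<close> stands for customer \<open>- i\<close>. By telescoping, the waiting time \<open>W\<close> at
  the second station is at most \<open>V\<close>, the supremum over \<open>j \<ge> 1\<close> of the weights of the paths which collect
  \<open>\<sigma>2\<close> up to some customer and \<open>\<sigma>1\<close> from there to customer \<open>j\<close>, minus the interarrival times.

  The weights are subadditive and stay below a line of slope \<open>- c\<close>, for \<open>c < a - b\<close>, with high
  probability. Restarting at the first exceedance of the line, as in Zachary's proof of Veraverbeke's
  theorem, gives \<open>P(V > x) \<le> ((d1 + d2) / (a - b) + o(1)) F\<^sup>s(x)\<close>.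

  Two kinds of events explain all of this mass up to \<open>o(F\<^sup>s(x))\<close>. A jump of \<open>\<sigma>2\<close> above
  \<open>x + n (a - b)\<close> at time \<open>- n\<close> makes \<open>W > x\<close>. After a jump of \<open>\<sigma>1\<close> of that size the first station stays
  busy up to time \<open>0\<close>, so the second one is a critical queue, and \<open>W\<close> is, up to a bounded variable, the
  maximum of \<open>n\<close> partial sums of centred variables of variance \<open>v\<^sup>2\<close>. By the central limit theorem and a
  first passage argument it exceeds \<open>x\<close> with probability about twice the normal tail at
  \<open>x / (v sqrt n)\<close>, uniformly in \<open>n\<close>. The lower bound for \<open>P(W > x)\<close> sums both kinds of events; the upper bound
  subtracts from \<open>P(V > x)\<close> the events where \<open>\<sigma>1\<close> jumps and \<open>W \<le> x\<close>.\<close>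

section \<open>Paths in the tandem network\<close>

text \<open>The spacings at the second station are dependent, so \<open>W\<close> itself has no
  convenient restart. \<open>V\<close> has one, because path weights are subadditive, but
  \<open>V\<close> is too large: a jump of \<open>\<sigma>1\<close> nearly always lifts it above
  \<open>x\<close>, whereas \<open>W\<close> follows only with about twice a normal tail as
  probability, the factor 2 coming from reflection. The sharp constant for \<open>V\<close>
  therefore matters: when the events with \<open>W \<le> x < V\<close> are subtracted, the term with
  \<open>d1 / (a - b)\<close> must cancel and leave the normal factor behind. Summed over the jump
  time \<open>n\<close>, the products of \<open>tail F (x + n (a - b))\<close> with this factor form
  a Riemann sum of the integral in the theorem, with \<open>y\<close> in the role of
  \<open>n\<close>. Finite variances give no rate in the central limit theorem. An error uniform in
  \<open>n\<close> suffices, since it is multiplied by the total jump probability, which is of the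
  order of the integrated tail at \<open>x\<close>; two jumps cost the square of that. A centred
  walk takes a time of order \<open>x^2\<close> to reach \<open>x\<close>, whence the comparison of
  the integrated tail at \<open>x^2\<close> and \<open>x\<close> in case (ii).\<close>

definition shift :: "nat \<Rightarrow> (nat \<Rightarrow> real) \<Rightarrow> nat \<Rightarrow> real" where
  "shift m f i = f (m + i)"

lemma shift_0 [simp]: "shift 0 f = f"
  by (simp add: shift_def fun_eq_iff)

lemma shift_shift [simp]: "shift m (shift n f) = shift (n + m) f"
  by (simp add: shift_def fun_eq_iff add.assoc)

definition lind :: "(nat \<Rightarrow> real) \<Rightarrow> (nat \<Rightarrow> real) \<Rightarrow> ereal" where
  "lind s u = (SUP k. ereal (\<Sum>i=1..k. s i - u i))"

text \<open>This is the spacing at the second station after customer \<open>- i\<close>. The service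
  time of customer \<open>- i + 1\<close> sits at the reversed index \<open>i - 1\<close>; all sums
  of gaps start at \<open>i = 1\<close>, so truncated subtraction does no harm.\<close>

definition gap :: "(nat \<Rightarrow> real) \<Rightarrow> (nat \<Rightarrow> real) \<Rightarrow> nat \<Rightarrow> real" where
  "gap s u i = - real_of_ereal (min 0 (lind (shift i s) (shift i u) + ereal (s i) - ereal (u i))) + s (i - 1)"

text \<open>The maximum over \<open>1 \<le> k \<le> j\<close> of the weight of the path with \<open>t\<close> up to index \<open>k\<close> and \<open>s\<close> from \<open>k\<close> to \<open>j\<close>.\<close>

fun passage :: "(nat \<Rightarrow> real) \<Rightarrow> (nat \<Rightarrow> real) \<Rightarrow> nat \<Rightarrow> real" where
  "passage s t 0 = 0"
| "passage s t (Suc j) = max (passage s t j) (\<Sum>i=1..Suc j. t i) + s (Suc j)"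

definition dater :: "(nat \<Rightarrow> real) \<Rightarrow> (nat \<Rightarrow> real) \<Rightarrow> (nat \<Rightarrow> real) \<Rightarrow> nat \<Rightarrow> real" where
  "dater s t u j = passage s t j - (\<Sum>i=1..j. u i)"

lemma lind_nonneg: "0 \<le> lind s u"
  unfolding lind_def by (rule SUP_upper2[of 0]) auto

lemma lind_ge: "ereal (\<Sum>i=1..k. s i - u i) \<le> lind s u"
  unfolding lind_def by (rule SUP_upper) auto

lemma lind_le: "(\<And>k. (\<Sum>i=1..k. s i - u i) \<le> x) \<Longrightarrow> lind s u \<le> ereal x"
  unfolding lind_def by (rule SUP_least) auto

lemma sum_shift_split:
  fixes f :: "nat \<Rightarrow> real"
  shows "(\<Sum>i=1..m + k. f i) = (\<Sum>i=1..m. f i) + (\<Sum>i=1..k. f (m + i))"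
  by (induction k) auto

lemma sum_Suc_head:
  fixes f :: "nat \<Rightarrow> real"
  shows "(\<Sum>i=1..Suc k. f i) = f 1 + (\<Sum>i=1..k. f (Suc i))"
  using sum_shift_split[of f 1 k] by simp

text \<open>Lindley's recursion: the term \<open>k = 0\<close> of the supremum contributes 0, and
  all other terms share the first increment.\<close>

lemma lindley:
  "lind s u = max 0 (lind (shift 1 s) (shift 1 u) + ereal (s 1) - ereal (u 1))"
proof -
  let ?f = "\<lambda>k. ereal (\<Sum>i=1..k. s i - u i)"
  let ?g = "\<lambda>k. ereal (\<Sum>i=1..k. shift 1 s i - shift 1 u i)"
  have "lind s u = sup (?f 0) (SUP k. ?f (Suc k))"
  proof -
    have "range ?f = insert (?f 0) (range (\<lambda>k. ?f (Suc k)))"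
      by (subst UNIV_nat_eq) (simp add: image_image)
    then have "Sup (range ?f) = Sup (insert (?f 0) (range (\<lambda>k. ?f (Suc k))))" by (rule arg_cong)
    then show ?thesis unfolding lind_def complete_lattice_class.Sup_insert .
  qed
  also have "(SUP k. ?f (Suc k)) = (SUP k. ?g k + ereal (s 1 - u 1))"
    by (intro SUP_cong refl) (simp only: sum_Suc_head, simp add: shift_def)
  also have "\<dots> = lind (shift 1 s) (shift 1 u) + ereal (s 1 - u 1)"
    unfolding lind_def by (rule SUP_ereal_add_left) auto
  also have "\<dots> = lind (shift 1 s) (shift 1 u) + ereal (s 1) - ereal (u 1)"
    by (cases "lind (shift 1 s) (shift 1 u)") auto
  finally show ?thesis by (simp add: sup_max zero_ereal_def)
qed

lemma lindley_shift:
  "lind (shift m s) (shift m u)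
     = max 0 (lind (shift (Suc m) s) (shift (Suc m) u) + ereal (s (Suc m)) - ereal (u (Suc m)))"
  using lindley[of "shift m s" "shift m u"] by (simp add: shift_def[of m _ 1] shift_def[of m _ "Suc 0"])

lemma lind_shift_finite: "lind s u < \<infinity> \<Longrightarrow> lind (shift m s) (shift m u) < \<infinity>"
proof (induction m)
  case (Suc m)
  then show ?case using lindley_shift[of m s u]
    by (cases "lind (shift (Suc m) s) (shift (Suc m) u)") (auto simp: max_def split: if_splits)
qed simp

text \<open>Since \<open>- min 0 y = max 0 y - y\<close>, each gap is \<open>u i\<close> plus the
  difference of the sojourn times (waiting plus service) at the first station for the indices
  \<open>i - 1\<close> and \<open>i\<close>. These differences telescope.\<close>

lemma sum_gap:
  assumes "lind s u < \<infinity>"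
  shows "(\<Sum>i=1..k. gap s u i)
    = (\<Sum>i=1..k. u i) + real_of_ereal (lind s u) + s 0 - real_of_ereal (lind (shift k s) (shift k u)) - s k"
proof (induction k)
  case (Suc k)
  obtain w0 w1 where w: "lind (shift k s) (shift k u) = ereal w0"
      "lind (shift (Suc k) s) (shift (Suc k) u) = ereal w1"
    using lind_shift_finite[OF assms, of k] lind_shift_finite[OF assms, of "Suc k"]
      lind_nonneg[of "shift k s" "shift k u"] lind_nonneg[of "shift (Suc k) s" "shift (Suc k) u"]
    by (cases "lind (shift k s) (shift k u)"; cases "lind (shift (Suc k) s) (shift (Suc k) u)") auto
  have "w0 = max 0 (w1 + s (Suc k) - u (Suc k))"
    using lindley_shift[of k s u] by (simp add: w max_def zero_ereal_def split: if_splits)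
  moreover have "gap s u (Suc k) = - min 0 (w1 + s (Suc k) - u (Suc k)) + s k"
    by (simp add: gap_def w min_def zero_ereal_def)
  ultimately show ?case using Suc.IH by (simp add: w max_def min_def split: if_splits)
qed simp

lemma gap_nonneg:
  assumes "\<And>i. 0 \<le> s i" shows "0 \<le> gap s u i"
proof -
  let ?x = "min 0 (lind (shift i s) (shift i u) + ereal (s i) - ereal (u i))"
  have "?x \<le> 0" by simp
  then have "real_of_ereal ?x \<le> 0" by (cases ?x) auto
  then show ?thesis using assms[of "i - 1"] unfolding gap_def by linarith
qed

lemma gap_shift: "1 \<le> i \<Longrightarrow> gap (shift m s) (shift m u) i = gap s u (m + i)"
  by (simp add: gap_def shift_def[of m _ i] shift_def[of m _ "i - Suc 0"])

lemma passage_ge_sum: "(\<Sum>i=1..j. t i) \<le> passage s t j" if "\<And>i. 0 \<le> s i"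
  using that by (cases j) (auto simp: add_increasing2 le_max_iff_disj)

lemma passage_Suc_le:
  "(\<And>i. 0 \<le> s i) \<Longrightarrow> (\<And>i. 0 \<le> t i) \<Longrightarrow> passage s t (Suc j) \<le> passage s t j + t (Suc j) + s (Suc j)"
  using passage_ge_sum[of s t j] by simp

text \<open>Cut a path at \<open>j\<close>. If it still collects \<open>t\<close> there, the part up
  to \<open>j\<close> is at most \<open>passage s t j\<close> because \<open>s\<close> is
  nonnegative; if it has already switched, the remainder collects only \<open>s\<close>.\<close>

lemma passage_add:
  assumes "\<And>i. 0 \<le> s i"
  shows "passage s t (j + i) \<le> passage s t j + passage (shift j s) (shift j t) i"
proof (induction i)
  case (Suc i)
  have "(\<Sum>i=1..j + Suc i. t i) \<le> passage s t j + (\<Sum>i=1..Suc i. shift j t i)"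
    unfolding sum_shift_split[of t j] using passage_ge_sum[OF assms, of t j] by (simp add: shift_def)
  moreover have "shift j s (Suc i) = s (Suc (j + i))" by (simp add: shift_def)
  ultimately show ?case using Suc by (auto simp: max_def)
qed simp

lemma passage_ge_path:
  "1 \<le> k \<Longrightarrow> (\<Sum>i=1..k. t i) + (\<Sum>i=k..k + j. s i) \<le> passage s t (k + j)"
proof (induction j)
  case 0
  then show ?case by (cases k) auto
next
  case (Suc j)
  then show ?case by simp
qed

text \<open>Nonnegativity of \<open>t\<close> lets a switch at index 1 beat the initial value 0, so
  the maximum is attained by a genuine path.\<close>

lemma passage_path:
  "\<exists>k\<ge>1. k \<le> Suc j \<and> passage s t (Suc j) = (\<Sum>i=1..k. t i) + (\<Sum>i=k..Suc j. s i)" if "\<And>i. 0 \<le> t i"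
proof (induction j)
  case 0
  then show ?case using that[of 1] by (auto intro!: exI[of _ 1])
next
  case (Suc j)
  then obtain k where k: "k \<ge> 1" "k \<le> Suc j" "passage s t (Suc j) = (\<Sum>i=1..k. t i) + (\<Sum>i=k..Suc j. s i)"
    by blast
  show ?case
  proof (cases "passage s t (Suc j) \<le> (\<Sum>i=1..Suc (Suc j). t i)")
    case True
    then show ?thesis by (intro exI[of _ "Suc (Suc j)"]) (auto simp: max_def)
  next
    case False
    then show ?thesis using k by (intro exI[of _ k]) (auto simp: max_def)
  qed
qed

text \<open>This forces a large sum of the two service times at any step where the weight crosses a
  line.\<close>

lemma dater_Suc_le:
  "(\<And>i. 0 \<le> s i) \<Longrightarrow> (\<And>i. 0 \<le> t i) \<Longrightarrow> (\<And>i. 0 \<le> u i) \<Longrightarrow>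
    dater s t u (Suc j) \<le> dater s t u j + t (Suc j) + s (Suc j)"
  using passage_Suc_le[of s t j] by (simp add: dater_def del: passage.simps) (smt (verit))

lemma dater_0 [simp]: "dater s t u 0 = 0"
  by (simp add: dater_def)

lemma dater_add:
  "(\<And>i. 0 \<le> s i) \<Longrightarrow> dater s t u (j + i) \<le> dater s t u j + dater (shift j s) (shift j t) (shift j u) i"
  using passage_add[of s t j i] sum_shift_split[of u j i]
  by (simp add: dater_def) (simp add: shift_def)

text \<open>The arrival process to the second station cancels by telescoping, and what is left is the
  weight of a path that switches from the second station to the first one.\<close>

lemma wait2_le_dater:
  assumes nn: "\<And>i. 0 \<le> s i" "\<And>i. 0 \<le> t i"
    and le: "\<And>j. 1 \<le> j \<Longrightarrow> dater s t u j \<le> x" and "0 \<le> x"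
  shows "(\<Sum>i=1..k. t i - gap s u i) \<le> x"
proof (cases "k = 0")
  case False
  have path: "(\<Sum>i=1..k. t i) + (\<Sum>i=k..k + j. s i) - (\<Sum>i=1..k + j. u i) \<le> x" if "1 \<le> k" for k j
    using passage_ge_path[OF that, of t s j] le[of "k + j"] that by (simp add: dater_def)
  have "lind s u \<le> ereal x"
  proof (rule lind_le)
    fix k show "(\<Sum>i=1..k. s i - u i) \<le> x"
    proof (cases k)
      case 0
      then show ?thesis using \<open>0 \<le> x\<close> by simp
    next
      case (Suc j)
      then show ?thesis using path[of 1 j] nn(2)[of 1] by (simp add: sum_subtractf)
    qed
  qed
  then have fin: "lind s u < \<infinity>" by (auto simp: less_top[symmetric])
  have "lind (shift k s) (shift k u) \<le> ereal (x - (\<Sum>i=1..k. t i - u i) - s k)"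
  proof (rule lind_le)
    fix j
    have "(\<Sum>i=k..k + j. s i) = s k + (\<Sum>i=1..j. shift k s i)"
      by (induction j) (auto simp: shift_def)
    then show "(\<Sum>i=1..j. shift k s i - shift k u i) \<le> x - (\<Sum>i=1..k. t i - u i) - s k"
      using path[of k j] False sum_shift_split[of u k j] by (simp add: sum_subtractf shift_def)
  qed
  then have "real_of_ereal (lind (shift k s) (shift k u)) \<le> x - (\<Sum>i=1..k. t i - u i) - s k"
    using lind_shift_finite[OF fin, of k] lind_nonneg[of "shift k s" "shift k u"]
    by (cases "lind (shift k s) (shift k u)") auto
  moreover have "0 \<le> real_of_ereal (lind s u)" by (intro real_of_ereal_pos lind_nonneg)
  ultimately show ?thesis using sum_gap[OF fin, of k] nn(1)[of 0] by (simp add: sum_subtractf)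
qed (use \<open>0 \<le> x\<close> in simp)

lemma lind_gap_le_dater:
  assumes "\<And>i. 0 \<le> s i" "\<And>i. 0 \<le> t i" "\<And>j. 1 \<le> j \<Longrightarrow> dater s t u j \<le> x" "0 \<le> x"
  shows "lind t (gap s u) \<le> ereal x"
  using wait2_le_dater[of s t u x] assms by (intro lind_le) auto

text \<open>In \<open>sum_gap\<close> both terms at index \<open>k\<close> enter negatively and are
  dropped: the first station stretches the first \<open>k\<close> gaps by at most
  \<open>w + s 0\<close> in total. A large \<open>t k\<close> therefore reaches the second station's
  waiting time almost undiminished.\<close>

lemma lind_gap_ge:
  assumes "lind s u \<le> ereal w" and "0 \<le> s k"
  shows "ereal ((\<Sum>i=1..k. t i - u i) - w - s 0) \<le> lind t (gap s u)"
proof -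
  have fin: "lind s u < \<infinity>" using assms(1) by (auto simp: less_top[symmetric])
  have "real_of_ereal (lind s u) \<le> w"
    using assms(1) lind_nonneg[of s u] by (cases "lind s u") auto
  moreover have "0 \<le> real_of_ereal (lind (shift k s) (shift k u))"
    by (intro real_of_ereal_pos lind_nonneg)
  ultimately have "(\<Sum>i=1..k. t i - u i) - w - s 0 \<le> (\<Sum>i=1..k. t i - gap s u i)"
    using sum_gap[OF fin, of k] assms(2) by (simp add: sum_subtractf)
  then show ?thesis using lind_ge[of t "gap s u" k] by (meson ereal_less_eq(3) order_trans)
qed

text \<open>The sum from \<open>i\<close> to \<open>n\<close> is one of the candidates for the
  backlog that the next customer finds. If it is nonnegative, the server does not idle and the
  minimum in \<open>gap\<close> is 0.\<close>

lemma gap_busy: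
  assumes busy: "0 \<le> (\<Sum>j=i..n. s j - u j)" and "1 \<le> i" "i \<le> n"
  shows "gap s u i = s (i - 1)"
proof -
  have "(\<Sum>j=i..n. s j - u j) = (s i - u i) + (\<Sum>j=1..n - i. shift i s j - shift i u j)"
  proof -
    have "(\<Sum>j=i..i + k. s j - u j) = (s i - u i) + (\<Sum>j=1..k. shift i s j - shift i u j)" for k
      by (induction k) (auto simp: shift_def)
    from this[of "n - i"] show ?thesis using assms by simp
  qed
  then have "0 \<le> ereal (s i - u i) + lind (shift i s) (shift i u)"
    using busy lind_ge[of "shift i s" "shift i u" "n - i"]
    by (cases "lind (shift i s) (shift i u)") auto
  then have "min 0 (lind (shift i s) (shift i u) + ereal (s i) - ereal (u i)) = 0"
    by (cases "lind (shift i s) (shift i u)") (auto simp: min_def)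
  then show ?thesis by (simp add: gap_def)
qed

text \<open>While the first station is busy, the second one sees the departures spaced by the service
  times of the first.\<close>

lemma lind_gap_busy_ge:
  assumes "\<And>i. 1 \<le> i \<Longrightarrow> i \<le> n \<Longrightarrow> 0 \<le> (\<Sum>j=i..n. s j - u j)" and "k \<le> n"
  shows "ereal (\<Sum>i=1..k. t i - s (i - 1)) \<le> lind t (gap s u)"
proof -
  have "(\<Sum>i=1..k. t i - gap s u i) = (\<Sum>i=1..k. t i - s (i - 1))"
    using assms by (intro sum.cong refl) (auto simp: gap_busy[where n=n])
  then show ?thesis using lind_ge[of t "gap s u" k] by simp
qed

text \<open>The sums are cut after the busy stretch. Up to \<open>n\<close> the gaps are service
  times. Index \<open>n + 1\<close>, whose gap contains the service time \<open>s n\<close>, costs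
  at most \<open>t (Suc n)\<close>. Beyond it the bound by path weights applies to the shifted
  sequences.\<close>

lemma lind_gap_busy_le:
  assumes nn: "\<And>i. 0 \<le> s i" "\<And>i. 0 \<le> t i"
    and busy: "\<And>i. 1 \<le> i \<Longrightarrow> i \<le> n \<Longrightarrow> 0 \<le> (\<Sum>j=i..n. s j - u j)"
    and max: "\<And>k. k \<le> n \<Longrightarrow> (\<Sum>i=1..k. t i - s (i - 1)) \<le> m"
    and le: "\<And>j. 1 \<le> j \<Longrightarrow> dater (shift (Suc n) s) (shift (Suc n) t) (shift (Suc n) u) j \<le> y"
    and "0 \<le> y"
  shows "lind t (gap s u) \<le> ereal (m + t (Suc n) + y)"
proof (rule lind_le)
  fix k
  have eq: "(\<Sum>i=1..k. t i - gap s u i) = (\<Sum>i=1..k. t i - s (i - 1))" if "k \<le> n" for k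
    using that busy by (intro sum.cong refl) (auto simp: gap_busy[where n=n])
  have n: "(\<Sum>i=1..n. t i - gap s u i) \<le> m" using eq[of n] max[of n] by simp
  have g: "0 \<le> gap s u (Suc n)" by (rule gap_nonneg[OF nn(1)])
  consider "k \<le> n" | j where "k = Suc n + j" by (metis less_eqE not_less_eq_eq)
  then show "(\<Sum>i=1..k. t i - gap s u i) \<le> m + t (Suc n) + y"
  proof cases
    case 1
    then show ?thesis using eq[of k] max[of k] nn(2)[of "Suc n"] \<open>0 \<le> y\<close> by simp
  next
    case (2 j)
    have "(\<Sum>i=1..j. t (Suc n + i) - gap s u (Suc n + i))
        = (\<Sum>i=1..j. shift (Suc n) t i - gap (shift (Suc n) s) (shift (Suc n) u) i)"
      by (intro sum.cong refl) (auto simp: gap_shift, simp add: shift_def)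
    also have "\<dots> \<le> y"
    proof (rule wait2_le_dater)
      show "0 \<le> shift (Suc n) s i" "0 \<le> shift (Suc n) t i" for i using nn by (simp_all add: shift_def)
    qed (use le \<open>0 \<le> y\<close> in auto)
    finally show ?thesis unfolding 2 sum_shift_split[of _ "Suc n" j]
      using n g by simp
  qed
qed

section \<open>Independent sequences\<close>

text \<open>Stated for functions of the whole family rather than through sub-sigma-algebras, so that
  independence reduces to disjointness of sets of coordinates.\<close>

definition depends_on :: "'i set \<Rightarrow> (('i \<Rightarrow> 'b) \<Rightarrow> 'c) \<Rightarrow> bool" where
  "depends_on A g \<longleftrightarrow> (\<forall>f f'. (\<forall>i\<in>A. f i = f' i) \<longrightarrow> g f = g f')"

lemma depends_onI: "(\<And>f f'. (\<And>i. i \<in> A \<Longrightarrow> f i = f' i) \<Longrightarrow> g f = g f') \<Longrightarrow> depends_on A g"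
  unfolding depends_on_def by blast

lemma depends_onD: "depends_on A g \<Longrightarrow> (\<And>i. i \<in> A \<Longrightarrow> f i = f' i) \<Longrightarrow> g f = g f'"
  unfolding depends_on_def by blast

lemma (in prob_space) indep_var_depends_on:
  fixes X :: "'i \<Rightarrow> 'a \<Rightarrow> real"
  assumes ind: "indep_vars (\<lambda>_. borel) X UNIV"
    and g [measurable]: "g \<in> measurable (PiM UNIV (\<lambda>_. borel)) S"
    and h [measurable]: "h \<in> measurable (PiM UNIV (\<lambda>_. borel)) T"
    and dep: "depends_on A g" "depends_on B h" and disj: "A \<inter> B = {}"
  shows "indep_var S (\<lambda>\<omega>. g (\<lambda>i. X i \<omega>)) T (\<lambda>\<omega>. h (\<lambda>i. X i \<omega>))"
proof -
  \<comment> \<open>Extends a restricted family by 0; a function that depends on \<open>C\<close>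
    only cannot see the value chosen outside.\<close>
  let ?e = "\<lambda>C r i. if i \<in> C then r i else (0::real)"
  have e [measurable]: "?e C \<in> measurable (PiM C (\<lambda>_. borel)) (PiM UNIV (\<lambda>_. borel))" for C :: "'i set"
  proof (rule measurable_PiM_single')
    show "(\<lambda>r. ?e C r i) \<in> borel_measurable (PiM C (\<lambda>_. borel))" for i
      by (cases "i \<in> C") auto
  qed (auto simp: space_PiM)
  have "indep_var (PiM A (\<lambda>_. borel)) (\<lambda>\<omega>. restrict (\<lambda>i. X i \<omega>) A)
                  (PiM B (\<lambda>_. borel)) (\<lambda>\<omega>. restrict (\<lambda>i. X i \<omega>) B)"
    by (rule indep_var_restrict[OF ind disj]) auto
  then have "indep_var S ((g \<circ> ?e A) \<circ> (\<lambda>\<omega>. restrict (\<lambda>i. X i \<omega>) A))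
                       T ((h \<circ> ?e B) \<circ> (\<lambda>\<omega>. restrict (\<lambda>i. X i \<omega>) B))"
    by (rule indep_var_compose) (rule measurable_comp[OF e g] measurable_comp[OF e h])+
  moreover have "(g \<circ> ?e A) \<circ> (\<lambda>\<omega>. restrict (\<lambda>i. X i \<omega>) A) = (\<lambda>\<omega>. g (\<lambda>i. X i \<omega>))"
    unfolding comp_def by (rule ext, rule depends_onD[OF dep(1)]) simp
  moreover have "(h \<circ> ?e B) \<circ> (\<lambda>\<omega>. restrict (\<lambda>i. X i \<omega>) B) = (\<lambda>\<omega>. h (\<lambda>i. X i \<omega>))"
    unfolding comp_def by (rule ext, rule depends_onD[OF dep(2)]) simp
  ultimately show ?thesis by simp
qed

lemma indep_vars_PiM_coordinates:
  fixes \<mu> :: "'i \<Rightarrow> real measure"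
  assumes \<mu>: "\<And>i. real_distribution (\<mu> i)"
  shows "prob_space.indep_vars (PiM UNIV \<mu>) (\<lambda>_. borel) (\<lambda>i f. f i) UNIV"
proof -
  have ps: "prob_space (\<mu> i)" for i using \<mu>[of i] by (simp add: real_distribution_def)
  have sets [measurable_cong, simp]: "sets (\<mu> i) = sets borel" for i
    using real_distribution.events_eq_borel[OF \<mu>[of i]] by simp
  interpret prob_space "PiM UNIV \<mu>" by (rule prob_space_PiM) (rule ps)
  have "distr (PiM UNIV \<mu>) borel (\<lambda>f. f i) = \<mu> i" for i
  proof -
    have "distr (PiM UNIV \<mu>) borel (\<lambda>f. f i) = distr (PiM UNIV \<mu>) (\<mu> i) (\<lambda>f. f i)"
      by (rule distr_cong) auto
    then show ?thesis using distr_PiM_component[of UNIV \<mu> i] ps by simp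
  qed
  moreover have "distr (PiM UNIV \<mu>) (PiM UNIV (\<lambda>_. borel)) (\<lambda>f. f) = PiM UNIV \<mu>"
    by (subst distr_id2) (auto intro!: sets_PiM_cong)
  ultimately show ?thesis
    by (subst indep_vars_iff_distr_eq_PiM') (auto simp: restrict_UNIV)
qed

lemma measurable_coordinate_map:
  "(\<lambda>f i. f (r i)) \<in> measurable (PiM UNIV (\<lambda>_. borel :: real measure)) (PiM UNIV (\<lambda>_. borel))"
  by (rule measurable_PiM_single') (auto simp: space_PiM)

text \<open>Injectivity is enough, so this covers both shifts of time, which are not onto, and
  reversals of a finite stretch.\<close>

lemma PiM_reindex:
  fixes \<mu> :: "'i \<Rightarrow> real measure"
  assumes \<mu>: "\<And>i. real_distribution (\<mu> i)" and r: "inj r" "\<And>i. \<mu> (r i) = \<mu> i"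
  shows "distr (PiM UNIV \<mu>) (PiM UNIV \<mu>) (\<lambda>f i. f (r i)) = PiM UNIV \<mu>"
  using distr_PiM_reindex[of UNIV \<mu> r UNIV] \<mu> r
  by (simp add: real_distribution_def restrict_UNIV)

lemma measure_PiM_reindex:
  fixes \<mu> :: "'i \<Rightarrow> real measure"
  assumes \<mu>: "\<And>i. real_distribution (\<mu> i)" and r: "inj r" "\<And>i. \<mu> (r i) = \<mu> i"
    and [measurable]: "Measurable.pred (PiM UNIV \<mu>) Q"
  shows "measure (PiM UNIV \<mu>) {f \<in> space (PiM UNIV \<mu>). Q (\<lambda>i. f (r i))}
       = measure (PiM UNIV \<mu>) {f \<in> space (PiM UNIV \<mu>). Q f}"
proof -
  have sets: "sets (PiM UNIV \<mu>) = sets (PiM UNIV (\<lambda>_. borel))"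
    by (rule sets_PiM_cong) (auto simp: real_distribution.events_eq_borel[OF \<mu>])
  have sp: "space (PiM UNIV \<mu>) = UNIV"
    using sets_eq_imp_space_eq[OF sets] by (simp add: space_PiM)
  have m [measurable]: "(\<lambda>f i. f (r i)) \<in> measurable (PiM UNIV \<mu>) (PiM UNIV \<mu>)"
    using measurable_coordinate_map[of r] by (simp cong: measurable_cong_sets add: sets)
  have Q: "{f \<in> space (PiM UNIV \<mu>). Q f} \<in> sets (PiM UNIV \<mu>)"
    using assms(4) by (simp add: pred_def)
  have "distr (PiM UNIV \<mu>) (PiM UNIV \<mu>) (\<lambda>f i. f (r i)) = PiM UNIV \<mu>"
    by (rule PiM_reindex) (use \<mu> r in auto)
  then have "measure (PiM UNIV \<mu>) {f \<in> space (PiM UNIV \<mu>). Q f}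
      = measure (distr (PiM UNIV \<mu>) (PiM UNIV \<mu>) (\<lambda>f i. f (r i))) {f \<in> space (PiM UNIV \<mu>). Q f}"
    by simp
  also have "\<dots> = measure (PiM UNIV \<mu>)
      ((\<lambda>f i. f (r i)) -` {f \<in> space (PiM UNIV \<mu>). Q f} \<inter> space (PiM UNIV \<mu>))"
    by (rule measure_distr[OF m Q])
  finally show ?thesis by (simp add: sp vimage_def)
qed

section \<open>Maxima of partial sums and walks with negative drift\<close>

fun max_sum :: "nat \<Rightarrow> (nat \<Rightarrow> real) \<Rightarrow> real" where
  "max_sum 0 f = 0"
| "max_sum (Suc n) f = max 0 (f 0 + max_sum n (\<lambda>i. f (Suc i)))"

lemma max_sum_ge: "k \<le> n \<Longrightarrow> (\<Sum>i<k. f i) \<le> max_sum n f"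
proof (induction n arbitrary: f k)
  case (Suc n)
  then show ?case
  proof (cases k)
    case (Suc j)
    then show ?thesis using Suc.IH[of j "\<lambda>i. f (Suc i)"] Suc.prems
      by (simp add: sum.lessThan_Suc_shift del: sum.lessThan_Suc)
  qed simp
qed simp

lemma max_sum_attained: "\<exists>k\<le>n. max_sum n f = (\<Sum>i<k. f i)"
proof (induction n arbitrary: f)
  case (Suc n)
  obtain k where k: "k \<le> n" "max_sum n (\<lambda>i. f (Suc i)) = (\<Sum>i<k. f (Suc i))" using Suc by blast
  have eq: "f 0 + (\<Sum>i<k. f (Suc i)) = (\<Sum>i<Suc k. f i)" by (rule sum.lessThan_Suc_shift[symmetric])
  show ?case
  proof (cases "0 \<le> f 0 + (\<Sum>i<k. f (Suc i))")
    case True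
    then have "max_sum (Suc n) f = (\<Sum>i<Suc k. f i)" using k eq by simp
    then show ?thesis using k by (intro exI[of _ "Suc k"]) simp
  next
    case False
    then have "max_sum (Suc n) f = (\<Sum>i<0. f i)" using k by simp
    then show ?thesis by blast
  qed
qed simp

lemma max_sum_greater_iff: "max_sum n f > x \<longleftrightarrow> (\<exists>k\<le>n. (\<Sum>i<k. f i) > x)"
  using max_sum_attained[of n f] max_sum_ge[of _ n f] by (metis less_le_trans)

lemma max_sum_nonneg: "0 \<le> max_sum n f"
  using max_sum_ge[of 0 n f] by simp

lemma max_sum_mono: "m \<le> n \<Longrightarrow> max_sum m f \<le> max_sum n f"
  using max_sum_attained[of m f] max_sum_ge[of _ n f] by (metis order_trans)

lemma max_sum_le_sum_abs: "max_sum n f \<le> (\<Sum>i<n. \<bar>f i\<bar>)"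
proof -
  obtain k where k: "k \<le> n" "max_sum n f = (\<Sum>i<k. f i)" using max_sum_attained by blast
  have "(\<Sum>i<k. f i) \<le> (\<Sum>i<k. \<bar>f i\<bar>)" by (intro sum_mono) auto
  also have "\<dots> \<le> (\<Sum>i<n. \<bar>f i\<bar>)" using k by (intro sum_mono2) auto
  finally show ?thesis using k by simp
qed

lemma measurable_max_sum [measurable]:
  fixes F :: "'x \<Rightarrow> nat \<Rightarrow> real"
  assumes "\<And>i. (\<lambda>x. F x i) \<in> borel_measurable M"
  shows "(\<lambda>x. max_sum n (F x)) \<in> borel_measurable M"
  using assms by (induction n arbitrary: F) auto

text \<open>On the shift-invariant event \<open>A\<close> that the partial sums are unbounded above, the expectation
  of \<open>max_sum (n + 1) f - max_sum n (f \<circ> Suc)\<close> is nonnegative by stationarity, and it tends to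
  \<open>P(A)\<close> times the mean, because \<open>A\<close> is independent of the first coordinate.\<close>

lemma AE_PiM_partial_sums_bounded:
  fixes \<mu> :: "real measure"
  assumes \<mu>: "real_distribution \<mu>" and int: "integrable \<mu> (\<lambda>x. x)" and neg: "(\<integral>x. x \<partial>\<mu>) < 0"
  shows "AE f in PiM UNIV (\<lambda>_::nat. \<mu>). \<exists>K. \<forall>n. (\<Sum>i<n. f i) \<le> K"
proof -
  define N where "N = PiM UNIV (\<lambda>_::nat. \<mu>)"
  interpret \<mu>: real_distribution \<mu> by (rule \<mu>)
  interpret N: prob_space N unfolding N_def by (rule prob_space_PiM) unfold_locales
  have sets_N [measurable_cong]: "sets N = sets (PiM UNIV (\<lambda>_::nat. borel))"
    unfolding N_def by (rule sets_PiM_cong) auto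
  have comp: "distr N borel (\<lambda>f. f i) = \<mu>" for i
  proof -
    have "distr N borel (\<lambda>f. f i) = distr N \<mu> (\<lambda>f. f i)" by (rule distr_cong) auto
    then show ?thesis using distr_PiM_component[of UNIV "\<lambda>_. \<mu>" i] \<mu>.prob_space_axioms by (simp add: N_def)
  qed
  have int_comp: "integrable N (\<lambda>f. f i)" for i
    using int unfolding comp[of i, symmetric] by (subst (asm) integrable_distr_eq) auto
  have mean: "N.expectation (\<lambda>f. f i) = (\<integral>x. x \<partial>\<mu>)" for i
    unfolding comp[of i, symmetric] by (subst integral_distr) auto
  define A where "A f \<longleftrightarrow> (\<forall>K::nat. \<exists>n. real K < max_sum n f)" for f :: "nat \<Rightarrow> real"
  define \<theta> where "\<theta> f = (\<lambda>i. f (Suc i))" for f :: "nat \<Rightarrow> real"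
  have [measurable]: "\<theta> \<in> measurable N N" using measurable_coordinate_map[of Suc] by (simp add: \<theta>_def [abs_def] cong: measurable_cong_sets)
  have [measurable]: "Measurable.pred N A" unfolding A_def by measurable
  have [measurable]: "Measurable.pred (PiM UNIV (\<lambda>_. borel)) A" unfolding A_def by measurable
  have [measurable]: "Measurable.pred (PiM UNIV (\<lambda>_. borel)) (\<lambda>f. A (\<theta> f))"
    unfolding A_def \<theta>_def by measurable
  have inv: "distr N N \<theta> = N"
    unfolding N_def \<theta>_def by (rule PiM_reindex[where r=Suc]) (auto intro: \<mu>)
  have int_max: "integrable N (\<lambda>f. max_sum n f)" for n
  proof (rule Bochner_Integration.integrable_bound)
    show "integrable N (\<lambda>f. \<Sum>i<n. \<bar>f i\<bar>)" by (intro Bochner_Integration.integrable_sum integrable_abs int_comp)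
    show "AE f in N. norm (max_sum n f) \<le> norm (\<Sum>i<n. \<bar>f i\<bar>)"
      by (rule AE_I2) (simp add: max_sum_nonneg sum_nonneg max_sum_le_sum_abs)
  qed measurable
  have A_shift: "A (\<theta> f) \<longleftrightarrow> A f" for f
  proof
    assume A: "A (\<theta> f)"
    show "A f" unfolding A_def
    proof
      fix K :: nat
      obtain n where "real (K + nat \<lceil>\<bar>f 0\<bar>\<rceil>) < max_sum n (\<theta> f)" using A unfolding A_def by blast
      moreover have "\<bar>f 0\<bar> \<le> real (nat \<lceil>\<bar>f 0\<bar>\<rceil>)" by linarith
      ultimately have "real K < f 0 + max_sum n (\<theta> f)" by linarith
      then have "real K < max_sum (Suc n) f" by (simp add: \<theta>_def less_max_iff_disj)
      then show "\<exists>n. real K < max_sum n f" ..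
    qed
  next
    assume A: "A f"
    show "A (\<theta> f)" unfolding A_def
    proof
      fix K :: nat
      obtain n where n: "real (K + nat \<lceil>\<bar>f 0\<bar>\<rceil>) < max_sum n f" using A unfolding A_def by blast
      moreover have "\<bar>f 0\<bar> \<le> real (nat \<lceil>\<bar>f 0\<bar>\<rceil>)" by linarith
      moreover have "max_sum n f \<le> max_sum (Suc n) f" by (rule max_sum_mono) simp
      moreover have "max_sum (Suc n) f = max 0 (f 0 + max_sum n (\<theta> f))" by (simp add: \<theta>_def)
      ultimately have "real K < max_sum n (\<theta> f)" by linarith
      then show "\<exists>n. real K < max_sum n (\<theta> f)" ..
    qed
  qed
  let ?I = "\<lambda>f. if A f then 1 else (0::real)"
  have stat: "N.expectation (\<lambda>f. max_sum n f * ?I f) = N.expectation (\<lambda>f. max_sum n (\<theta> f) * ?I f)" for n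
    using integral_distr[of \<theta> N N "\<lambda>f. max_sum n f * ?I f"] by (simp add: inv A_shift)
  have int_shift: "integrable N (\<lambda>f. max_sum n (\<theta> f))" for n
    using integrable_distr_eq[of \<theta> N N "max_sum n"] int_max[of n] by (simp add: inv)
  have [measurable]: "(\<lambda>f. max_sum n (\<theta> f)) \<in> borel_measurable N" for n
    using int_shift[of n] by (rule borel_measurable_integrable)
  have int_I: "integrable N (\<lambda>f. g f * ?I f)" if [measurable]: "integrable N g" for g
    by (rule Bochner_Integration.integrable_bound[OF that]) auto
  \<comment> \<open>Peeling off the first summand shows that the integrand is
    \<open>max_sum (Suc n) f - max_sum n (\<theta> f)\<close>. By stationarity its integral over
    \<open>A\<close> is that of the nonnegative function
    \<open>max_sum (Suc n) f - max_sum n f\<close>.\<close>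
  have "0 \<le> N.expectation (\<lambda>f. max (f 0) (- max_sum n (\<theta> f)) * ?I f)" for n
  proof -
    have "0 \<le> N.expectation (\<lambda>f. (max_sum (Suc n) f - max_sum n f) * ?I f)"
      by (rule integral_nonneg_AE) (auto simp: max_sum_mono simp del: max_sum.simps)
    also have "\<dots> = N.expectation (\<lambda>f. max_sum (Suc n) f * ?I f - max_sum n f * ?I f)"
      by (simp only: left_diff_distrib)
    also have "\<dots> = N.expectation (\<lambda>f. max_sum (Suc n) f * ?I f) - N.expectation (\<lambda>f. max_sum n f * ?I f)"
      by (rule Bochner_Integration.integral_diff[OF int_I[OF int_max] int_I[OF int_max]])
    also have "\<dots> = N.expectation (\<lambda>f. max_sum (Suc n) f * ?I f) - N.expectation (\<lambda>f. max_sum n (\<theta> f) * ?I f)"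
      by (simp only: stat[of n])
    also have "\<dots> = N.expectation (\<lambda>f. max_sum (Suc n) f * ?I f - max_sum n (\<theta> f) * ?I f)"
      by (rule Bochner_Integration.integral_diff[OF int_I[OF int_max] int_I[OF int_shift], symmetric])
    also have "\<dots> = N.expectation (\<lambda>f. max (f 0) (- max_sum n (\<theta> f)) * ?I f)"
      by (intro Bochner_Integration.integral_cong) (auto simp: \<theta>_def max_def)
    finally show ?thesis .
  qed
  \<comment> \<open>On \<open>A\<close> the maxima of the shifted sequence eventually exceed
    \<open>\<bar>f 0\<bar>\<close>, so the integrand settles at \<open>f 0\<close>.\<close>
  moreover have "(\<lambda>n. N.expectation (\<lambda>f. max (f 0) (- max_sum n (\<theta> f)) * ?I f))
      \<longlonglongrightarrow> N.expectation (\<lambda>f. f 0 * ?I f)"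
  proof (rule integral_dominated_convergence[where w="\<lambda>f. \<bar>f 0\<bar>"])
    show "AE f in N. (\<lambda>n. max (f 0) (- max_sum n (\<theta> f)) * ?I f) \<longlonglongrightarrow> f 0 * ?I f"
    proof (rule AE_I2)
      fix f
      show "(\<lambda>n. max (f 0) (- max_sum n (\<theta> f)) * ?I f) \<longlonglongrightarrow> f 0 * ?I f"
      proof (cases "A f")
        case True
        then obtain n0 where n0: "real (nat \<lceil>\<bar>f 0\<bar>\<rceil>) < max_sum n0 (\<theta> f)"
          using A_shift[of f] unfolding A_def by blast
        have "max (f 0) (- max_sum n (\<theta> f)) = f 0" if "n0 \<le> n" for n
          using max_sum_mono[OF that, of "\<theta> f"] n0 by linarith
        then show ?thesis
          by (intro tendsto_eventually eventually_sequentiallyI[of n0]) simp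
      qed simp
    qed
    show "AE f in N. norm (max (f 0) (- max_sum n (\<theta> f)) * ?I f) \<le> \<bar>f 0\<bar>" for n
    proof (rule AE_I2)
      show "norm (max (f 0) (- max_sum n (\<theta> f)) * ?I f) \<le> \<bar>f 0\<bar>" for f
        using max_sum_nonneg[of n "\<theta> f"] by (auto simp: max_def)
    qed
  qed (auto intro: int_comp)
  ultimately have "0 \<le> N.expectation (\<lambda>f. f 0 * ?I f)"
    by (intro LIMSEQ_le_const) auto
  \<comment> \<open>By invariance the indicator can be read off from the shifted sequence, in which
    \<open>f 0\<close> does not occur.\<close>
  also have "N.expectation (\<lambda>f. f 0 * ?I f) = N.expectation (\<lambda>f. f 0 * ?I (\<theta> f))"
    by (simp add: A_shift)
  also have "\<dots> = N.expectation (\<lambda>f. f 0) * N.expectation (\<lambda>f. ?I (\<theta> f))"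
  proof (rule N.indep_var_lebesgue_integral)
    have "N.indep_vars (\<lambda>_. borel) (\<lambda>i f. f i) UNIV"
      unfolding N_def by (rule indep_vars_PiM_coordinates) (rule \<mu>)
    then show "N.indep_var borel (\<lambda>f. f 0) borel (\<lambda>f. ?I (\<theta> f))"
    proof (rule N.indep_var_depends_on[where A="{0}" and B="{1..}" and h="\<lambda>f. ?I (\<theta> f)" and g="\<lambda>f. f 0"])
      show "depends_on {1..} (\<lambda>f. ?I (\<theta> f))"
      proof (rule depends_onI)
        fix f f' :: "nat \<Rightarrow> real" assume "\<And>i. i \<in> {1..} \<Longrightarrow> f i = f' i"
        then have "\<theta> f = \<theta> f'" by (simp add: \<theta>_def)
        then show "?I (\<theta> f) = ?I (\<theta> f')" by simp
      qed
      show "depends_on {0} (\<lambda>f. f 0)" by (rule depends_onI) simp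
      show "{0} \<inter> {1..} = ({} :: nat set)" by simp
    qed measurable
    show "integrable N (\<lambda>f. ?I (\<theta> f))"
      by (rule N.integrable_const_bound[where B=1]) auto
  qed (rule int_comp)
  also have "N.expectation (\<lambda>f. ?I (\<theta> f)) = N.prob {f \<in> space N. A f}"
    by (subst Bochner_Integration.integral_cong[OF refl, of N _ "indicator {f \<in> space N. A f}"])
       (auto simp: A_shift)
  finally have "0 \<le> (\<integral>x. x \<partial>\<mu>) * N.prob {f \<in> space N. A f}" by (simp add: mean)
  then have "N.prob {f \<in> space N. A f} = 0"
    using neg measure_nonneg[of N "{f \<in> space N. A f}"] by (auto simp: zero_le_mult_iff)
  then have "AE f in N. \<not> A f"
    using N.prob_eq_0[of "{f \<in> space N. A f}"] by simp
  then show ?thesis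
    unfolding N_def[symmetric]
  proof eventually_elim
    case (elim f)
    then obtain K where K: "\<And>n. max_sum n f \<le> real K" unfolding A_def not_all not_ex not_less by blast
    have "(\<Sum>i<n. f i) \<le> real K" for n using max_sum_ge[of n n f] K[of n] by simp
    then show ?case by blast
  qed
qed

lemma (in prob_space) random_sequence:
  fixes X :: "'i \<Rightarrow> 'a \<Rightarrow> real"
  assumes ind: "indep_vars (\<lambda>_. borel) X UNIV"
  shows "random_variable (PiM UNIV (\<lambda>_. borel)) (\<lambda>\<omega> i. X i \<omega>)"
proof (rule measurable_PiM_single')
  show "X i \<in> borel_measurable M" for i using ind by (simp add: indep_vars_def)
qed (simp add: space_PiM)

lemma (in prob_space) distr_iid:
  fixes X :: "nat \<Rightarrow> 'a \<Rightarrow> real"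
  assumes ind: "indep_vars (\<lambda>_. borel) X UNIV" and id: "\<And>i. distr M borel (X i) = \<mu>"
  shows "distr M (PiM UNIV (\<lambda>_. borel)) (\<lambda>\<omega> i. X i \<omega>) = PiM UNIV (\<lambda>_. \<mu>)"
  using indep_vars_iff_distr_eq_PiM'[of UNIV X "\<lambda>_. borel"] ind id
  by (auto simp: indep_vars_def restrict_UNIV)

text \<open>A one-sided law of large numbers, since \<open>X - m\<close> has negative mean. A random
  constant in place of a limit is the form needed for bounds by straight lines.\<close>

lemma (in prob_space) AE_partial_sums_bounded:
  fixes X :: "nat \<Rightarrow> 'a \<Rightarrow> real"
  assumes ind: "indep_vars (\<lambda>_. borel) X UNIV" and id: "\<And>i. distr M borel (X i) = \<mu>"
    and int: "integrable \<mu> (\<lambda>x. x)" and mean: "(\<integral>x. x \<partial>\<mu>) < m"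
  shows "AE \<omega> in M. \<exists>K. \<forall>n. (\<Sum>i<n. X i \<omega>) \<le> real n * m + K"
proof -
  have rv [measurable]: "random_variable borel (X i)" for i using ind by (auto simp: indep_vars_def)
  define Y where "Y i \<omega> = X i \<omega> - m" for i \<omega>
  define \<nu> where "\<nu> = distr \<mu> borel (\<lambda>x. x - m)"
  have [measurable_cong]: "sets \<mu> = sets borel" unfolding id[of 0, symmetric] by (rule sets_distr)
  interpret \<mu>: prob_space \<mu> unfolding id[of 0, symmetric] by (rule prob_space_distr[OF rv])
  have indY: "indep_vars (\<lambda>_. borel) Y UNIV"
    unfolding Y_def by (rule indep_vars_compose2[OF ind]) auto
  have idY: "distr M borel (Y i) = \<nu>" for i
  proof -
    have "\<nu> = distr (distr M borel (X i)) borel (\<lambda>x. x - m)" by (simp only: \<nu>_def id)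
    also have "\<dots> = distr M borel (Y i)" by (subst distr_distr) (simp_all add: Y_def [abs_def] comp_def)
    finally show ?thesis ..
  qed
  have \<nu>: "real_distribution \<nu>"
    unfolding \<nu>_def by (rule \<mu>.real_distribution_distr) measurable
  have "AE f in PiM UNIV (\<lambda>_::nat. \<nu>). \<exists>K. \<forall>n. (\<Sum>i<n. f i) \<le> K"
  proof (rule AE_PiM_partial_sums_bounded[OF \<nu>])
    have m: "(\<lambda>x. x - m) \<in> measurable \<mu> borel" by measurable
    have c: "integrable \<mu> (\<lambda>_. m)" by (rule \<mu>.integrable_const)
    have "integrable \<mu> (\<lambda>x. x - m)" using int c by (rule Bochner_Integration.integrable_diff)
    then show "integrable \<nu> (\<lambda>x. x)"
      unfolding \<nu>_def integrable_distr_eq[OF m measurable_ident_sets[OF refl]] .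
    have "(\<integral>x. x \<partial>\<nu>) = (\<integral>x. x - m \<partial>\<mu>)"
      unfolding \<nu>_def by (rule integral_distr[OF m measurable_ident_sets[OF refl]])
    also have "\<dots> = (\<integral>x. x \<partial>\<mu>) - (\<integral>x. m \<partial>\<mu>)"
      using int c by (rule Bochner_Integration.integral_diff)
    finally show "(\<integral>x. x \<partial>\<nu>) < 0" using mean by (simp add: \<mu>.prob_space)
  qed
  then have "AE \<omega> in M. \<exists>K. \<forall>n. (\<Sum>i<n. Y i \<omega>) \<le> K"
    unfolding distr_iid[OF indY idY, symmetric]
    by (rule AE_distrD[rotated]) (rule random_sequence[OF indY])
  then show ?thesis
  proof eventually_elim
    case (elim \<omega>)
    then obtain K where "\<And>n. (\<Sum>i<n. Y i \<omega>) \<le> K" by blast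
    then have "(\<Sum>i<n. X i \<omega>) \<le> real n * m + K" for n
      by (simp add: Y_def sum_subtractf algebra_simps)
    then show ?case by blast
  qed
qed

text \<open>Continuity of measure along integer levels. It trades an almost sure random constant for
  a deterministic one, at the price of an event of probability less than \<open>e\<close>.\<close>

lemma (in prob_space) tight_of_AE_bounded:
  fixes Q :: "real \<Rightarrow> 'a \<Rightarrow> bool"
  assumes [measurable]: "\<And>K. Measurable.pred M (Q K)"
    and mono: "\<And>K L \<omega>. K \<le> L \<Longrightarrow> Q K \<omega> \<Longrightarrow> Q L \<omega>"
    and AE: "AE \<omega> in M. \<exists>K. Q K \<omega>" and "0 < e"
  shows "\<forall>\<^sub>F K in at_top. prob {\<omega> \<in> space M. Q K \<omega>} > 1 - e"
proof -
  let ?A = "\<lambda>n. {\<omega> \<in> space M. Q (real n) \<omega>}"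
  have "(\<lambda>n. prob (?A n)) \<longlonglongrightarrow> prob (\<Union>n. ?A n)"
  proof (rule finite_Lim_measure_incseq)
    show "incseq ?A"
    proof (rule incseq_SucI, rule Collect_mono, rule impI)
      fix n \<omega> assume "\<omega> \<in> space M \<and> Q (real n) \<omega>"
      then show "\<omega> \<in> space M \<and> Q (real (Suc n)) \<omega>" using mono[of "real n" "real (Suc n)" \<omega>] by simp
    qed
  qed auto
  moreover have "prob (\<Union>n. ?A n) = 1"
  proof (rule prob_eq_1[THEN iffD2])
    show "AE \<omega> in M. \<omega> \<in> (\<Union>n. ?A n)"
      using AE AE_space
    proof eventually_elim
      case (elim \<omega>)
      then obtain K where "Q K \<omega>" by blast
      then have "Q (real (nat \<lceil>K\<rceil>)) \<omega>" by (rule mono[rotated]) linarith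
      then show ?case using elim by blast
    qed
  qed measurable
  ultimately have "eventually (\<lambda>n. prob (?A n) > 1 - e) sequentially"
    using \<open>0 < e\<close> by (intro order_tendstoD(1)) auto
  then obtain n where n: "prob (?A n) > 1 - e" by (auto simp: eventually_sequentially)
  have "1 - e < prob {\<omega> \<in> space M. Q K \<omega>}" if "real n \<le> K" for K
  proof -
    have "prob (?A n) \<le> prob {\<omega> \<in> space M. Q K \<omega>}"
    proof (rule finite_measure_mono)
      show "?A n \<subseteq> {\<omega> \<in> space M. Q K \<omega>}" using mono[OF that] by blast
    qed measurable
    then show ?thesis using n by simp
  qed
  then show ?thesis by (auto simp: eventually_at_top_linorder)
qed


section \<open>Independence and reindexing on a product of real laws\<close>

locale real_product =
  fixes \<mu> :: "'i \<Rightarrow> real measure"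
  assumes marginal: "real_distribution (\<mu> i)"
begin

definition N :: "('i \<Rightarrow> real) measure" where
  "N = PiM UNIV \<mu>"

lemma sets_N [measurable_cong]: "sets N = sets (PiM UNIV (\<lambda>_. borel))"
  unfolding N_def
  by (rule sets_PiM_cong) (simp_all add: real_distribution.events_eq_borel[OF marginal])

lemma space_N [simp]: "space N = UNIV"
  using sets_eq_imp_space_eq[OF sets_N] by (simp add: space_PiM)

sublocale prob_space N
  unfolding N_def using marginal by (intro prob_space_PiM) (simp add: real_distribution_def)

lemma distr_coordinate: "distr N borel (\<lambda>f. f i) = \<mu> i"
proof -
  have "distr N borel (\<lambda>f. f i) = distr N (\<mu> i) (\<lambda>f. f i)"
    by (rule distr_cong) (simp_all add: real_distribution.events_eq_borel[OF marginal])
  then show ?thesis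
    using distr_PiM_component[of UNIV \<mu> i] marginal by (simp add: N_def real_distribution_def)
qed

lemma indep_coordinates: "indep_vars (\<lambda>_. borel) (\<lambda>i f. f i) UNIV"
  unfolding N_def by (rule indep_vars_PiM_coordinates) (rule marginal)

lemma indep_var_N:
  assumes "g \<in> measurable (PiM UNIV (\<lambda>_. borel)) S" "h \<in> measurable (PiM UNIV (\<lambda>_. borel)) T"
    and "depends_on A g" "depends_on B h" "A \<inter> B = {}"
  shows "indep_var S g T h"
  using indep_var_depends_on[OF indep_coordinates assms] by simp

lemma prob_conj_indep:
  assumes P: "Measurable.pred (PiM UNIV (\<lambda>_. borel)) P" and Q: "Measurable.pred (PiM UNIV (\<lambda>_. borel)) Q"
    and "depends_on A P" "depends_on B Q" "A \<inter> B = {}"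
  shows "prob {f. P f \<and> Q f} = prob {f. P f} * prob {f. Q f}"
proof -
  have "indep_var (count_space UNIV) P (count_space UNIV) Q"
    by (rule indep_var_N) fact+
  from indep_varD[OF this, of "{True}" "{True}"] show ?thesis
    by (simp add: vimage_def)
qed

lemma prob_reindex:
  assumes "Measurable.pred (PiM UNIV (\<lambda>_. borel)) P" and "inj r" "\<And>i. \<mu> (r i) = \<mu> i"
  shows "prob {f. P (\<lambda>i. f (r i))} = prob {f. P f}"
proof -
  have "Measurable.pred N P" using assms(1) by (simp cong: measurable_cong_sets add: sets_N)
  then show ?thesis
    using measure_PiM_reindex[of \<mu> r P] marginal assms(2,3) by (simp add: N_def[symmetric])
qed

text \<open>A Markov property: the family read through \<open>r\<close> is a fresh copy of the
  whole, independent of what happens on \<open>A\<close>.\<close>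

lemma prob_conj_reindex:
  assumes P: "Measurable.pred (PiM UNIV (\<lambda>_. borel)) P" and Q: "Measurable.pred (PiM UNIV (\<lambda>_. borel)) Q"
    and dep: "depends_on A P" and r: "inj r" "\<And>i. \<mu> (r i) = \<mu> i" "A \<inter> range r = {}"
  shows "prob {f. P f \<and> Q (\<lambda>i. f (r i))} = prob {f. P f} * prob {f. Q f}"
proof -
  have "prob {f. P f \<and> Q (\<lambda>i. f (r i))} = prob {f. P f} * prob {f. Q (\<lambda>i. f (r i))}"
  proof (rule prob_conj_indep)
    show "Measurable.pred (PiM UNIV (\<lambda>_. borel)) (\<lambda>f. Q (\<lambda>i. f (r i)))"
      using measurable_compose[OF measurable_coordinate_map[of r] Q] .
    show "depends_on (range r) (\<lambda>f. Q (\<lambda>i. f (r i)))"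
    proof (rule depends_onI)
      fix f f' :: "'i \<Rightarrow> real" assume "\<And>i. i \<in> range r \<Longrightarrow> f i = f' i"
      then have "(\<lambda>i. f (r i)) = (\<lambda>i. f' (r i))" by (intro ext) auto
      then show "Q (\<lambda>i. f (r i)) = Q (\<lambda>i. f' (r i))" by simp
    qed
  qed fact+
  then show ?thesis using prob_reindex[OF Q r(1,2)] by simp
qed

end

lemma (in real_distribution) tail_eq: "tail M x = measure M {x<..}"
proof -
  have "UNIV - {..x} = {x<..}" by auto
  then show ?thesis using prob_compl[of "{..x}"] by (simp add: tail_def cdf_def)
qed

lemma (in real_distribution) tail_nonneg [simp]: "0 \<le> tail M x"
  by (simp add: tail_eq)

lemma (in real_distribution) tail_le_1 [simp]: "tail M x \<le> 1"
  by (simp add: tail_eq)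

lemma (in real_distribution) tail_antimono: "x \<le> y \<Longrightarrow> tail M y \<le> tail M x"
  by (simp add: tail_def cdf_nondecreasing)

lemma (in real_distribution) tail_diff: "x \<le> y \<Longrightarrow> tail M x - tail M y = measure M {x<..y}"
  using cdf_diff_eq[of x y] by (cases "x = y") (auto simp: tail_def)

lemma (in real_distribution) tail_at_top: "(tail M \<longlongrightarrow> 0) at_top"
  using tendsto_diff[OF tendsto_const[of 1] cdf_lim_at_top_prob] by (simp add: tail_def [abs_def])

section \<open>Maxima of centred random walks\<close>

abbreviation normal_tail :: "real \<Rightarrow> real" where
  "normal_tail \<equiv> tail std_normal_distribution"

interpretation std_normal: real_distribution std_normal_distribution
  by (rule real_dist_normal_dist)

lemma normal_tail_diff_le:
  assumes "0 \<le> c" "x \<le> y" "\<And>z. x < z \<Longrightarrow> z \<le> y \<Longrightarrow> std_normal_density z \<le> c"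
  shows "normal_tail x - normal_tail y \<le> c * (y - x)"
proof -
  have "emeasure std_normal_distribution {x<..y} = (\<integral>\<^sup>+z. ennreal (std_normal_density z) * indicator {x<..y} z \<partial>lborel)"
    by (rule emeasure_density) auto
  also have "\<dots> \<le> (\<integral>\<^sup>+z. ennreal c * indicator {x<..y} z \<partial>lborel)"
    by (rule nn_integral_mono) (use assms in \<open>auto simp: indicator_def intro!: ennreal_leI\<close>)
  also have "\<dots> = ennreal (c * (y - x))"
    using assms by (simp add: nn_integral_cmult ennreal_mult)
  finally have "measure std_normal_distribution {x<..y} \<le> c * (y - x)"
    using assms by (simp add: std_normal.emeasure_eq_measure)
  then show ?thesis using std_normal.tail_diff[OF assms(2)] by simp
qed

lemma std_normal_density_le: "std_normal_density z \<le> exp (- z\<^sup>2 / 2)"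
proof -
  have "1 \<le> 2 * pi" using pi_gt3 by simp
  then have "1 \<le> sqrt (2 * pi)" by simp
  then have "1 / sqrt (2 * pi) \<le> 1" by simp
  then show ?thesis unfolding std_normal_density_def by (rule mult_left_le_one_le[rotated 2]) auto
qed

lemma normal_tail_lipschitz: "x \<le> y \<Longrightarrow> normal_tail x - normal_tail y \<le> y - x"
proof -
  assume "x \<le> y"
  moreover have "std_normal_density z \<le> 1" for z
  proof -
    have "exp (- z\<^sup>2 / 2) \<le> (1::real)" by simp
    then show ?thesis using std_normal_density_le[of z] by linarith
  qed
  ultimately show ?thesis using normal_tail_diff_le[of 1 x y] by simp
qed

text \<open>Uniform in \<open>z\<close> because \<open>z \<le> exp (z^2 / 2)\<close>. It allows
  \<open>sqrt n\<close> to be changed by a factor near 1, uniformly in the level.\<close>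

lemma normal_tail_scale:
  assumes "0 < z" "1 \<le> r"
  shows "normal_tail z - normal_tail (r * z) \<le> r - 1"
proof -
  have "normal_tail z - normal_tail (r * z) \<le> exp (- z\<^sup>2 / 2) * (r * z - z)"
  proof (rule normal_tail_diff_le)
    fix w assume "z < w"
    then have "z\<^sup>2 \<le> w\<^sup>2" using assms by (intro power_mono) auto
    then have "exp (- w\<^sup>2 / 2) \<le> exp (- z\<^sup>2 / 2)" by simp
    then show "std_normal_density w \<le> exp (- z\<^sup>2 / 2)" using std_normal_density_le[of w] by linarith
  qed (use assms in auto)
  also have "\<dots> = (z / exp (z\<^sup>2 / 2)) * (r - 1)" by (simp add: exp_minus field_simps)
  also have "\<dots> \<le> 1 * (r - 1)"
  proof (rule mult_right_mono)
    have "0 \<le> (z - 1)\<^sup>2" by simp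
    then have "z \<le> 1 + z\<^sup>2 / 2" by (simp add: power2_eq_square algebra_simps)
    also have "\<dots> \<le> exp (z\<^sup>2 / 2)" by (rule exp_ge_add_one_self)
    finally show "z / exp (z\<^sup>2 / 2) \<le> 1" by simp
  qed (use assms in simp)
  finally show ?thesis by simp
qed

lemma normal_tail_0: "normal_tail 0 = 1 / 2"
proof -
  let ?m = "emeasure std_normal_distribution"
  have "?m {0<..} = (\<integral>\<^sup>+z. ennreal (std_normal_density z) * indicator {0<..} z \<partial>lborel)"
    by (rule emeasure_density) auto
  also have "\<dots> = ennreal \<bar>- 1\<bar> * (\<integral>\<^sup>+z. ennreal (std_normal_density (0 + - 1 * z)) * indicator {0<..} (0 + - 1 * z) \<partial>lborel)"
    by (rule nn_integral_real_affine) auto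
  also have "\<dots> = (\<integral>\<^sup>+z. ennreal (std_normal_density z) * indicator {..<0} z \<partial>lborel)"
    by (simp add: std_normal_density_def) (intro nn_integral_cong, simp add: indicator_def)
  also have "\<dots> = ?m {..<0}"
    by (rule emeasure_density[symmetric]) auto
  finally have eq: "?m {0<..} = ?m {..<0}" .
  have "?m {0} = (\<integral>\<^sup>+z. ennreal (std_normal_density z) * indicator {0} z \<partial>lborel)"
    by (rule emeasure_density) auto
  also have "\<dots> = 0"
    by (subst nn_integral_0_iff_AE) (auto intro!: eventually_mono[OF AE_lborel_singleton[of 0]])
  finally have "measure std_normal_distribution {0} = 0" by (simp add: measure_def)
  moreover have "measure std_normal_distribution ({..<0} \<union> ({0} \<union> {0<..}))
      = measure std_normal_distribution {..<0} + measure std_normal_distribution ({0} \<union> {0<..})"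
    by (rule std_normal.finite_measure_Union) auto
  moreover have "measure std_normal_distribution ({0} \<union> {0<..})
      = measure std_normal_distribution {0} + measure std_normal_distribution {0<..}"
    by (rule std_normal.finite_measure_Union) auto
  moreover have "{..<0} \<union> ({0} \<union> {0<..}) = (UNIV :: real set)" by auto
  ultimately show ?thesis
    using std_normal.prob_space eq by (simp add: std_normal.tail_eq measure_def)
qed

lemma normal_tail_le_half: "0 \<le> x \<Longrightarrow> normal_tail x \<le> 1 / 2"
  using std_normal.tail_antimono[of 0 x] normal_tail_0 by simp

lemma normal_tail_pos: "0 < normal_tail x"
proof -
  have "0 < emeasure std_normal_distribution {x<..}"
  proof (rule ccontr)
    assume "\<not> ?thesis"
    then have "emeasure std_normal_distribution {x<..} = 0" by (simp add: not_less)
    then have "(\<integral>\<^sup>+z. ennreal (std_normal_density z) * indicator {x<..} z \<partial>lborel) = 0"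
      by (subst (asm) emeasure_density) auto
    then have "AE z in lborel. ennreal (std_normal_density z) * indicator {x<..} z = 0"
      by (subst (asm) nn_integral_0_iff_AE) auto
    then have "AE z in lborel. z \<notin> {x<..}"
    proof eventually_elim
      case (elim z)
      have "0 < std_normal_density z" by (rule normal_density_pos) simp
      then show ?case using elim by (auto simp: indicator_def split: if_splits)
    qed
    then have "emeasure lborel {x<..} = 0"
      by (subst (asm) AE_iff_measurable[OF _ refl]) (auto simp: greaterThan_def)
    moreover have "emeasure lborel {x<..x + 1} \<le> emeasure lborel {x<..}"
      by (rule emeasure_mono) auto
    ultimately show False by simp
  qed
  then show ?thesis by (simp add: std_normal.tail_eq std_normal.emeasure_eq_measure)
qed

text \<open>Polya's theorem: pointwise convergence of monotone functions to a continuous limit is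
  uniform. A finite grid of mesh \<open>h\<close> suffices, because the limit is 1-Lipschitz and is
  within \<open>h\<close> of its limits 1 and 0 at the ends of the grid.\<close>

lemma weak_conv_normal_uniform:
  assumes m: "\<And>n. real_distribution (m n)" and conv: "weak_conv_m m std_normal_distribution"
    and "0 < e"
  shows "\<forall>\<^sub>F n in sequentially. \<forall>x. \<bar>tail (m n) x - normal_tail x\<bar> \<le> e"
proof -
  define h where "h = e / 3"
  have h: "0 < h" using \<open>0 < e\<close> by (simp add: h_def)
  have "isCont (cdf std_normal_distribution) x" for x
    unfolding isCont_def LIM_def
    proof (intro allI impI)
      fix r :: real assume "0 < r"
      have "\<bar>cdf std_normal_distribution y - cdf std_normal_distribution x\<bar> \<le> \<bar>y - x\<bar>" for y
        using normal_tail_lipschitz[of x y] normal_tail_lipschitz[of y x]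
          std_normal.tail_antimono[of x y] std_normal.tail_antimono[of y x]
        by (cases "x \<le> y") (auto simp: tail_def)
      then show "\<exists>s>0. \<forall>y. y \<noteq> x \<and> dist y x < s \<longrightarrow>
          dist (cdf std_normal_distribution y) (cdf std_normal_distribution x) < r"
        using \<open>0 < r\<close> by (intro exI[of _ r]) (auto simp: dist_real_def intro: le_less_trans)
    qed
  then have "(\<lambda>n. cdf (m n) x) \<longlonglongrightarrow> cdf std_normal_distribution x" for x
    using conv unfolding weak_conv_m_def weak_conv_def by blast
  then have lim: "(\<lambda>n. tail (m n) x) \<longlonglongrightarrow> normal_tail x" for x
    unfolding tail_def by (intro tendsto_intros)
  have "\<forall>\<^sub>F x in at_top. normal_tail x < h"
    using std_normal.tail_at_top h by (rule order_tendstoD)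
  then obtain b where b: "normal_tail b < h" by (auto simp: eventually_at_top_linorder)
  have "((\<lambda>x. normal_tail x) \<longlongrightarrow> 1) at_bot"
    using tendsto_diff[OF tendsto_const[of 1] std_normal.cdf_lim_at_bot] by (simp add: tail_def)
  then have "\<forall>\<^sub>F x in at_bot. 1 - h < normal_tail x"
    using h by (intro order_tendstoD(1)) auto
  then obtain a0 where a0: "\<And>x. x \<le> a0 \<Longrightarrow> 1 - h < normal_tail x" by (auto simp: eventually_at_bot_linorder)
  define a where "a = min a0 b"
  have a: "1 - h < normal_tail a" "a \<le> b" using a0 by (auto simp: a_def)
  define J where "J = nat \<lceil>(b - a) / h\<rceil>"
  define p where "p i = a + real i * h" for i
  have pJ: "b \<le> p J"
  proof -
    have "(b - a) / h \<le> real J" unfolding J_def by linarith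
    then show ?thesis using h by (simp add: p_def field_simps)
  qed
  have "\<forall>\<^sub>F n in sequentially. \<forall>i\<in>{..J}. \<bar>tail (m n) (p i) - normal_tail (p i)\<bar> < h"
  proof (rule eventually_ball_finite)
    show "\<forall>i\<in>{..J}. \<forall>\<^sub>F n in sequentially. \<bar>tail (m n) (p i) - normal_tail (p i)\<bar> < h"
      using tendstoD[OF lim h] by (auto simp: dist_real_def)
  qed simp
  then show ?thesis
  proof eventually_elim
    case (elim n)
    interpret m: real_distribution "m n" by (rule m)
    have g: "\<bar>tail (m n) (p i) - normal_tail (p i)\<bar> < h" if "i \<le> J" for i using elim that by simp
    have e3: "e = 3 * h" by (simp add: h_def)
    show ?case
    proof
      fix x
      consider "x < a" | "p J \<le> x" | "a \<le> x" "x < p J" by linarith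
      then show "\<bar>tail (m n) x - normal_tail x\<bar> \<le> e"
      proof cases
        case 1
        have "p 0 = a" by (simp add: p_def)
        then show ?thesis
          using g[of 0] a m.tail_antimono[of x a] std_normal.tail_antimono[of x a] m.tail_le_1[of x]
            std_normal.tail_le_1[of x] 1 e3 h by (simp; linarith)
      next
        case 2
        have "normal_tail (p J) < h" using std_normal.tail_antimono[OF pJ] b by linarith
        then show ?thesis
          using g[of J] m.tail_antimono[OF 2] std_normal.tail_antimono[OF 2] m.tail_nonneg[of x]
            std_normal.tail_nonneg[of x] e3 h by (simp; linarith)
      next
        case 3
        define i where "i = nat \<lfloor>(x - a) / h\<rfloor>"
        have "0 \<le> (x - a) / h" using 3 h by simp
        then have i: "real i \<le> (x - a) / h" "(x - a) / h < real i + 1" unfolding i_def by linarith+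
        have x: "p i \<le> x" "x < p (Suc i)" using i h by (auto simp: p_def field_simps)
        have "p i < p J" using x 3 by linarith
        then have "i < J" using h by (simp add: p_def)
        have "normal_tail (p i) - normal_tail (p (Suc i)) \<le> h"
          using normal_tail_lipschitz[of "p i" "p (Suc i)"] h by (simp add: p_def algebra_simps)
        then show ?thesis
          using g[of i] g[of "Suc i"] \<open>i < J\<close> x h e3
            m.tail_antimono[of "p i" x] m.tail_antimono[of x "p (Suc i)"]
            std_normal.tail_antimono[of "p i" x] std_normal.tail_antimono[of x "p (Suc i)"]
          by (simp; linarith)
      qed
    qed
  qed
qed


text \<open>Chebyshev's inequality with the second moment restricted to large values, which vanishes
  by dominated convergence. By a union bound, none of \<open>n\<close> increments exceeds
  \<open>c * sqrt n\<close> with high probability, so the overshoot of a walk is negligible.\<close>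

lemma (in real_distribution) scaled_tail_tendsto_0:
  assumes int: "integrable M (\<lambda>x. x\<^sup>2)" and "0 < c"
  shows "(\<lambda>n. real n * tail M (c * sqrt (real n))) \<longlonglongrightarrow> 0"
proof (rule tendsto_sandwich[where f="\<lambda>_. 0"
      and h="\<lambda>n. (1 / c\<^sup>2) * (\<integral>x. x\<^sup>2 * indicator {c * sqrt (real n)<..} x \<partial>M)"])
  let ?f = "\<lambda>n x. x\<^sup>2 * indicator {c * sqrt (real n)<..} x :: real"
  have "(\<lambda>n. \<integral>x. ?f n x \<partial>M) \<longlonglongrightarrow> (\<integral>x. 0 \<partial>M)"
  proof (rule integral_dominated_convergence[where w="\<lambda>x. x\<^sup>2"])
    show "AE x in M. (\<lambda>n. ?f n x) \<longlonglongrightarrow> 0"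
    proof (rule AE_I2)
      fix x
      have "\<forall>\<^sub>F n in sequentially. x / c < sqrt (real n)"
        using filterlim_compose[OF sqrt_at_top filterlim_real_sequentially]
        by (simp add: filterlim_at_top_dense)
      then have "\<forall>\<^sub>F n in sequentially. ?f n x = 0"
        by eventually_elim (use \<open>0 < c\<close> in \<open>simp add: field_simps\<close>)
      then show "(\<lambda>n. ?f n x) \<longlonglongrightarrow> 0" by (rule tendsto_eventually)
    qed
  qed (use int in \<open>auto simp: indicator_def\<close>)
  then show "(\<lambda>n. (1 / c\<^sup>2) * (\<integral>x. ?f n x \<partial>M)) \<longlonglongrightarrow> 0"
    by (intro tendsto_mult_right_zero) simp
  show "\<forall>\<^sub>F n in sequentially. real n * tail M (c * sqrt (real n)) \<le> (1 / c\<^sup>2) * (\<integral>x. ?f n x \<partial>M)"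
  proof (rule always_eventually, rule allI)
    fix n
    have "c\<^sup>2 * real n * tail M (c * sqrt (real n)) = (\<integral>x. c\<^sup>2 * real n * indicator {c * sqrt (real n)<..} x \<partial>M)"
      by (simp add: tail_eq)
    also have "\<dots> \<le> (\<integral>x. ?f n x \<partial>M)"
    proof (rule integral_mono)
      show "integrable M (?f n)"
        by (rule Bochner_Integration.integrable_bound[OF int]) (auto simp: indicator_def)
      fix x
      show "c\<^sup>2 * real n * indicator {c * sqrt (real n)<..} x \<le> ?f n x"
      proof (cases "c * sqrt (real n) < x")
        case True
        have "(c * sqrt (real n))\<^sup>2 \<le> x\<^sup>2" using True \<open>0 < c\<close> by (intro power_mono) auto
        then show ?thesis using True by (simp add: power_mult_distrib)
      qed simp
    qed (auto intro!: integrable_mult_right integrable_real_indicator simp: emeasure_eq_measure)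
    finally show "real n * tail M (c * sqrt (real n)) \<le> (1 / c\<^sup>2) * (\<integral>x. ?f n x \<partial>M)"
      using \<open>0 < c\<close> by (simp add: field_simps)
  qed
qed (auto intro!: always_eventually)

text \<open>Splitting at the first passage time above \<open>x\<close>, the walk ends above \<open>x\<close> with conditional
  probability about one half, since the overshoot is negligible.\<close>

lemma max_sum_clt:
  fixes \<nu> :: "real measure" and v e :: real
  assumes \<nu>: "real_distribution \<nu>" and sq: "integrable \<nu> (\<lambda>x. x\<^sup>2)"
    and mean: "(\<integral>x. x \<partial>\<nu>) = 0" and var: "(\<integral>x. x\<^sup>2 \<partial>\<nu>) = v\<^sup>2" and "0 < v" "0 < e"
  shows "\<forall>\<^sub>F n in sequentially. \<forall>x\<ge>0.
    \<bar>measure (PiM UNIV (\<lambda>_::nat. \<nu>)) {f. max_sum n f > x} - 2 * normal_tail (x / (v * sqrt (real n)))\<bar> \<le> e"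
proof -
  interpret R: real_product "\<lambda>_::nat. \<nu>" by (rule real_product.intro) (rule \<nu>)
  interpret \<nu>: real_distribution \<nu> by (rule \<nu>)
  define S where "S n f = (\<Sum>i<n. f i)" for n and f :: "nat \<Rightarrow> real"
  have S_meas [measurable]: "S n \<in> borel_measurable (PiM UNIV (\<lambda>_. borel))" for n
    unfolding S_def by measurable
  have S_split: "S (k + j) f = S k f + S j (\<lambda>i. f (k + i))" for k j f
    unfolding S_def by (induction j) (simp_all add: add.assoc[symmetric])
  define E where "E k x f \<longleftrightarrow> S k f > x \<and> (\<forall>j<k. S j f \<le> x)" for k x f
  have E_meas [measurable]: "Measurable.pred (PiM UNIV (\<lambda>_. borel)) (E k x)" for k x
    unfolding E_def by measurable
  have S_dep: "S k f = S k f'" if "\<And>i. i \<in> {..<n} \<Longrightarrow> f i = f' i" "k \<le> n" for k n f f'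
    unfolding S_def using that by (intro sum.cong) auto
  have E_dep: "depends_on {..<k} (E k x)" for k x
  proof (rule depends_onI)
    fix f f' :: "nat \<Rightarrow> real" assume f: "\<And>i. i \<in> {..<k} \<Longrightarrow> f i = f' i"
    have "S j f = S j f'" if "j \<le> k" for j by (rule S_dep[OF f that]) auto
    then show "E k x f = E k x f'" by (simp add: E_def)
  qed
  have E_disj: "k = l" if "E k x f" "E l x f" for k l x f
    using that unfolding E_def by (metis linorder_neqE_nat not_less)
  have max_iff: "max_sum n f > x \<longleftrightarrow> (\<exists>k\<le>n. E k x f)" for n f x
  proof
    assume "max_sum n f > x"
    then obtain k where k: "k \<le> n" "S k f > x" by (auto simp: max_sum_greater_iff S_def)
    define l where "l = (LEAST l. S l f > x)"
    have "S l f > x" unfolding l_def using k(2) by (rule LeastI)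
    moreover have "S j f \<le> x" if "j < l" for j
      using not_less_Least[of j "\<lambda>l. S l f > x"] that by (simp add: l_def not_less)
    moreover have "l \<le> k" unfolding l_def using k(2) by (rule Least_le)
    ultimately show "\<exists>k\<le>n. E k x f" using k(1) by (auto simp: E_def intro!: exI[of _ l])
  next
    assume "\<exists>k\<le>n. E k x f"
    then show "max_sum n f > x" by (auto simp: max_sum_greater_iff E_def S_def)
  qed
  have sets1: "{f. P f} \<in> sets R.N" if "Measurable.pred (PiM UNIV (\<lambda>_. borel)) P" for P
    using that unfolding pred_def by (simp add: R.sets_N space_PiM)
  have shiftm: "(\<lambda>f i. f (k + i)) \<in> measurable (PiM UNIV (\<lambda>_. borel)) (PiM UNIV (\<lambda>_. borel :: real measure))" for k :: nat
    by (rule measurable_coordinate_map)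
  have S_shift [measurable]: "(\<lambda>f. S n (\<lambda>i. f (k + i))) \<in> borel_measurable (PiM UNIV (\<lambda>_. borel))" for n k
    using measurable_compose[OF shiftm S_meas] .
  have sum_E: "(\<Sum>k\<in>K. R.prob {f. E k x f \<and> P k f}) = R.prob {f. \<exists>k\<in>K. E k x f \<and> P k f}"
    if "finite K" "\<And>k. Measurable.pred (PiM UNIV (\<lambda>_. borel)) (P k)" for K x and P :: "nat \<Rightarrow> (nat \<Rightarrow> real) \<Rightarrow> bool"
  proof -
    have "R.prob (\<Union>k\<in>K. {f. E k x f \<and> P k f}) = (\<Sum>k\<in>K. R.prob {f. E k x f \<and> P k f})"
    proof (rule R.finite_measure_finite_Union)
      show "(\<lambda>k. {f. E k x f \<and> P k f}) ` K \<subseteq> sets R.N"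
        using that(2) by (auto intro!: sets1)
      show "disjoint_family_on (\<lambda>k. {f. E k x f \<and> P k f}) K"
        by (auto simp: disjoint_family_on_def dest: E_disj)
    qed (rule that)
    moreover have "(\<Union>k\<in>K. {f. E k x f \<and> P k f}) = {f. \<exists>k\<in>K. E k x f \<and> P k f}" by auto
    ultimately show ?thesis by simp
  qed
  have max_E: "R.prob {f. max_sum n f > x} = (\<Sum>k\<le>n. R.prob {f. E k x f})" for n x
    using sum_E[of "{..n}" "\<lambda>_ _. True" x] by (simp add: max_iff Bex_def)
  have markov: "R.prob {f. E k x f \<and> S j (\<lambda>i. f (k + i)) > 0} = R.prob {f. E k x f} * R.prob {f. S j f > 0}"
    for k x j
    by (rule R.prob_conj_reindex[where r="\<lambda>i. k + i" and A="{..<k}" and Q="\<lambda>f. S j f > 0"])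
       (auto simp: inj_def intro: E_dep)
  define Q where "Q n x = normal_tail (x / (v * sqrt (real n)))" for n x
  have Q01: "0 \<le> Q n x" "Q n x \<le> 1" for n x by (simp_all add: Q_def)
  have clt: "\<forall>\<^sub>F n in sequentially. \<forall>x. \<bar>R.prob {f. S n f > x} - Q n x\<bar> \<le> d" if "0 < d" for d
  proof -
    have comp: "distr R.N borel (\<lambda>f. f i) = \<nu>" for i by (rule R.distr_coordinate)
    have cm: "(\<lambda>f. f i) \<in> borel_measurable R.N" for i by measurable
    have exp_sq: "R.expectation (\<lambda>f. (f i)\<^sup>2) = v\<^sup>2" for i
      using integral_distr[OF cm, of "\<lambda>x. x\<^sup>2" i] var by (simp add: comp)
    have exp_1: "R.expectation (\<lambda>f. f i) = 0" for i
      using integral_distr[OF cm, of "\<lambda>x. x" i] mean by (simp add: comp)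
    have "weak_conv_m (\<lambda>n. distr R.N borel (\<lambda>f. (\<Sum>i<n. f i) / sqrt (real n * v\<^sup>2))) std_normal_distribution"
    proof (rule R.central_limit_theorem_zero_mean[where X="\<lambda>i f. f i" and \<mu>=\<nu>])
      show "integrable R.N (\<lambda>f. (f i)\<^sup>2)" for i
        using integrable_distr_eq[OF cm, of "\<lambda>x. x\<^sup>2" i] sq by (simp add: comp)
      show "R.variance (\<lambda>f. f i) = v\<^sup>2" for i by (simp add: exp_1 exp_sq)
    qed (use \<open>0 < v\<close> in \<open>auto simp: exp_1 comp intro: R.indep_coordinates\<close>)
    moreover have "real_distribution (distr R.N borel (\<lambda>f. (\<Sum>i<n. f i) / sqrt (real n * v\<^sup>2)))" for n
      by (rule R.real_distribution_distr) measurable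
    ultimately have "\<forall>\<^sub>F n in sequentially. \<forall>x.
        \<bar>tail (distr R.N borel (\<lambda>f. (\<Sum>i<n. f i) / sqrt (real n * v\<^sup>2))) x - normal_tail x\<bar> \<le> d"
      using that by (intro weak_conv_normal_uniform)
    then show ?thesis using eventually_ge_at_top[of 1]
    proof eventually_elim
      case (elim n)
      let ?D = "distr R.N borel (\<lambda>f. (\<Sum>i<n. f i) / sqrt (real n * v\<^sup>2))"
      interpret D: real_distribution ?D by (rule R.real_distribution_distr) measurable
      have pos: "0 < v * sqrt (real n)" using elim(2) \<open>0 < v\<close> by simp
      have rt: "sqrt (real n * v\<^sup>2) = v * sqrt (real n)" using \<open>0 < v\<close> by (simp add: real_sqrt_mult)
      have "tail ?D (x / (v * sqrt (real n))) = R.prob {f. S n f > x}" for x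
      proof -
        have "tail ?D (x / (v * sqrt (real n)))
            = R.prob ((\<lambda>f. (\<Sum>i<n. f i) / sqrt (real n * v\<^sup>2)) -` {x / (v * sqrt (real n))<..} \<inter> space R.N)"
          unfolding D.tail_eq by (rule measure_distr) measurable
        also have "(\<lambda>f. (\<Sum>i<n. f i) / sqrt (real n * v\<^sup>2)) -` {x / (v * sqrt (real n))<..} \<inter> space R.N = {f. S n f > x}"
          using pos elim(2) by (auto simp: S_def rt divide_less_cancel)
        finally show ?thesis .
      qed
      then show ?case using elim(1) unfolding Q_def by metis
    qed
  qed
  \<comment> \<open>The worse of the two final estimates loses \<open>4 * d\<close> for half of the
    probability.\<close>
  define d where "d = e / 8"
  have d: "0 < d" "e = 8 * d" using \<open>0 < e\<close> by (simp_all add: d_def)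
  obtain m where m: "\<And>n x. m \<le> n \<Longrightarrow> \<bar>R.prob {f. S n f > x} - Q n x\<bar> \<le> d"
    using clt[OF d(1)] by (auto simp: eventually_sequentially)
  have Q0: "Q n 0 = 1 / 2" for n by (simp add: Q_def normal_tail_0)
  \<comment> \<open>The walk is watched for \<open>m\<close> further steps, so that every first
    passage up to \<open>n\<close> leaves at least \<open>m\<close> steps, after which the remaining
    increment is positive with probability nearly one half.\<close>
  have upper: "(1 / 2 - d) * R.prob {f. max_sum n f > x} \<le> R.prob {f. S (n + m) f > x}" for n x
  proof -
    have "(1 / 2 - d) * R.prob {f. max_sum n f > x} = (\<Sum>k\<le>n. R.prob {f. E k x f} * (1 / 2 - d))"
      by (simp add: max_E sum_distrib_right mult.commute sum_distrib_left)
    also have "\<dots> \<le> (\<Sum>k\<le>n. R.prob {f. E k x f} * R.prob {f. S (n + m - k) f > 0})"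
    proof (intro sum_mono mult_left_mono)
      fix k assume "k \<in> {..n}"
      then have "m \<le> n + m - k" by simp
      then show "1 / 2 - d \<le> R.prob {f. S (n + m - k) f > 0}"
        using m[of "n + m - k" 0] Q0[of "n + m - k"] by simp
    qed simp
    also have "\<dots> = (\<Sum>k\<le>n. R.prob {f. E k x f \<and> S (n + m - k) (\<lambda>i. f (k + i)) > 0})"
      by (intro sum.cong refl markov[symmetric])
    also have "\<dots> = R.prob {f. \<exists>k\<in>{..n}. E k x f \<and> S (n + m - k) (\<lambda>i. f (k + i)) > 0}"
      by (rule sum_E) (simp, measurable)
    also have "\<dots> \<le> R.prob {f. S (n + m) f > x}"
    proof (rule R.finite_measure_mono)
      show "{f. \<exists>k\<in>{..n}. E k x f \<and> S (n + m - k) (\<lambda>i. f (k + i)) > 0} \<subseteq> {f. S (n + m) f > x}"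
      proof safe
        fix f k assume "k \<le> n" "E k x f" "S (n + m - k) (\<lambda>i. f (k + i)) > 0"
        then show "x < S (n + m) f" using S_split[of k "n + m - k" f] by (simp add: E_def)
      qed
      show "{f. S (n + m) f > x} \<in> sets R.N" by (rule sets1) measurable
    qed
    finally show ?thesis .
  qed
  \<comment> \<open>\<open>C\<close> is an allowance for the overshoot and for the last
    \<open>m\<close> steps. If no increment exceeds \<open>C / (m + 1)\<close>, the overshoot is at
    most \<open>C\<close>, and a first passage during the last \<open>m\<close> steps cannot lead
    above \<open>x + C\<close>. The \<open>1\<close> in \<open>m + 1\<close> covers the case
    \<open>m = 0\<close>.\<close>
  have lower: "R.prob {f. S n f > x + C}
      \<le> (1 / 2 + d) * R.prob {f. max_sum n f > x} + real n * tail \<nu> (C / real (m + 1))"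
    if "m \<le> n" "0 \<le> x" "0 \<le> C" for n x C
  proof -
    let ?c = "C / real (m + 1)"
    let ?A = "{f. \<exists>k\<in>{..n - m}. E k x f \<and> S (n - k) (\<lambda>i. f (k + i)) > 0}"
    let ?B = "\<Union>i\<in>{..<n}. {f. f i > ?c}"
    have mc: "real m * ?c \<le> C" "?c \<le> C" using that by (simp_all add: field_simps)
    have "{f. S n f > x + C} \<subseteq> ?A \<union> ?B"
    proof safe
      fix f assume f: "x + C < S n f" and nB: "f \<notin> ?B"
      have le: "f i \<le> ?c" if "i < n" for i using nB that by (auto simp: not_less)
      have "max_sum n f > x" using f that by (auto simp: max_sum_greater_iff S_def[symmetric] intro!: exI[of _ n])
      then obtain k where k: "k \<le> n" "E k x f" by (auto simp: max_iff)
      show "\<exists>k\<in>{..n - m}. E k x f \<and> 0 < S (n - k) (\<lambda>i. f (k + i))"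
      proof (cases "k \<le> n - m")
        case True
        obtain j where j: "k = Suc j" using k \<open>0 \<le> x\<close> by (cases k) (auto simp: E_def S_def)
        have "S k f = S j f + f j" by (simp add: S_def j)
        moreover have "S j f \<le> x" using k j by (simp add: E_def)
        ultimately have "S k f \<le> x + C" using le[of j] k j mc by simp
        then show ?thesis using S_split[of k "n - k" f] k f True by (intro bexI[of _ k]) auto
      next
        case False
        then have "S (n - m) f \<le> x" using k by (simp add: E_def)
        moreover have "S m (\<lambda>i. f (n - m + i)) \<le> (\<Sum>i<m. ?c)"
          unfolding S_def by (rule sum_mono, rule le) (use that in auto)
        ultimately have "S n f \<le> x + C" using S_split[of "n - m" m f] that mc by simp
        then show ?thesis using f by simp
      qed
    qed
    then have "R.prob {f. S n f > x + C} \<le> R.prob (?A \<union> ?B)"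
    proof (rule R.finite_measure_mono)
      have "?A \<in> sets R.N" by (rule sets1) measurable
      moreover have "?B \<in> sets R.N" by (intro sets.finite_UN sets1) simp_all
      ultimately show "?A \<union> ?B \<in> sets R.N" by (rule sets.Un)
    qed
    also have "\<dots> \<le> R.prob ?A + R.prob ?B"
    proof (rule measure_Un_le)
      show "?A \<in> sets R.N" by (rule sets1) measurable
      show "?B \<in> sets R.N" by (intro sets.finite_UN sets1) simp_all
    qed
    also have "R.prob ?B \<le> (\<Sum>i<n. R.prob {f. f i > ?c})"
      by (rule R.finite_measure_subadditive_finite) (auto intro!: sets1)
    also have "\<dots> = (\<Sum>i<n. tail \<nu> ?c)"
    proof (rule sum.cong[OF refl])
      fix i
      have "tail \<nu> ?c = measure (distr R.N borel (\<lambda>f. f i)) {?c<..}"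
        by (simp only: R.distr_coordinate \<nu>.tail_eq)
      also have "\<dots> = R.prob ((\<lambda>f. f i) -` {?c<..} \<inter> space R.N)"
        by (rule measure_distr) measurable
      finally show "R.prob {f. f i > ?c} = tail \<nu> ?c" by (simp add: vimage_def)
    qed
    also have "\<dots> = real n * tail \<nu> ?c" by simp
    also have "R.prob ?A = (\<Sum>k\<le>n - m. R.prob {f. E k x f \<and> S (n - k) (\<lambda>i. f (k + i)) > 0})"
      by (rule sum_E[symmetric]) (simp, measurable)
    also have "\<dots> = (\<Sum>k\<le>n - m. R.prob {f. E k x f} * R.prob {f. S (n - k) f > 0})"
      by (intro sum.cong refl markov)
    also have "\<dots> \<le> (\<Sum>k\<le>n - m. R.prob {f. E k x f} * (1 / 2 + d))"
    proof (intro sum_mono mult_left_mono)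
      fix k assume "k \<in> {..n - m}"
      then have "m \<le> n - k" using that by auto
      then show "R.prob {f. S (n - k) f > 0} \<le> 1 / 2 + d" using m[of "n - k" 0] Q0[of "n - k"] by simp
    qed simp
    also have "\<dots> = (1 / 2 + d) * (\<Sum>k\<le>n - m. R.prob {f. E k x f})"
      by (subst sum_distrib_right[symmetric]) (rule mult.commute)
    also have "(\<Sum>k\<le>n - m. R.prob {f. E k x f}) \<le> R.prob {f. max_sum n f > x}"
      unfolding max_E by (rule sum_mono2) auto
    finally show ?thesis using d(1) by (simp add: mult_left_mono)
  qed
  have "(\<lambda>n. real n * tail \<nu> (d * v / real (m + 1) * sqrt (real n))) \<longlonglongrightarrow> 0"
    using d(1) \<open>0 < v\<close> by (intro \<nu>.scaled_tail_tendsto_0 sq) simp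
  then have ev1: "\<forall>\<^sub>F n in sequentially. real n * tail \<nu> (d * v / real (m + 1) * sqrt (real n)) < d"
    using d(1) by (rule order_tendstoD)
  have "((\<lambda>n. sqrt (1 + real m * inverse (real n))) \<longlongrightarrow> sqrt (1 + real m * 0)) sequentially"
    by (intro tendsto_intros lim_inverse_n)
  then have ev2: "\<forall>\<^sub>F n in sequentially. sqrt (1 + real m * inverse (real n)) < 1 + d"
    using d(1) by (intro order_tendstoD(2)[where y="sqrt (1 + real m * 0)"]) auto
  show ?thesis
    using ev1 ev2 eventually_ge_at_top[of "m + 1"]
  proof eventually_elim
    case (elim n)
    show ?case
    proof (intro allI impI)
      fix x :: real assume "0 \<le> x"
      let ?P = "R.prob {f. max_sum n f > x}"
      have P01: "0 \<le> ?P" "?P \<le> 1" by simp_all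
      have pos: "0 < v * sqrt (real n)" using elim \<open>0 < v\<close> by simp
      have "Q (n + m) x - Q n x \<le> d"
      proof (cases "x = 0")
        case False
        let ?z = "x / (v * sqrt (real (n + m)))" and ?r = "sqrt (1 + real m * inverse (real n))"
        have n: "0 < real n" using elim by simp
        have "real (n + m) = real n * (1 + real m * inverse (real n))" using n by (simp add: field_simps)
        then have rt: "sqrt (real (n + m)) = sqrt (real n) * ?r" by (metis real_sqrt_mult)
        have r: "1 \<le> ?r" by simp
        have "w * (x / (v * (z * w))) = x / (v * z)" if "1 \<le> w" for w z :: real using that by simp
        from this[OF r] have "?r * ?z = x / (v * sqrt (real n))" unfolding rt .
        moreover have "0 < ?z" using \<open>0 \<le> x\<close> False \<open>0 < v\<close> n by simp
        ultimately show ?thesis using normal_tail_scale[of ?z ?r] r elim(2) by (simp add: Q_def)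
      qed (simp add: Q0 d less_imp_le)
      moreover have "\<bar>R.prob {f. S (n + m) f > x} - Q (n + m) x\<bar> \<le> d" using elim by (intro m) auto
      moreover have "(1 / 2 - d) * ?P = ?P / 2 - d * ?P" by (simp add: algebra_simps)
      moreover have "d * ?P \<le> d" using P01 d(1) by (simp add: mult_left_le)
      moreover have "(1 / 2 - d) * ?P \<le> R.prob {f. S (n + m) f > x}" by (rule upper)
      ultimately have up: "?P \<le> 2 * Q n x + 6 * d" by linarith
      \<comment> \<open>This allowance moves the argument of the normal tail by \<open>d\<close>
        only, while the union bound over the increments still costs less than
        \<open>d\<close>.\<close>
      let ?C = "d * v * sqrt (real n)"
      have "?C / real (m + 1) = d * v / real (m + 1) * sqrt (real n)" by simp
      moreover have "R.prob {f. S n f > x + ?C} \<le> (1 / 2 + d) * ?P + real n * tail \<nu> (?C / real (m + 1))"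
        by (rule lower) (use elim \<open>0 \<le> x\<close> d(1) \<open>0 < v\<close> in simp_all)
      ultimately have "R.prob {f. S n f > x + ?C} \<le> (1 / 2 + d) * ?P + d"
        using elim(1) by simp
      moreover have "\<bar>R.prob {f. S n f > x + ?C} - Q n (x + ?C)\<bar> \<le> d" using elim by (intro m) auto
      moreover have "Q n x - Q n (x + ?C) \<le> d"
      proof -
        have "(x + ?C) / (v * sqrt (real n)) = x / (v * sqrt (real n)) + d"
          using pos \<open>0 < v\<close> elim(3) by (simp add: add_divide_distrib mult.assoc)
        then show ?thesis
          using normal_tail_lipschitz[of "x / (v * sqrt (real n))" "x / (v * sqrt (real n)) + d"] d(1)
          by (simp add: Q_def)
      qed
      moreover have "(1 / 2 + d) * ?P = ?P / 2 + d * ?P" by (simp add: algebra_simps)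
      moreover have "d * ?P \<le> d" using P01 d(1) by (simp add: mult_left_le)
      ultimately have "2 * Q n x - 8 * d \<le> ?P" by linarith
      then show "\<bar>measure (PiM UNIV (\<lambda>_::nat. \<nu>)) {f. max_sum n f > x}
          - 2 * normal_tail (x / (v * sqrt (real n)))\<bar> \<le> e"
        using up d unfolding Q_def R.N_def by simp
    qed
  qed
qed

text \<open>For \<open>n\<close> beyond some \<open>n0\<close> the preceding bound holds at every
  level \<open>x \<ge> 0\<close>. For the finitely many smaller \<open>n\<close> both terms are
  small at high levels, being at most their values at a common index \<open>k\<close>.\<close>

lemma max_sum_clt_uniform:
  fixes \<nu> :: "real measure" and v e :: real
  assumes \<nu>: "real_distribution \<nu>" and sq: "integrable \<nu> (\<lambda>x. x\<^sup>2)"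
    and mean: "(\<integral>x. x \<partial>\<nu>) = 0" and var: "(\<integral>x. x\<^sup>2 \<partial>\<nu>) = v\<^sup>2" and "0 < v" "0 < e"
  shows "\<forall>\<^sub>F x in at_top. \<forall>n\<ge>1.
    \<bar>measure (PiM UNIV (\<lambda>_::nat. \<nu>)) {f. max_sum n f > x} - 2 * normal_tail (x / (v * sqrt (real n)))\<bar> \<le> e"
proof -
  interpret R: real_product "\<lambda>_::nat. \<nu>" by (rule real_product.intro) (rule \<nu>)
  obtain n0 where n0: "\<And>n x. n0 \<le> n \<Longrightarrow> 0 \<le> x \<Longrightarrow>
      \<bar>R.prob {f. max_sum n f > x} - 2 * normal_tail (x / (v * sqrt (real n)))\<bar> \<le> e"
    using max_sum_clt[OF assms] unfolding R.N_def by (auto simp: eventually_sequentially)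
  define k where "k = max 1 n0"
  have m: "max_sum n \<in> borel_measurable R.N" for n by measurable
  interpret D: real_distribution "distr R.N borel (max_sum k)"
    by (rule R.real_distribution_distr) (rule m)
  have tl: "tail (distr R.N borel (max_sum k)) x = R.prob {f. max_sum k f > x}" for x
    unfolding D.tail_eq by (subst measure_distr[OF m]) (auto simp: vimage_def)
  have "\<forall>\<^sub>F x in at_top. tail (distr R.N borel (max_sum k)) x < e"
    using D.tail_at_top \<open>0 < e\<close> by (rule order_tendstoD)
  moreover have "\<forall>\<^sub>F x in at_top. normal_tail (x * (1 / (v * sqrt (real k)))) < e / 2"
  proof (rule order_tendstoD)
    have "filterlim (\<lambda>x. x * (1 / (v * sqrt (real k)))) at_top at_top"
      using \<open>0 < v\<close> by (intro filterlim_at_top_mult_tendsto_pos[OF tendsto_const _ filterlim_ident])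
        (auto simp: k_def)
    then show "((\<lambda>x. normal_tail (x * (1 / (v * sqrt (real k))))) \<longlongrightarrow> 0) at_top"
      by (rule filterlim_compose[OF std_normal.tail_at_top])
  qed (use \<open>0 < e\<close> in simp)
  ultimately show ?thesis
    using eventually_ge_at_top[of 0]
  proof eventually_elim
    case (elim x)
    show ?case
    proof (intro allI impI)
      fix n :: nat assume "1 \<le> n"
      show "\<bar>measure (PiM UNIV (\<lambda>_::nat. \<nu>)) {f. max_sum n f > x} - 2 * normal_tail (x / (v * sqrt (real n)))\<bar> \<le> e"
      proof (cases "n0 \<le> n")
        case True
        then show ?thesis using n0 elim by (simp add: R.N_def)
      next
        case False
        then have nk: "n \<le> k" by (simp add: k_def)
        have "R.prob {f. max_sum n f > x} \<le> R.prob {f. max_sum k f > x}"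
        proof (rule R.finite_measure_mono)
          show "{f. max_sum n f > x} \<subseteq> {f. max_sum k f > x}"
            using max_sum_mono[OF nk] by (auto intro: less_le_trans)
          show "{f. max_sum k f > x} \<in> sets R.N"
            using measurable_sets[OF m, of "{x<..}" k] by (simp add: vimage_def)
        qed
        then have 1: "R.prob {f. max_sum n f > x} < e" using elim(1) tl by simp
        have "x / (v * sqrt (real k)) \<le> x / (v * sqrt (real n))"
          using nk \<open>1 \<le> n\<close> elim(3) \<open>0 < v\<close> by (intro divide_left_mono mult_left_mono mult_pos_pos) auto
        from std_normal.tail_antimono[OF this] have 2: "normal_tail (x / (v * sqrt (real n))) < e / 2"
          using elim(2) by simp
        have "0 \<le> R.prob {f. max_sum n f > x}" "0 \<le> normal_tail (x / (v * sqrt (real n)))" by simp_all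
        then show ?thesis using 1 2 unfolding R.N_def[symmetric] by linarith
      qed
    qed
  qed
qed

section \<open>Subexponential distributions\<close>

text \<open>The part of a convolution tail that is not due to a single large summand.
  Subexponentiality makes it negligible against the tail, first \<open>x\<close> and then
  \<open>K\<close> tending to infinity.\<close>

definition both_large :: "real measure \<Rightarrow> real measure \<Rightarrow> real \<Rightarrow> real \<Rightarrow> real" where
  "both_large A B K x = measure (A \<Otimes>\<^sub>M B) {p. K < fst p \<and> K < snd p \<and> x < fst p + snd p}"

lemma both_large_borel [simp]:
  "{p. K < fst p \<and> K < snd p \<and> x < fst p + snd p} \<in> sets (borel \<Otimes>\<^sub>M (borel :: real measure))"
proof -
  have "{p \<in> space (borel \<Otimes>\<^sub>M borel). K < fst p \<and> K < snd p \<and> x < fst p + (snd p :: real)} \<in> sets (borel \<Otimes>\<^sub>M borel)"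
    by measurable
  then show ?thesis by (simp add: space_pair_measure)
qed

lemma sum_greater_borel [simp]: "{p. x < fst p + snd p} \<in> sets (borel \<Otimes>\<^sub>M (borel :: real measure))"
proof -
  have "{p \<in> space (borel \<Otimes>\<^sub>M borel). x < fst p + (snd p :: real)} \<in> sets (borel \<Otimes>\<^sub>M borel)"
    by measurable
  then show ?thesis by (simp add: space_pair_measure)
qed

context
  fixes A B :: "real measure"
  assumes A: "real_distribution A" and B: "real_distribution B"
begin

interpretation A: real_distribution A by (rule A)
interpretation B: real_distribution B by (rule B)
interpretation AB: pair_prob_space A B by unfold_locales

lemma sets_pair_real [measurable_cong]: "sets (A \<Otimes>\<^sub>M B) = sets (borel \<Otimes>\<^sub>M borel)"
  by (rule sets_pair_measure_cong) simp_all

lemma space_pair_real: "space (A \<Otimes>\<^sub>M B) = UNIV"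
  by (simp add: space_pair_measure)

lemma measure_pair_times:
  assumes "X \<in> sets borel" "Y \<in> sets borel"
  shows "measure (A \<Otimes>\<^sub>M B) (X \<times> Y) = measure A X * measure B Y"
proof -
  have "emeasure (A \<Otimes>\<^sub>M B) (X \<times> Y) = emeasure A X * emeasure B Y"
    using assms by (intro B.emeasure_pair_measure_Times) simp_all
  then show ?thesis by (simp add: measure_def enn2real_mult)
qed

lemma both_large_set [measurable]: "{p. K < fst p \<and> K < snd p \<and> x < fst p + snd p} \<in> sets (A \<Otimes>\<^sub>M B)"
  by (simp add: sets_pair_real)

lemma emeasure_both_large:
  "emeasure (A \<Otimes>\<^sub>M B) {p. K < fst p \<and> K < snd p \<and> x < fst p + snd p}
     = (\<integral>\<^sup>+u. (if K < u then ennreal (tail B (max K (x - u))) else 0) \<partial>A)"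
proof -
  have "emeasure B (Pair u -` {p. K < fst p \<and> K < snd p \<and> x < fst p + snd p})
      = (if K < u then ennreal (tail B (max K (x - u))) else 0)" for u
  proof (cases "K < u")
    case True
    then have "Pair u -` {p. K < fst p \<and> K < snd p \<and> x < fst p + snd p} = {max K (x - u)<..}"
      by (auto simp: less_diff_eq diff_less_eq algebra_simps)
    then show ?thesis using True by (simp add: B.tail_eq B.emeasure_eq_measure)
  qed simp
  then show ?thesis by (subst B.emeasure_pair_measure_alt[OF both_large_set]) simp
qed

lemma tail_convolution: "tail (A \<star> B) x = measure (A \<Otimes>\<^sub>M B) {p. x < fst p + snd p}"
proof -
  have m: "(\<lambda>(x, y). x + y) \<in> borel_measurable (A \<Otimes>\<^sub>M B)" by measurable
  have "prob_space (A \<star> B)" unfolding convolution_def by (rule AB.prob_space_distr[OF m])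
  then interpret C: real_distribution "A \<star> B"
    by (simp add: real_distribution_def real_distribution_axioms_def)
  have "(\<lambda>(x, y). x + y) -` {x<..} \<inter> space (A \<Otimes>\<^sub>M B) = {p. x < fst p + snd p}"
    by (auto simp: space_pair_real)
  then show ?thesis
    unfolding C.tail_eq unfolding convolution_def by (subst measure_distr[OF m]) simp_all
qed

lemma sum_set [measurable]: "{p. x < fst p + snd p} \<in> sets (A \<Otimes>\<^sub>M B)"
  by (simp add: sets_pair_real)

text \<open>If one summand is at most \<open>K\<close>, the other must exceed
  \<open>x - K\<close>.\<close>

lemma tail_convolution_le:
  "tail (A \<star> B) x \<le> tail A (x - K) + tail B (x - K) + both_large A B K x"
proof -
  let ?U = "{x - K<..} \<times> (UNIV :: real set)" and ?V = "(UNIV :: real set) \<times> {x - K<..}"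
  let ?J = "{p. K < fst p \<and> K < snd p \<and> x < fst p + snd p}"
  have s: "?U \<in> sets (A \<Otimes>\<^sub>M B)" "?V \<in> sets (A \<Otimes>\<^sub>M B)" "?J \<in> sets (A \<Otimes>\<^sub>M B)"
    by (auto intro: pair_measureI both_large_set)
  have "measure (A \<Otimes>\<^sub>M B) {p. x < fst p + snd p} \<le> measure (A \<Otimes>\<^sub>M B) (?U \<union> ?V \<union> ?J)"
    by (rule AB.finite_measure_mono) (use s in auto)
  also have "\<dots> \<le> measure (A \<Otimes>\<^sub>M B) (?U \<union> ?V) + measure (A \<Otimes>\<^sub>M B) ?J"
    by (rule measure_Un_le) (use s in auto)
  also have "measure (A \<Otimes>\<^sub>M B) (?U \<union> ?V) \<le> measure (A \<Otimes>\<^sub>M B) ?U + measure (A \<Otimes>\<^sub>M B) ?V"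
    by (rule measure_Un_le) (use s in auto)
  also have "measure (A \<Otimes>\<^sub>M B) ?U = tail A (x - K)"
    using B.prob_space by (simp add: measure_pair_times A.tail_eq)
  also have "measure (A \<Otimes>\<^sub>M B) ?V = tail B (x - K)"
    using A.prob_space by (simp add: measure_pair_times B.tail_eq)
  finally show ?thesis by (simp add: tail_convolution both_large_def)
qed

end

text \<open>For a fixed first summand \<open>u > K\<close> the second must exceed
  \<open>max K (x - u)\<close>, which is at least \<open>K\<close>; hence only tails beyond
  \<open>K\<close> are compared. The sum over \<open>j\<close> is there for the possible crossing
  times of a line, whose tails add up to an integrated tail.\<close>

lemma both_large_sum_mono:
  assumes A: "real_distribution A" and B: "\<And>j. j \<in> I \<Longrightarrow> real_distribution (B j)" and B': "real_distribution B'"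
    and I: "finite I" and le: "\<And>z. K \<le> z \<Longrightarrow> (\<Sum>j\<in>I. tail (B j) z) \<le> C * tail B' z" and "0 \<le> C"
  shows "(\<Sum>j\<in>I. both_large A (B j) K x) \<le> C * both_large A B' K x"
proof -
  interpret A: real_distribution A by fact
  interpret B': real_distribution B' by fact
  interpret AB': pair_prob_space A B' by unfold_locales
  let ?J = "{p. K < fst p \<and> K < snd p \<and> x < fst p + snd p}"
  have m: "(\<lambda>u. if K < u then ennreal (tail D (max K (x - u))) else 0) \<in> borel_measurable A"
    if "real_distribution D" for D
  proof -
    interpret D: real_distribution D by fact
    have "mono (\<lambda>x. - tail D x)" by (auto simp: mono_def D.tail_antimono)
    then have [measurable]: "tail D \<in> borel_measurable borel"
      using borel_measurable_uminus[OF borel_measurable_mono] by fastforce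
    show ?thesis by measurable
  qed
  have "(\<Sum>j\<in>I. emeasure (A \<Otimes>\<^sub>M B j) ?J)
      = (\<Sum>j\<in>I. \<integral>\<^sup>+u. (if K < u then ennreal (tail (B j) (max K (x - u))) else 0) \<partial>A)"
    by (intro sum.cong refl emeasure_both_large A B)
  also have "\<dots> = (\<integral>\<^sup>+u. (\<Sum>j\<in>I. if K < u then ennreal (tail (B j) (max K (x - u))) else 0) \<partial>A)"
    by (rule nn_integral_sum[symmetric]) (intro m B)
  also have "\<dots> \<le> (\<integral>\<^sup>+u. ennreal C * (if K < u then ennreal (tail B' (max K (x - u))) else 0) \<partial>A)"
  proof (rule nn_integral_mono)
    fix u
    have "0 \<le> tail (B j) z" if "j \<in> I" for j z
      using B[OF that] by (rule real_distribution.tail_nonneg)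
    then have "(\<Sum>j\<in>I. ennreal (tail (B j) z)) = ennreal (\<Sum>j\<in>I. tail (B j) z)" for z
      by (intro sum_ennreal) auto
    then show "(\<Sum>j\<in>I. if K < u then ennreal (tail (B j) (max K (x - u))) else 0)
        \<le> ennreal C * (if K < u then ennreal (tail B' (max K (x - u))) else 0)"
      using le[of "max K (x - u)"] \<open>0 \<le> C\<close> by (auto simp flip: ennreal_mult intro!: ennreal_leI)
  qed
  also have "\<dots> = ennreal C * emeasure (A \<Otimes>\<^sub>M B') ?J"
    unfolding emeasure_both_large[OF A B'] by (rule nn_integral_cmult[OF m[OF B']])
  also have "(\<Sum>j\<in>I. emeasure (A \<Otimes>\<^sub>M B j) ?J) = (\<Sum>j\<in>I. ennreal (both_large A (B j) K x))"
  proof (rule sum.cong[OF refl])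
    fix j assume "j \<in> I"
    then interpret Bj: real_distribution "B j" by (rule B)
    interpret ABj: pair_prob_space A "B j" by unfold_locales
    show "emeasure (A \<Otimes>\<^sub>M B j) ?J = ennreal (both_large A (B j) K x)"
      by (simp add: both_large_def ABj.emeasure_eq_measure)
  qed
  also have "\<dots> = ennreal (\<Sum>j\<in>I. both_large A (B j) K x)"
    by (intro sum_ennreal) (simp add: both_large_def)
  finally have "ennreal (\<Sum>j\<in>I. both_large A (B j) K x) \<le> ennreal (C * both_large A B' K x)"
    using \<open>0 \<le> C\<close> by (simp add: both_large_def AB'.emeasure_eq_measure ennreal_mult)
  then show ?thesis
    using \<open>0 \<le> C\<close> by (subst (asm) ennreal_le_iff) (auto simp: both_large_def)
qed

lemma both_large_mono:
  assumes "real_distribution A" "real_distribution B" "real_distribution B'"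
    and "\<And>z. K \<le> z \<Longrightarrow> tail B z \<le> C * tail B' z" and "0 \<le> C"
  shows "both_large A B K x \<le> C * both_large A B' K x"
  using both_large_sum_mono[of A "{()}" "\<lambda>_. B" B' K C x] assms by simp

lemma both_large_commute:
  assumes "real_distribution A" "real_distribution B"
  shows "both_large A B K x = both_large B A K x"
proof -
  interpret A: real_distribution A by fact
  interpret B: real_distribution B by fact
  interpret AB: pair_prob_space A B by unfold_locales
  let ?J = "{p. K < fst p \<and> K < snd p \<and> x < fst p + snd p}"
  have "both_large A B K x = measure (distr (B \<Otimes>\<^sub>M A) (A \<Otimes>\<^sub>M B) (\<lambda>(x, y). (y, x))) ?J"
    unfolding both_large_def by (subst AB.distr_pair_swap) simp
  also have "\<dots> = measure (B \<Otimes>\<^sub>M A) ((\<lambda>(x, y). (y, x)) -` ?J \<inter> space (B \<Otimes>\<^sub>M A))"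
    by (rule measure_distr) (auto intro: both_large_set assms)
  also have "(\<lambda>(x, y). (y, x)) -` ?J \<inter> space (B \<Otimes>\<^sub>M A) = ?J"
    by (auto simp: space_pair_real assms add.commute)
  finally show ?thesis by (simp add: both_large_def)
qed

text \<open>Among the ways to exceed \<open>x\<close>, those where one term is at most \<open>K\<close> have probability at least
  \<open>2 F(K)\<close> times the tail of \<open>F\<close>.\<close>

context
  fixes F :: "real measure"
  assumes F: "subexponential F"
begin

lemma subexponential_real_distribution: "real_distribution F"
  using F by (simp add: subexponential_def distribution_nonneg_def)

interpretation F: real_distribution F by (rule subexponential_real_distribution)
interpretation FF: pair_prob_space F F by unfold_locales

lemma tail_pos: "0 < tail F x"
  using F by (simp add: subexponential_def)

lemma subexponential_ratio: "((\<lambda>x. tail (F \<star> F) x / tail F x) \<longlongrightarrow> 2) at_top"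
  using F by (simp add: subexponential_def tail_equiv_def)

lemma measure_atLeast_0: "measure F {0..} = 1"
proof (subst F.prob_eq_1)
  have "AE x in F. 0 \<le> x" using F by (simp add: subexponential_def distribution_nonneg_def)
  then show "AE x in F. x \<in> {0..}" by simp
qed simp

lemma measure_Icc_0: "0 \<le> y \<Longrightarrow> measure F {0..y} = 1 - tail F y"
proof -
  assume "0 \<le> y"
  then have "{0..} = {0..y} \<union> {y<..}" by auto
  then have "measure F {0..} = measure F ({0..y} \<union> {y<..})" by simp
  also have "\<dots> = measure F {0..y} + measure F {y<..}"
    by (rule F.finite_measure_Union) auto
  finally show ?thesis using measure_atLeast_0 by (simp add: F.tail_eq)
qed

text \<open>The event that the sum exceeds \<open>x\<close> contains three disjoint pieces: the
  first term exceeds \<open>x\<close>; the first is at most \<open>y\<close> and the second exceeds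
  \<open>x\<close>; the first is between \<open>y\<close> and \<open>x\<close> and the second
  exceeds \<open>x - y\<close>. The first two use up nearly \<open>2 * tail F x\<close> already, and
  the third bounds \<open>tail F (x - y)\<close>.\<close>

lemma long_tailed: "((\<lambda>x. tail F (x - y) / tail F x) \<longlongrightarrow> 1) at_top"
proof -
  have pos: "((\<lambda>x. tail F (x - y) / tail F x) \<longlongrightarrow> 1) at_top" if "0 \<le> y" for y
  proof (rule tendsto_sandwich[where f="\<lambda>_. 1"
        and h="\<lambda>x. (tail (F \<star> F) x / tail F x - 2 + tail F y) / (tail F y - tail F x)"])
    show "((\<lambda>x. (tail (F \<star> F) x / tail F x - 2 + tail F y) / (tail F y - tail F x)) \<longlongrightarrow> 1) at_top"
    proof -
      have "((\<lambda>x. (tail (F \<star> F) x / tail F x - 2 + tail F y) / (tail F y - tail F x))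
          \<longlongrightarrow> (2 - 2 + tail F y) / (tail F y - 0)) at_top"
        using tail_pos[of y] by (intro tendsto_intros subexponential_ratio F.tail_at_top) simp
      then show ?thesis using tail_pos[of y] by simp
    qed
    have "\<forall>\<^sub>F x in at_top. tail F x < tail F y"
      using F.tail_at_top tail_pos by (rule order_tendstoD)
    then show "\<forall>\<^sub>F x in at_top. tail F (x - y) / tail F x
        \<le> (tail (F \<star> F) x / tail F x - 2 + tail F y) / (tail F y - tail F x)"
      using eventually_ge_at_top[of y]
    proof eventually_elim
      case (elim x)
      let ?X = "{x<..} \<times> {0..}" and ?Y = "{0..y} \<times> {x<..}" and ?Z = "{y<..x} \<times> {x - y<..}"
      have s: "?X \<in> sets (F \<Otimes>\<^sub>M F)" "?Y \<in> sets (F \<Otimes>\<^sub>M F)" "?Z \<in> sets (F \<Otimes>\<^sub>M F)"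
        by (auto intro: pair_measureI)
      have "measure (F \<Otimes>\<^sub>M F) ?X + (measure (F \<Otimes>\<^sub>M F) ?Y + measure (F \<Otimes>\<^sub>M F) ?Z)
          = measure (F \<Otimes>\<^sub>M F) ?X + measure (F \<Otimes>\<^sub>M F) (?Y \<union> ?Z)"
        using s by (subst FF.finite_measure_Union) auto
      also have "\<dots> = measure (F \<Otimes>\<^sub>M F) (?X \<union> (?Y \<union> ?Z))"
        using s elim by (subst FF.finite_measure_Union) auto
      also have "\<dots> \<le> measure (F \<Otimes>\<^sub>M F) {p. x < fst p + snd p}"
        by (rule FF.finite_measure_mono) (use that in \<open>auto intro: sum_set F.real_distribution_axioms\<close>)
      also have "\<dots> = tail (F \<star> F) x"
        by (simp add: tail_convolution F.real_distribution_axioms)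
      also have "measure (F \<Otimes>\<^sub>M F) ?X = tail F x"
        by (simp add: measure_pair_times F.real_distribution_axioms measure_atLeast_0 F.tail_eq)
      also have "measure (F \<Otimes>\<^sub>M F) ?Y = (1 - tail F y) * tail F x"
        using measure_Icc_0[OF that] by (simp add: measure_pair_times F.real_distribution_axioms F.tail_eq)
      also have "measure (F \<Otimes>\<^sub>M F) ?Z = (tail F y - tail F x) * tail F (x - y)"
        using F.tail_diff[of y x] elim
        by (simp add: measure_pair_times F.real_distribution_axioms F.tail_eq)
      finally have "(tail F y - tail F x) * tail F (x - y) \<le> tail (F \<star> F) x - 2 * tail F x + tail F y * tail F x"
        by (simp add: algebra_simps)
      also have "\<dots> = (tail (F \<star> F) x / tail F x - 2 + tail F y) * tail F x"
        using tail_pos[of x] by (simp add: field_simps)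
      finally show ?case using elim tail_pos[of x] by (simp add: field_simps)
    qed
    show "\<forall>\<^sub>F x in at_top. 1 \<le> tail F (x - y) / tail F x"
      using that tail_pos F.tail_antimono by (auto intro!: always_eventually)
  qed simp
  show ?thesis
  proof (cases "0 \<le> y")
    \<comment> \<open>Negative \<open>y\<close> follows from positive \<open>- y\<close> by
      translating \<open>x\<close> and taking reciprocals.\<close>
    case False
    have "filterlim (\<lambda>x. - y + x) at_top at_top"
      by (rule filterlim_tendsto_add_at_top[OF tendsto_const filterlim_ident])
    then have "filterlim (\<lambda>x. x - y) at_top at_top" by simp
    then have "((\<lambda>x. tail F ((x - y) - (- y)) / tail F (x - y)) \<longlongrightarrow> 1) at_top"
      using False by (intro filterlim_compose[OF pos[of "- y"]]) simp_all
    then have "((\<lambda>x. inverse (tail F ((x - y) - (- y)) / tail F (x - y))) \<longlongrightarrow> inverse 1) at_top"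
      by (rule tendsto_inverse) simp
    then show ?thesis by simp
  qed (rule pos)
qed

lemma long_tailed_le:
  assumes "0 < e" shows "\<forall>\<^sub>F x in at_top. tail F (x - y) \<le> (1 + e) * tail F x"
proof -
  have "\<forall>\<^sub>F x in at_top. tail F (x - y) / tail F x < 1 + e"
    using assms by (intro order_tendstoD(2)[OF long_tailed]) simp
  then show ?thesis by eventually_elim (use tail_pos in \<open>simp add: divide_less_eq less_imp_le\<close>)
qed

lemma both_large_small:
  assumes "0 < e" shows "\<forall>\<^sub>F K in at_top. \<forall>\<^sub>F x in at_top. both_large F F K x \<le> e * tail F x"
proof -
  \<comment> \<open>Half of \<open>e\<close> is for the ratio of the convolution tail, the other
    half for \<open>2 * tail F K\<close>.\<close>
  have "\<forall>\<^sub>F K in at_top. tail F K < e / 4"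
    using assms by (intro order_tendstoD(2)[OF F.tail_at_top]) simp
  then show ?thesis using eventually_ge_at_top[of 0]
  proof eventually_elim
    case K: (elim K)
    have "\<forall>\<^sub>F x in at_top. tail (F \<star> F) x / tail F x < 2 + e / 2"
      using assms by (intro order_tendstoD(2)[OF subexponential_ratio]) simp
    then show ?case using eventually_ge_at_top[of K]
    proof eventually_elim
      case (elim x)
      let ?X = "{x<..} \<times> {0..K}" and ?Y = "{0..K} \<times> {x<..}"
      let ?J = "{p. K < fst p \<and> K < snd p \<and> x < fst p + snd p}"
      have s: "?X \<in> sets (F \<Otimes>\<^sub>M F)" "?Y \<in> sets (F \<Otimes>\<^sub>M F)" "?J \<in> sets (F \<Otimes>\<^sub>M F)"
        by (auto intro: pair_measureI both_large_set F.real_distribution_axioms)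
      have "measure (F \<Otimes>\<^sub>M F) ?X + (measure (F \<Otimes>\<^sub>M F) ?Y + measure (F \<Otimes>\<^sub>M F) ?J)
          = measure (F \<Otimes>\<^sub>M F) ?X + measure (F \<Otimes>\<^sub>M F) (?Y \<union> ?J)"
        using s by (subst FF.finite_measure_Union) auto
      also have "\<dots> = measure (F \<Otimes>\<^sub>M F) (?X \<union> (?Y \<union> ?J))"
        using s elim by (subst FF.finite_measure_Union) auto
      also have "\<dots> \<le> measure (F \<Otimes>\<^sub>M F) {p. x < fst p + snd p}"
        by (rule FF.finite_measure_mono) (auto intro: sum_set F.real_distribution_axioms)
      also have "\<dots> = tail (F \<star> F) x"
        by (simp add: tail_convolution F.real_distribution_axioms)
      also have "measure (F \<Otimes>\<^sub>M F) ?X = tail F x * (1 - tail F K)"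
        using measure_Icc_0[OF K(2)] by (simp add: measure_pair_times F.real_distribution_axioms F.tail_eq)
      also have "measure (F \<Otimes>\<^sub>M F) ?Y = (1 - tail F K) * tail F x"
        using measure_Icc_0[OF K(2)] by (simp add: measure_pair_times F.real_distribution_axioms F.tail_eq)
      finally have "both_large F F K x \<le> tail (F \<star> F) x - 2 * tail F x + 2 * tail F K * tail F x"
        by (simp add: both_large_def algebra_simps)
      also have "\<dots> \<le> (2 + e / 2) * tail F x - 2 * tail F x + 2 * (e / 4) * tail F x"
        using elim K tail_pos[of x] by (intro add_mono diff_mono mult_right_mono mult_left_mono)
          (auto simp: divide_less_eq)
      finally show ?case by (simp add: algebra_simps)
    qed
  qed
qed

text \<open>The two factors of \<open>both_large\<close> are replaced by \<open>F\<close> one at a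
  time, with a swap of the coordinates in between. This multiplies it by
  \<open>\<alpha> * \<beta>\<close>, so that only the single-summand terms keep the constants
  \<open>\<alpha>\<close> and \<open>\<beta>\<close>.\<close>

lemma tail_convolution_dominated:
  assumes A: "real_distribution A" and B: "real_distribution B"
    and le: "\<forall>\<^sub>F x in at_top. tail A x \<le> \<alpha> * tail F x" "\<forall>\<^sub>F x in at_top. tail B x \<le> \<beta> * tail F x"
    and "0 < \<alpha>" "0 < \<beta>" "0 < e"
  shows "\<forall>\<^sub>F x in at_top. tail (A \<star> B) x \<le> (\<alpha> + \<beta> + e) * tail F x"
proof -
  obtain K1 where K1: "\<And>z. K1 \<le> z \<Longrightarrow> tail A z \<le> \<alpha> * tail F z" using le(1) by (auto simp: eventually_at_top_linorder)
  obtain K2 where K2: "\<And>z. K2 \<le> z \<Longrightarrow> tail B z \<le> \<beta> * tail F z" using le(2) by (auto simp: eventually_at_top_linorder)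
  have "\<forall>\<^sub>F K in at_top. K1 \<le> K \<and> K2 \<le> K \<and> (\<forall>\<^sub>F x in at_top. both_large F F K x \<le> (e / (2 * \<alpha> * \<beta>)) * tail F x)"
    using assms by (intro eventually_conj eventually_ge_at_top both_large_small) simp
  then obtain K where K: "K1 \<le> K" "K2 \<le> K" "\<forall>\<^sub>F x in at_top. both_large F F K x \<le> (e / (2 * \<alpha> * \<beta>)) * tail F x"
    using eventually_happens'[OF trivial_limit_at_top_linorder] by blast
  have "\<forall>\<^sub>F x in at_top. tail F (x - K) \<le> (1 + e / (2 * (\<alpha> + \<beta>))) * tail F x"
    using assms by (intro long_tailed_le) simp
  then show ?thesis using K(3) eventually_ge_at_top[of "K + max K1 K2"]
  proof eventually_elim
    case (elim x)
    have "tail (A \<star> B) x \<le> tail A (x - K) + tail B (x - K) + both_large A B K x"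
      by (rule tail_convolution_le[OF A B])
    also have "tail A (x - K) \<le> \<alpha> * tail F (x - K)" using elim by (intro K1) simp
    also have "tail B (x - K) \<le> \<beta> * tail F (x - K)" using elim by (intro K2) simp
    also have "both_large A B K x \<le> \<beta> * both_large A F K x"
      using assms K K2 by (intro both_large_mono) (auto intro: subexponential_real_distribution)
    also have "both_large A F K x = both_large F A K x"
      by (intro both_large_commute A subexponential_real_distribution)
    also have "\<beta> * both_large F A K x \<le> \<beta> * (\<alpha> * both_large F F K x)"
      using assms K K1 by (intro mult_left_mono both_large_mono) (auto intro: subexponential_real_distribution)
    also have "\<beta> * (\<alpha> * both_large F F K x) \<le> \<beta> * (\<alpha> * ((e / (2 * \<alpha> * \<beta>)) * tail F x))"
      using elim assms by (intro mult_left_mono) auto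
    also have "\<dots> = e / 2 * tail F x" using assms by simp
    finally have "tail (A \<star> B) x \<le> (\<alpha> + \<beta>) * tail F (x - K) + e / 2 * tail F x" by (simp add: algebra_simps)
    also have "\<dots> \<le> (\<alpha> + \<beta>) * ((1 + e / (2 * (\<alpha> + \<beta>))) * tail F x) + e / 2 * tail F x"
      using elim assms by (intro add_mono mult_left_mono) auto
    also have "\<dots> = (\<alpha> + \<beta> + e) * tail F x" using assms by (simp add: field_simps)
    finally show ?case by simp
  qed
qed

end

section \<open>The integrated tail and its Riemann sums\<close>

locale integrated_tail =
  fixes F :: "real measure"
  assumes F_nonneg: "distribution_nonneg F" and F_mean: "integrable F (\<lambda>x. x)"
    and subexp: "subexponential F" and subexp_int: "subexponential (int_tail_distribution F)"
begin

sublocale F: real_distribution F using F_nonneg by (simp add: distribution_nonneg_def)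

abbreviation "G \<equiv> int_tail_distribution F"

sublocale G: real_distribution G
  using int_tail_distribution(1)[OF F_nonneg F_mean] by (simp add: distribution_nonneg_def)

text \<open>The integrated tail without truncation at 1, so that differences are integrals and sums
  telescope from \<open>x \<ge> 0\<close> on. For large arguments it coincides with
  \<open>int_tail F\<close> and with the tail of \<open>G\<close>.\<close>

definition g :: "real \<Rightarrow> real" where
  "g x = (LBINT u:{x..}. tail F u)"

lemma set_integrable_tail: "A \<in> sets borel \<Longrightarrow> A \<subseteq> {0..} \<Longrightarrow> set_integrable lborel A (tail F)"
  using set_integrable_subset[OF tail_integrable[OF F_nonneg F_mean], of A] by simp

lemma tail_eq_int_tail: "0 \<le> x \<Longrightarrow> tail G x = int_tail F x"
  by (rule int_tail_distribution(2)[OF F_nonneg F_mean])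

lemma int_tail_eq: "int_tail F x = min 1 (g x)"
  by (simp add: int_tail_def g_def)

lemma g_split:
  assumes "0 \<le> x" "x \<le> y"
  shows "g x - g y = (LBINT u:{x..<y}. tail F u)"
proof -
  have "{x..} = {x..<y} \<union> {y..}" using assms by auto
  then have "g x = (LBINT u:{x..<y}. tail F u) + g y"
    unfolding g_def
    using set_integral_Un[of "{x..<y}" "{y..}" lborel "tail F"] set_integrable_tail[of "{x..<y}"]
      set_integrable_tail[of "{y..}"] assms by (simp add: ivl_disj_int subset_iff)
  then show ?thesis by simp
qed

lemma g_diff:
  assumes "0 \<le> x" "x \<le> y"
  shows "(y - x) * tail F y \<le> g x - g y" "g x - g y \<le> (y - x) * tail F x"
proof -
  have const: "set_integrable lborel {x..<y} (\<lambda>_. c :: real)" for c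
    unfolding set_integrable_def using assms by (auto intro!: integrable_real_indicator integrable_mult_left)
  have val: "(LBINT u:{x..<y}. c) = (y - x) * c" for c :: real
    using assms by (simp add: set_lebesgue_integral_def)
  have "set_integrable lborel {x..<y} (tail F)" using assms by (intro set_integrable_tail) auto
  then have "(LBINT u:{x..<y}. tail F y) \<le> (LBINT u:{x..<y}. tail F u)"
    "(LBINT u:{x..<y}. tail F u) \<le> (LBINT u:{x..<y}. tail F x)"
    by (auto intro!: set_integral_mono const F.tail_antimono)
  then show "(y - x) * tail F y \<le> g x - g y" "g x - g y \<le> (y - x) * tail F x"
    by (simp_all add: g_split[OF assms] val)
qed

lemma g_antimono: "0 \<le> x \<Longrightarrow> x \<le> y \<Longrightarrow> g y \<le> g x"
  using g_diff(1)[of x y] by (smt (verit) mult_nonneg_nonneg F.tail_nonneg)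

lemma g_nonneg: "0 \<le> g x"
  unfolding g_def set_lebesgue_integral_def by (intro integral_nonneg_AE) (auto simp: F.tail_nonneg)

lemma tail_G_pos: "0 < tail G x"
  by (rule tail_pos[OF subexp_int])

lemma g_pos: "0 \<le> x \<Longrightarrow> 0 < g x"
  using tail_G_pos[of x] by (simp add: tail_eq_int_tail int_tail_eq min_def split: if_splits)

lemma eventually_g_eq: "\<forall>\<^sub>F x in at_top. tail G x = g x \<and> int_tail F x = g x"
proof -
  have "\<forall>\<^sub>F x in at_top. tail G x < 1" using G.tail_at_top by (rule order_tendstoD) simp
  then show ?thesis using eventually_ge_at_top[of 0]
    by eventually_elim (auto simp: tail_eq_int_tail int_tail_eq min_def)
qed

lemma g_at_top: "(g \<longlongrightarrow> 0) at_top"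
  using eventually_g_eq by (intro Lim_transform_eventually[OF G.tail_at_top]) (auto elim: eventually_mono)

lemma g_shift_tendsto: "((\<lambda>x. g (x + y) / g x) \<longlongrightarrow> 1) at_top"
proof (rule Lim_transform_eventually)
  show "((\<lambda>x. tail G (x - (- y)) / tail G x) \<longlongrightarrow> 1) at_top"
    by (rule long_tailed[OF subexp_int])
  have "\<forall>\<^sub>F x in at_top. tail G (x + y) = g (x + y)"
    using eventually_compose_filterlim[OF eventually_g_eq filterlim_tendsto_add_at_top[OF tendsto_const[of y] filterlim_ident]]
    by (auto simp: add.commute elim: eventually_mono)
  then show "\<forall>\<^sub>F x in at_top. tail G (x - (- y)) / tail G x = g (x + y) / g x"
    using eventually_g_eq by eventually_elim simp
qed

lemma sum_tail_le: "0 \<le> z \<Longrightarrow> 0 < c \<Longrightarrow> (\<Sum>n<m. tail F (z + real (Suc n) * c)) \<le> g z / c"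
proof -
  assume zc: "0 \<le> z" "0 < c"
  have "c * (\<Sum>n<m. tail F (z + real (Suc n) * c)) \<le> g z - g (z + real m * c)"
  proof (induction m)
    case (Suc m)
    then show ?case using g_diff(1)[of "z + real m * c" "z + real (Suc m) * c"] zc
      by (simp add: algebra_simps)
  qed simp
  then show ?thesis using g_nonneg[of "z + real m * c"] zc by (simp add: field_simps)
qed

lemma summable_tail: "0 \<le> z \<Longrightarrow> 0 < c \<Longrightarrow> summable (\<lambda>n. tail F (z + real (Suc n) * c))"
  by (rule summableI_nonneg_bounded[of _ "g z / c"]) (simp_all add: sum_tail_le del: of_nat_Suc)

lemma g_sequence: "0 \<le> z \<Longrightarrow> 0 < c \<Longrightarrow> (\<lambda>m. g (z + real m * c)) \<longlonglongrightarrow> 0"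
  by (intro filterlim_compose[OF g_at_top] filterlim_tendsto_add_at_top[OF tendsto_const]
      filterlim_at_top_mult_tendsto_pos[OF tendsto_const _ filterlim_real_sequentially])

text \<open>The tail is nonincreasing, so a sum over right endpoints of mesh \<open>c\<close> falls
  short of the integral by at most the first cell; this accounts for the shift to
  \<open>z + c\<close>.\<close>

lemma suminf_tail_ge:
  assumes zc: "0 \<le> z" "0 < c"
  shows "g (z + c) / c \<le> (\<Sum>n. tail F (z + real (Suc n) * c))"
proof -
  have "g (z + c) - g (z + c + real m * c) \<le> c * (\<Sum>n<m. tail F (z + real (Suc n) * c))" for m
  proof (induction m)
    case (Suc m)
    then show ?case using g_diff(2)[of "z + c + real m * c" "z + c + real (Suc m) * c"] zc
      by (simp add: algebra_simps)
  qed simp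
  moreover have "(\<lambda>m. g (z + c) - g (z + c + real m * c)) \<longlonglongrightarrow> g (z + c) - 0"
    using zc by (intro tendsto_intros g_sequence) auto
  moreover have "(\<lambda>m. c * (\<Sum>n<m. tail F (z + real (Suc n) * c))) \<longlonglongrightarrow> c * (\<Sum>n. tail F (z + real (Suc n) * c))"
    by (intro tendsto_intros summable_LIMSEQ summable_tail zc)
  ultimately have "g (z + c) \<le> c * (\<Sum>n. tail F (z + real (Suc n) * c))"
    by (intro LIMSEQ_le[of _ "g (z + c)"]) auto
  then show ?thesis using zc by (simp add: field_simps)
qed

end

section \<open>Upper bound for the maximal path\<close>

lemma depends_on_compose:
  fixes g :: "('a \<Rightarrow> 'b) \<Rightarrow> 'c"
  shows "depends_on A g \<Longrightarrow> depends_on A (\<lambda>f. P (g f))"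
proof (rule depends_onI)
  fix f f' :: "'a \<Rightarrow> 'b" assume "depends_on A g" "\<And>i. i \<in> A \<Longrightarrow> f i = f' i"
  then have "g f = g f'" by (rule depends_onD)
  then show "P (g f) = P (g f')" by simp
qed

datatype kind = Arrival | First | Second

lemma measurable_passage [measurable]:
  assumes "\<And>i. (\<lambda>x. S x i) \<in> borel_measurable M" "\<And>i. (\<lambda>x. T x i) \<in> borel_measurable M"
  shows "(\<lambda>x. passage (S x) (T x) j) \<in> borel_measurable M"
  using assms by (induction j) simp_all

lemma measurable_dater [measurable]:
  assumes "\<And>i. (\<lambda>x. S x i) \<in> borel_measurable M" "\<And>i. (\<lambda>x. T x i) \<in> borel_measurable M"
    "\<And>i. (\<lambda>x. U x i) \<in> borel_measurable M"
  shows "(\<lambda>x. dater (S x) (T x) (U x) j) \<in> borel_measurable M"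
  unfolding dater_def using assms by measurable

lemma passage_cong:
  "(\<And>i. 1 \<le> i \<Longrightarrow> i \<le> j \<Longrightarrow> s i = s' i \<and> t i = t' i) \<Longrightarrow> passage s t j = passage s' t' j"
proof (induction j)
  case (Suc j)
  have "passage s t j = passage s' t' j" using Suc by simp
  moreover have "(\<Sum>i=1..Suc j. t i) = (\<Sum>i=1..Suc j. t' i)" by (rule sum.cong) (use Suc.prems in auto)
  moreover have "s (Suc j) = s' (Suc j)" using Suc.prems[of "Suc j"] by simp
  ultimately show ?case by (simp only: passage.simps)
qed simp

lemma dater_cong:
  assumes "\<And>i. 1 \<le> i \<Longrightarrow> i \<le> j \<Longrightarrow> s i = s' i \<and> t i = t' i \<and> u i = u' i"
  shows "dater s t u j = dater s' t' u' j"
proof -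
  have "passage s t j = passage s' t' j" by (rule passage_cong) (use assms in auto)
  moreover have "(\<Sum>i=1..j. u i) = (\<Sum>i=1..j. u' i)" by (rule sum.cong) (use assms in auto)
  ultimately show ?thesis by (simp add: dater_def)
qed

text \<open>Index 0 is included to make the maximum nonnegative.\<close>

definition max_dater :: "(nat \<Rightarrow> real) \<Rightarrow> (nat \<Rightarrow> real) \<Rightarrow> (nat \<Rightarrow> real) \<Rightarrow> nat \<Rightarrow> real" where
  "max_dater s t u n = Max ((\<lambda>j. dater s t u j) ` {..n})"

lemma max_dater_Suc: "max_dater s t u (Suc n) = max (max_dater s t u n) (dater s t u (Suc n))"
  unfolding max_dater_def by (simp add: atMost_Suc max.commute)

lemma max_dater_ge: "j \<le> n \<Longrightarrow> dater s t u j \<le> max_dater s t u n"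
  unfolding max_dater_def by (rule Max_ge) auto

lemma max_dater_nonneg: "0 \<le> max_dater s t u n"
  using max_dater_ge[of 0 n s t u] by simp

lemma max_dater_mono: "m \<le> n \<Longrightarrow> max_dater s t u m \<le> max_dater s t u n"
  unfolding max_dater_def by (rule Max_mono) auto

lemma max_dater_greater_iff: "0 \<le> x \<Longrightarrow> max_dater s t u n > x \<longleftrightarrow> (\<exists>j\<in>{1..n}. dater s t u j > x)"
proof -
  assume "0 \<le> x"
  have "max_dater s t u n > x \<longleftrightarrow> (\<exists>j\<in>{..n}. dater s t u j > x)"
    unfolding max_dater_def by (subst Max_gr_iff) auto
  also have "\<dots> \<longleftrightarrow> (\<exists>j\<in>{1..n}. dater s t u j > x)"
  proof
    assume "\<exists>j\<in>{..n}. dater s t u j > x"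
    then obtain j where "j \<le> n" "dater s t u j > x" by auto
    moreover from this have "j \<noteq> 0" using \<open>0 \<le> x\<close> by (metis dater_0 not_less)
    ultimately show "\<exists>j\<in>{1..n}. dater s t u j > x" by (intro bexI[of _ j]) auto
  qed auto
  finally show ?thesis .
qed

lemma measurable_max_dater [measurable]:
  assumes "\<And>i. (\<lambda>x. S x i) \<in> borel_measurable M" "\<And>i. (\<lambda>x. T x i) \<in> borel_measurable M"
    "\<And>i. (\<lambda>x. U x i) \<in> borel_measurable M"
  shows "(\<lambda>x. max_dater (S x) (T x) (U x) n) \<in> borel_measurable M"
proof (induction n)
  case 0
  then show ?case by (simp add: max_dater_def)
next
  case (Suc n)
  then show ?case unfolding max_dater_Suc by (intro borel_measurable_max measurable_dater assms)
qed

lemma (in real_product) indep_vars_blocks: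
  fixes h :: "'j \<Rightarrow> ('i \<Rightarrow> real) \<Rightarrow> real"
  assumes disj: "disjoint_family K" and h: "\<And>j. h j \<in> borel_measurable (PiM UNIV (\<lambda>_. borel))"
    and dep: "\<And>j. depends_on (K j) (h j)"
  shows "indep_vars (\<lambda>_. borel) h UNIV"
proof -
  let ?e = "\<lambda>j r i. if i \<in> K j then r i else (0::real)"
  have e: "?e j \<in> measurable (PiM (K j) (\<lambda>_. borel)) (PiM UNIV (\<lambda>_. borel))" for j
  proof (rule measurable_PiM_single')
    show "(\<lambda>r. ?e j r i) \<in> borel_measurable (PiM (K j) (\<lambda>_. borel))" for i
      by (cases "i \<in> K j") auto
  qed (auto simp: space_PiM)
  have "indep_vars (\<lambda>j. PiM (K j) (\<lambda>_. borel)) (\<lambda>j f. restrict (\<lambda>i. f i) (K j)) UNIV"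
    by (rule indep_vars_restrict[OF indep_coordinates]) (use disj in auto)
  then have "indep_vars (\<lambda>_. borel) (\<lambda>j f. (h j \<circ> ?e j) (restrict (\<lambda>i. f i) (K j))) UNIV"
    by (rule indep_vars_compose2) (rule measurable_comp[OF e h])
  moreover have "(h j \<circ> ?e j) (restrict (\<lambda>i. f i) (K j)) = h j f" for j f
    unfolding comp_def by (rule depends_onD[OF dep]) simp
  ultimately show ?thesis by simp
qed

section \<open>The tandem queue on a product space\<close>

locale tandem_law = integrated_tail F for F +
  fixes \<mu> :: "kind \<Rightarrow> real measure" and a b d1 d2 :: real
  assumes law: "distribution_nonneg (\<mu> k)" and integrable_law: "integrable (\<mu> k) (\<lambda>x. x)"
    and mean_arrival: "(\<integral>x. x \<partial>\<mu> Arrival) = a"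
    and mean_first: "(\<integral>x. x \<partial>\<mu> First) = b" and mean_second: "(\<integral>x. x \<partial>\<mu> Second) = b"
    and stable: "b < a" and d_nonneg: "0 \<le> d1" "0 \<le> d2"
    and tail_first: "\<And>\<delta>. 0 < \<delta> \<Longrightarrow> \<forall>\<^sub>F x in at_top. \<bar>tail (\<mu> First) x - d1 * tail F x\<bar> \<le> \<delta> * tail F x"
    and tail_second: "\<And>\<delta>. 0 < \<delta> \<Longrightarrow> \<forall>\<^sub>F x in at_top. \<bar>tail (\<mu> Second) x - d2 * tail F x\<bar> \<le> \<delta> * tail F x"
begin

lemma law_real: "real_distribution (\<mu> k)"
  using law by (simp add: distribution_nonneg_def)

sublocale real_product "\<lambda>p :: kind \<times> nat. \<mu> (fst p)"
  by (rule real_product.intro) (rule law_real)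

abbreviation "PX \<equiv> PiM UNIV (\<lambda>_ :: kind \<times> nat. borel :: real measure)"

text \<open>Absolute values make the variables nonnegative everywhere, without changing their law.\<close>

definition cs :: "kind \<Rightarrow> (kind \<times> nat \<Rightarrow> real) \<Rightarrow> nat \<Rightarrow> real" where
  "cs k f i = \<bar>f (k, i)\<bar>"

abbreviation "dt f \<equiv> dater (cs First f) (cs Second f) (cs Arrival f)"
abbreviation "mdt f \<equiv> max_dater (cs First f) (cs Second f) (cs Arrival f)"

definition move :: "nat \<Rightarrow> kind \<times> nat \<Rightarrow> kind \<times> nat" where
  "move m p = (fst p, m + snd p)"

lemma inj_move: "inj (move m)"
  by (auto simp: inj_def move_def prod_eq_iff)

lemma fst_move [simp]: "fst (move m p) = fst p"
  by (simp add: move_def)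

lemma cs_move: "cs k (\<lambda>p. f (move m p)) = shift m (cs k f)"
  by (simp add: fun_eq_iff cs_def shift_def move_def)

lemma cs_nonneg [simp]: "0 \<le> cs k f i"
  by (simp add: cs_def)

lemma cs_measurable [measurable]: "(\<lambda>f. cs k f i) \<in> borel_measurable PX"
  unfolding cs_def by measurable

lemma sets_pred: "Measurable.pred PX P \<Longrightarrow> {f. P f} \<in> sets N"
  unfolding pred_def by (simp add: sets_N space_PiM)

lemma prob_mono_pred:
  "Measurable.pred PX Q \<Longrightarrow> (\<And>f. P f \<Longrightarrow> Q f) \<Longrightarrow> prob {f. P f} \<le> prob {f. Q f}"
  by (rule finite_measure_mono) (auto intro: sets_pred)

lemma distr_cs: "distr N borel (\<lambda>f. cs k f i) = \<mu> k"
proof -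
  interpret L: real_distribution "\<mu> k" by (rule law_real)
  have "distr N borel (\<lambda>f. cs k f i) = distr (distr N borel (\<lambda>f. f (k, i))) borel abs"
    by (subst distr_distr) (simp_all add: comp_def cs_def [abs_def])
  also have "\<dots> = distr (\<mu> k) borel abs" by (simp only: distr_coordinate fst_conv)
  also have "\<dots> = distr (\<mu> k) borel (\<lambda>x. x)"
  proof (rule distr_cong_AE)
    have "AE x in \<mu> k. 0 \<le> x" using law by (simp add: distribution_nonneg_def)
    then show "AE x in \<mu> k. \<bar>x\<bar> = x" by eventually_elim simp
  qed simp_all
  also have "\<dots> = \<mu> k" by (rule distr_id2) simp
  finally show ?thesis .
qed

lemma cs_measurable_N: "(\<lambda>f. cs k f i) \<in> borel_measurable N"
  by measurable

lemma prob_cs: "X \<in> sets borel \<Longrightarrow> prob {f. cs k f i \<in> X} = measure (\<mu> k) X"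
proof -
  assume X: "X \<in> sets borel"
  have "measure (distr N borel (\<lambda>f. cs k f i)) X = prob ((\<lambda>f. cs k f i) -` X \<inter> space N)"
    by (rule measure_distr[OF cs_measurable_N X])
  then show ?thesis by (simp add: distr_cs vimage_def)
qed

lemma prob_cs_greater: "prob {f. cs k f i > z} = tail (\<mu> k) z"
  using prob_cs[of "{z<..}" k i] by (simp add: real_distribution.tail_eq[OF law_real])

lemma indep_vars_cs: "inj r \<Longrightarrow> indep_vars (\<lambda>_. borel) (\<lambda>(i::nat) f. \<bar>f (r i)\<bar>) UNIV"
  by (rule indep_vars_blocks[where K="\<lambda>i. {r i}"])
     (auto simp: disjoint_family_on_def inj_def intro!: depends_onI)

lemma AE_sum_cs_le:
  assumes "(\<integral>x. x \<partial>\<mu> k) < m"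
  shows "AE f in N. \<exists>K. \<forall>n. (\<Sum>i=1..n. cs k f i) \<le> real n * m + K"
proof -
  have "AE f in N. \<exists>K. \<forall>n. (\<Sum>i<n. cs k f (Suc i)) \<le> real n * m + K"
  proof (rule AE_partial_sums_bounded[OF _ distr_cs integrable_law assms])
    show "indep_vars (\<lambda>_. borel) (\<lambda>i f. cs k f (Suc i)) UNIV"
      using indep_vars_cs[of "\<lambda>i. (k, Suc i)"] by (simp add: cs_def inj_def)
  qed
  then show ?thesis by (simp add: sum.atLeast1_atMost_eq)
qed

lemma AE_sum_cs_ge:
  assumes "m < (\<integral>x. x \<partial>\<mu> k)"
  shows "AE f in N. \<exists>K. \<forall>n. real n * m - K \<le> (\<Sum>i=1..n. cs k f i)"
proof -
  interpret L: real_distribution "\<mu> k" by (rule law_real)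
  let ?\<nu> = "distr (\<mu> k) borel uminus"
  have m: "uminus \<in> borel_measurable (\<mu> k)" by simp
  have d: "distr N borel (\<lambda>f. - cs k f i) = ?\<nu>" for i
  proof -
    have "?\<nu> = distr (distr N borel (\<lambda>f. cs k f i)) borel uminus" by (simp only: distr_cs)
    also have "\<dots> = distr N borel (\<lambda>f. - cs k f i)"
      by (subst distr_distr[OF borel_measurable_uminus[OF measurable_ident_sets[OF refl]] cs_measurable_N])
        (simp_all add: comp_def)
    finally show ?thesis ..
  qed
  have "AE f in N. \<exists>K. \<forall>n. (\<Sum>i<n. - cs k f (Suc i)) \<le> real n * (- m) + K"
  proof (rule AE_partial_sums_bounded[OF _ d])
    show "indep_vars (\<lambda>_. borel) (\<lambda>i f. - cs k f (Suc i)) UNIV"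
      using indep_vars_compose2[OF indep_vars_cs[of "\<lambda>i. (k, Suc i)"], of "\<lambda>_ x. - x" "\<lambda>_. borel"]
      by (simp add: cs_def inj_def)
    show "integrable ?\<nu> (\<lambda>x. x)"
      unfolding integrable_distr_eq[OF m measurable_ident_sets[OF refl]] using integrable_law by simp
    show "(\<integral>x. x \<partial>?\<nu>) < - m"
      unfolding integral_distr[OF m measurable_ident_sets[OF refl]] using assms by simp
  qed
  then show ?thesis
  proof eventually_elim
    case (elim f)
    then obtain K where "\<And>n. (\<Sum>i<n. - cs k f (Suc i)) \<le> real n * (- m) + K" by blast
    then have "real n * m - K \<le> (\<Sum>i<n. cs k f (Suc i))" for n
      by (simp add: sum_negf algebra_simps)
    then show ?case by (auto simp: sum.atLeast1_atMost_eq)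
  qed
qed

text \<open>On a maximal path with switch at \<open>k\<close>, each of the sums of service and
  interarrival times deviates from its mean by at most \<open>e\<close> per step up to a random
  constant. The segment of \<open>\<sigma>1\<close> from \<open>k\<close> to \<open>j\<close> is a
  difference of two initial sums, which is why \<open>\<sigma>1\<close> must be controlled from both
  sides.\<close>

lemma AE_dater_bounded:
  assumes "c < a - b"
  shows "AE f in N. \<exists>R. \<forall>j\<ge>1. dt f j \<le> R - real j * c"
proof -
  define e where "e = (a - b - c) / 4"
  have e: "0 < e" "4 * e = a - b - c" using assms by (simp_all add: e_def)
  have 1: "AE f in N. \<exists>K. \<forall>n. (\<Sum>i=1..n. cs Second f i) \<le> real n * (b + e) + K"
    by (rule AE_sum_cs_le) (use e in \<open>simp add: mean_second\<close>)
  have 2: "AE f in N. \<exists>K. \<forall>n. (\<Sum>i=1..n. cs First f i) \<le> real n * (b + e) + K"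
    by (rule AE_sum_cs_le) (use e in \<open>simp add: mean_first\<close>)
  have 3: "AE f in N. \<exists>K. \<forall>n. real n * (b - e) - K \<le> (\<Sum>i=1..n. cs First f i)"
    by (rule AE_sum_cs_ge) (use e in \<open>simp add: mean_first\<close>)
  have 4: "AE f in N. \<exists>K. \<forall>n. real n * (a - e) - K \<le> (\<Sum>i=1..n. cs Arrival f i)"
    by (rule AE_sum_cs_ge) (use e in \<open>simp add: mean_arrival\<close>)
  show ?thesis
    using 1 2 3 4
  proof eventually_elim
    case (elim f)
    obtain K1 where K1: "\<And>n. (\<Sum>i=1..n. cs Second f i) \<le> real n * (b + e) + K1" using elim(1) by blast
    obtain K2 where K2: "\<And>n. (\<Sum>i=1..n. cs First f i) \<le> real n * (b + e) + K2" using elim(2) by blast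
    obtain K3 where K3: "\<And>n. real n * (b - e) - K3 \<le> (\<Sum>i=1..n. cs First f i)" using elim(3) by blast
    obtain K4 where K4: "\<And>n. real n * (a - e) - K4 \<le> (\<Sum>i=1..n. cs Arrival f i)" using elim(4) by blast
    \<comment> \<open>The extra \<open>b\<close> arises because both service times of the switching
      customer count. The deviations add up to at most \<open>4 * j * e\<close>, which is the whole
      slack \<open>j * (a - b - c)\<close>.\<close>
    have "dt f j \<le> (b + K1 + K2 + K3 + K4) - real j * c" if "1 \<le> j" for j
    proof -
      obtain j' where j': "j = Suc j'" using \<open>1 \<le> j\<close> by (cases j) auto
      obtain k where k: "k \<ge> 1" "k \<le> j"
        "passage (cs First f) (cs Second f) j = (\<Sum>i=1..k. cs Second f i) + (\<Sum>i=k..j. cs First f i)"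
        using passage_path[of "cs Second f" j' "cs First f"] unfolding j' by auto
      have "(\<Sum>i=1..j. cs First f i) = (\<Sum>i=1..k - 1. cs First f i) + (\<Sum>i=k..j. cs First f i)"
      proof -
        have "{1..j} = {1..k - 1} \<union> {k..j}" using k by auto
        then show ?thesis using k by (simp only:) (subst sum.union_disjoint, auto)
      qed
      then have "dt f j \<le> real k * (b + e) + K1 + (real j * (b + e) + K2) - (real (k - 1) * (b - e) - K3)
          - (real j * (a - e) - K4)"
        using k K1[of k] K2[of j] K3[of "k - 1"] K4[of j] by (simp add: dater_def)
      also have "\<dots> = b + (2 * real k - 1 + 2 * real j) * e - real j * (a - b) + (K1 + K2 + K3 + K4)"
        using k by (simp add: of_nat_diff algebra_simps)
      also have "(2 * real k - 1 + 2 * real j) * e \<le> (4 * real j) * e"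
        using k e by (intro mult_right_mono) auto
      also have "(4 * real j) * e = real j * (a - b) - real j * c"
      proof -
        have "(4 * real j) * e = real j * (4 * e)" by simp
        then show ?thesis unfolding e(2) by (simp add: algebra_simps)
      qed
      finally show ?thesis by simp
    qed
    then show ?case by blast
  qed
qed

definition q :: "nat \<Rightarrow> real \<Rightarrow> real" where
  "q n x = prob {f. mdt f n > x}"

text \<open>Tail of the largest amount by which a path weight can grow in one step.\<close>

definition H :: "real \<Rightarrow> real" where
  "H = tail (\<mu> First \<star> \<mu> Second)"

lemma H_eq: "H z = prob {f. cs First f i + cs Second f i > z}"
proof -
  have "indep_var borel (\<lambda>f. cs First f i) borel (\<lambda>f. cs Second f i)"
    by (rule indep_var_N[of _ _ _ _ "{(First, i)}" "{(Second, i)}"]) (auto intro!: depends_onI simp: cs_def)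
  then have eq: "\<mu> First \<Otimes>\<^sub>M \<mu> Second = distr N (borel \<Otimes>\<^sub>M borel) (\<lambda>f. (cs First f i, cs Second f i))"
    unfolding indep_var_distribution_eq by (simp add: distr_cs)
  have m: "(\<lambda>f. (cs First f i, cs Second f i)) \<in> measurable N (borel \<Otimes>\<^sub>M borel)" by measurable
  have "H z = measure (\<mu> First \<Otimes>\<^sub>M \<mu> Second) {p. z < fst p + snd p}"
    unfolding H_def by (rule tail_convolution) (rule law_real)+
  also have "\<dots> = prob ((\<lambda>f. (cs First f i, cs Second f i)) -` {p. z < fst p + snd p} \<inter> space N)"
    unfolding eq by (rule measure_distr[OF m]) simp
  finally show ?thesis by (simp add: vimage_def)
qed

lemma q_nonneg: "0 \<le> q n x" and q_le_1: "q n x \<le> 1"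
  by (simp_all add: q_def)

lemma mdt_measurable [measurable]: "(\<lambda>f. mdt f n) \<in> borel_measurable PX"
  by measurable

lemma real_distribution_mdt: "real_distribution (distr N borel (\<lambda>f. mdt f n))"
  by (rule real_distribution_distr) measurable

lemma tail_mdt: "tail (distr N borel (\<lambda>f. mdt f n)) x = q n x"
proof -
  interpret D: real_distribution "distr N borel (\<lambda>f. mdt f n)" by (rule real_distribution_mdt)
  have m: "(\<lambda>f. mdt f n) \<in> borel_measurable N" by measurable
  show ?thesis unfolding D.tail_eq by (subst measure_distr[OF m]) (simp_all add: q_def vimage_def)
qed

text \<open>One step of the recursion at the first time \<open>j\<close> at which \<open>dt f j\<close> exceeds the line
  \<open>R - j c\<close>: then \<open>\<sigma>1 + \<sigma>2\<close> is large at time \<open>j\<close>, and what follows is a fresh copy.\<close>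

lemma q_step:
  assumes "0 \<le> R" "0 < c" "0 \<le> K" "R \<le> x" "2 * K \<le> x" "0 \<le> C"
    and C: "\<And>z m. K \<le> z \<Longrightarrow> (\<Sum>j\<in>{1..m}. H (z - R + (real j - 1) * c)) \<le> C * tail G z"
    and \<gamma>: "prob {f. \<exists>j\<ge>1. dt f j > R - real j * c} \<le> \<gamma>"
  shows "q (Suc n) x \<le> C * tail G (x - K) + \<gamma> * q n (x - K) + C * both_large G (distr N borel (\<lambda>f. mdt f n)) K x"
proof -
  define T where "T j f \<longleftrightarrow> dt f j > R - real j * c \<and> (\<forall>i\<in>{1..<j}. dt f i \<le> R - real i * c)" for j f
  define M' where "M' j f = mdt (\<lambda>p. f (move j p)) n" for j f
  \<comment> \<open>Just before a first exceedance at \<open>j\<close> the weight is at most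
    \<open>R - (j - 1) c\<close>, that is \<open>- h j\<close>. Hence \<open>gg j\<close> dominates
    the weight at \<open>j\<close>, yet it involves time \<open>j\<close> only and is independent of
    the continuation \<open>M' j\<close>.\<close>
  define h where "h j = (real j - 1) * c - R" for j :: nat
  define gg where "gg j f = cs First f j + cs Second f j - h j" for j f
  let ?L = "distr N borel (\<lambda>f. mdt f n)"
  have T_meas [measurable]: "Measurable.pred PX (T j)" for j unfolding T_def by measurable
  have M'_meas [measurable]: "M' j \<in> borel_measurable PX" for j
    unfolding M'_def by (rule measurable_compose[OF measurable_coordinate_map mdt_measurable])
  have gg_meas [measurable]: "gg j \<in> borel_measurable PX" for j unfolding gg_def by measurable
  have T_dep: "depends_on {p. 1 \<le> snd p \<and> snd p \<le> j} (T j)" for j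
  proof (rule depends_onI)
    fix f f' :: "kind \<times> nat \<Rightarrow> real" assume eq: "\<And>p. p \<in> {p. 1 \<le> snd p \<and> snd p \<le> j} \<Longrightarrow> f p = f' p"
    have "dt f i = dt f' i" if "i \<le> j" for i
      by (rule dater_cong) (use eq that in \<open>auto simp: cs_def\<close>)
    then show "T j f = T j f'" by (simp add: T_def)
  qed
  have T_disj: "i = j" if "T i f" "T j f" "1 \<le> i" "1 \<le> j" for i j f
    using that unfolding T_def by (metis atLeastLessThan_iff linorder_neqE_nat not_less)
  have T_gg: "z < gg j f" if "T j f" "z < dt f j" "1 \<le> j" for j z f
  proof -
    obtain j' where j': "j = Suc j'" using \<open>1 \<le> j\<close> by (cases j) auto
    have "dt f j \<le> dt f j' + cs Second f j + cs First f j"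
      unfolding j' by (rule dater_Suc_le) simp_all
    moreover have "dt f j' \<le> R - real j' * c"
    proof (cases "j' = 0")
      case False
      then have "j' \<in> {1..<j}" using j' by simp
      then show ?thesis using that(1) unfolding T_def by blast
    qed (use \<open>0 \<le> R\<close> in simp)
    ultimately show ?thesis using that by (simp add: gg_def h_def j')
  qed
  have M'_dep: "depends_on {p. snd p > j} (M' j)" for j
  proof (rule depends_onI)
    fix f f' :: "kind \<times> nat \<Rightarrow> real" assume eq: "\<And>p. p \<in> {p. snd p > j} \<Longrightarrow> f p = f' p"
    have "dt (\<lambda>p. f (move j p)) i = dt (\<lambda>p. f' (move j p)) i" for i
      by (rule dater_cong) (use eq in \<open>auto simp: cs_def move_def\<close>)
    then show "M' j f = M' j f'" by (simp add: M'_def max_dater_def)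
  qed
  have M'_prob: "prob {f. T j f \<and> M' j f > z} = prob {f. T j f} * q n z" for j z
  proof -
    have "prob {f. T j f \<and> M' j f > z} = prob {f. T j f} * prob {f. M' j f > z}"
    proof (rule prob_conj_indep)
      show "depends_on {p. snd p > j} (\<lambda>f. M' j f > z)"
        by (rule depends_on_compose[OF M'_dep])
    qed (rule T_meas, measurable, rule T_dep, auto)
    also have "prob {f. M' j f > z} = q n z"
      unfolding q_def M'_def
      by (rule prob_reindex[where P="\<lambda>f. mdt f n > z"]) (measurable, simp_all add: inj_move)
    finally show ?thesis .
  qed
  have incl: "\<exists>j\<in>{1..Suc n}. T j f \<and> (gg j f > x - K \<or> M' j f > x - K \<or>
        (gg j f > K \<and> M' j f > K \<and> gg j f + M' j f > x))" if big: "mdt f (Suc n) > x" for f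
  proof -
    have "0 \<le> x" using assms by simp
    then obtain i where i: "1 \<le> i" "i \<le> Suc n" "dt f i > x"
      using big max_dater_greater_iff[of x "cs First f" "cs Second f" "cs Arrival f" "Suc n"] by auto
    have "dt f i > R - real i * c" using i assms by (smt (verit) mult_nonneg_nonneg of_nat_0_le_iff)
    then obtain j where j: "1 \<le> j" "j \<le> i" "T j f"
    proof -
      define j where "j = (LEAST j. 1 \<le> j \<and> dt f j > R - real j * c)"
      have e: "1 \<le> i \<and> dt f i > R - real i * c" using i \<open>dt f i > R - real i * c\<close> by simp
      have "1 \<le> j \<and> dt f j > R - real j * c" unfolding j_def using e by (rule LeastI)
      moreover have "j \<le> i" unfolding j_def using e by (rule Least_le)
      moreover have "dt f k \<le> R - real k * c" if "k \<in> {1..<j}" for k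
        using not_less_Least[of k "\<lambda>j. 1 \<le> j \<and> dt f j > R - real j * c"] that by (simp add: j_def not_less)
      ultimately show thesis using that by (auto simp: T_def)
    qed
    have "dt f i \<le> dt f j + dt (\<lambda>p. f (move j p)) (i - j)"
      using dater_add[of "cs First f" "cs Second f" "cs Arrival f" j "i - j"] j by (simp add: cs_move)
    also have "dt (\<lambda>p. f (move j p)) (i - j) \<le> M' j f"
      unfolding M'_def by (rule max_dater_ge) (use i j in simp)
    finally have sum: "x < dt f j + M' j f" using i by simp
    have "M' j f \<ge> 0" unfolding M'_def by (rule max_dater_nonneg)
    have le: "x - M' j f < gg j f" by (rule T_gg[OF j(3) _ j(1)]) (use sum in simp)
    \<comment> \<open>If one of the two terms is at most \<open>K\<close>, the other exceeds
      \<open>x - K\<close>; otherwise both are larger than \<open>K\<close>.\<close>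
    then have "gg j f > x - K \<or> M' j f > x - K \<or> (gg j f > K \<and> M' j f > K \<and> gg j f + M' j f > x)"
      using assms by linarith
    then show ?thesis using j i by (intro bexI[of _ j]) auto
  qed
  let ?I = "{1..Suc n}"
  have g1: "prob {f. gg j f > z} = H (z - R + (real j - 1) * c)" for j z
    unfolding H_eq[of _ j] by (rule arg_cong[where f=prob]) (auto simp: gg_def h_def)
  define D where "D j = distr N borel (gg j)" for j
  have D_real: "real_distribution (D j)" for j
    unfolding D_def by (rule real_distribution_distr) measurable
  have D_tail: "tail (D j) z = H (z - R + (real j - 1) * c)" for j z
  proof -
    interpret D: real_distribution "D j" by (rule D_real)
    have m: "gg j \<in> borel_measurable N" by measurable
    have "tail (D j) z = prob {f. gg j f > z}"
      unfolding D.tail_eq unfolding D_def by (subst measure_distr[OF m]) (simp_all add: vimage_def)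
    then show ?thesis by (simp only: g1)
  qed
  have joint: "prob {f. gg j f > K \<and> M' j f > K \<and> gg j f + M' j f > x} = both_large ?L (D j) K x" for j
  proof -
    have "indep_var borel (M' j) borel (gg j)"
    proof (rule indep_var_N[of _ _ _ _ "{p. snd p > j}" "{p. snd p = j}"])
      show "depends_on {p. snd p > j} (M' j)" by (rule M'_dep)
      show "depends_on {p. snd p = j} (gg j)"
        by (rule depends_onI) (simp add: gg_def cs_def)
    qed auto
    moreover have "distr N borel (M' j) = ?L"
    proof -
      have "distr N N (\<lambda>f p. f (move j p)) = N"
        unfolding N_def by (rule PiM_reindex) (simp_all add: law_real inj_move)
      then have "?L = distr (distr N N (\<lambda>f p. f (move j p))) borel (\<lambda>f. mdt f n)" by simp
      also have "\<dots> = distr N borel (M' j)"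
      proof (subst distr_distr)
        show "(\<lambda>f p. f (move j p)) \<in> measurable N N"
          using measurable_coordinate_map[of "move j"] by (simp cong: measurable_cong_sets add: sets_N)
      qed (measurable, simp add: comp_def M'_def [abs_def])
      finally show ?thesis ..
    qed
    ultimately have eq: "?L \<Otimes>\<^sub>M D j = distr N (borel \<Otimes>\<^sub>M borel) (\<lambda>f. (M' j f, gg j f))"
      unfolding indep_var_distribution_eq D_def by simp
    have m: "(\<lambda>f. (M' j f, gg j f)) \<in> measurable N (borel \<Otimes>\<^sub>M borel)" by measurable
    have "both_large ?L (D j) K x = prob ((\<lambda>f. (M' j f, gg j f)) -` {p. K < fst p \<and> K < snd p \<and> x < fst p + snd p} \<inter> space N)"
      unfolding both_large_def eq by (rule measure_distr[OF m]) simp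
    also have "(\<lambda>f. (M' j f, gg j f)) -` {p. K < fst p \<and> K < snd p \<and> x < fst p + snd p} \<inter> space N
        = {f. gg j f > K \<and> M' j f > K \<and> gg j f + M' j f > x}" by auto
    finally show ?thesis ..
  qed
  have sum_T: "(\<Sum>j\<in>?I. prob {f. T j f}) \<le> \<gamma>"
  proof -
    have "(\<Sum>j\<in>?I. prob {f. T j f}) = prob (\<Union>j\<in>?I. {f. T j f})"
    proof (rule finite_measure_finite_Union[symmetric])
      show "(\<lambda>j. {f. T j f}) ` ?I \<subseteq> sets N" by (auto intro!: sets_pred)
      show "disjoint_family_on (\<lambda>j. {f. T j f}) ?I"
        unfolding disjoint_family_on_def using T_disj by fastforce
    qed simp
    also have "\<dots> \<le> prob {f. \<exists>j\<ge>1. dt f j > R - real j * c}"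
      by (rule finite_measure_mono) (auto simp: T_def intro!: sets_pred)
    finally show ?thesis using \<gamma> by simp
  qed
  \<comment> \<open>The exceedance event \<open>T j\<close> is kept only where the continuation
    alone is large. There it is independent of \<open>M' j\<close>, and the total probability of the
    \<open>T j\<close> is at most \<open>\<gamma>\<close>. In the other two cases the size of
    \<open>gg j\<close> is rare enough to be summed over all \<open>j\<close>.\<close>
  have "q (Suc n) x \<le> prob (\<Union>j\<in>?I. {f. gg j f > x - K} \<union> {f. T j f \<and> M' j f > x - K}
      \<union> {f. gg j f > K \<and> M' j f > K \<and> gg j f + M' j f > x})"
    unfolding q_def
  proof (rule finite_measure_mono)
    show "{f. mdt f (Suc n) > x} \<subseteq> (\<Union>j\<in>?I. {f. gg j f > x - K} \<union> {f. T j f \<and> M' j f > x - K}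
      \<union> {f. gg j f > K \<and> M' j f > K \<and> gg j f + M' j f > x})"
      using incl by blast
  qed (intro sets.finite_UN sets.Un sets_pred finite_atLeastAtMost; measurable)
  also have "\<dots> \<le> (\<Sum>j\<in>?I. prob ({f. gg j f > x - K} \<union> {f. T j f \<and> M' j f > x - K}
      \<union> {f. gg j f > K \<and> M' j f > K \<and> gg j f + M' j f > x}))"
  proof (rule finite_measure_subadditive_finite)
    show "(\<lambda>j. {f. gg j f > x - K} \<union> {f. T j f \<and> M' j f > x - K}
      \<union> {f. gg j f > K \<and> M' j f > K \<and> gg j f + M' j f > x}) ` ?I \<subseteq> sets N"
      by (intro image_subsetI sets.Un sets_pred; measurable)
  qed (rule finite_atLeastAtMost)
  also have "\<dots> \<le> (\<Sum>j\<in>?I. prob {f. gg j f > x - K} + prob {f. T j f \<and> M' j f > x - K}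
      + prob {f. gg j f > K \<and> M' j f > K \<and> gg j f + M' j f > x})"
  proof (rule sum_mono)
    fix j
    have s: "{f. gg j f > x - K} \<in> sets N" "{f. T j f \<and> M' j f > x - K} \<in> sets N"
      "{f. gg j f > K \<and> M' j f > K \<and> gg j f + M' j f > x} \<in> sets N"
      by (rule sets_pred; measurable)+
    show "prob ({f. gg j f > x - K} \<union> {f. T j f \<and> M' j f > x - K} \<union> {f. gg j f > K \<and> M' j f > K \<and> gg j f + M' j f > x})
      \<le> prob {f. gg j f > x - K} + prob {f. T j f \<and> M' j f > x - K} + prob {f. gg j f > K \<and> M' j f > K \<and> gg j f + M' j f > x}"
      using measure_Un_le[OF sets.Un[OF s(1,2)] s(3)] measure_Un_le[OF s(1,2)] by linarith
  qed
  also have "\<dots> = (\<Sum>j\<in>?I. prob {f. gg j f > x - K}) + (\<Sum>j\<in>?I. prob {f. T j f} * q n (x - K))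
      + (\<Sum>j\<in>?I. both_large ?L (D j) K x)"
    by (simp only: sum.distrib joint M'_prob)
  also have "(\<Sum>j\<in>?I. prob {f. gg j f > x - K}) \<le> C * tail G (x - K)"
    unfolding g1 by (rule C) (use assms in simp)
  also have "(\<Sum>j\<in>?I. prob {f. T j f} * q n (x - K)) \<le> \<gamma> * q n (x - K)"
    unfolding sum_distrib_right[symmetric] using sum_T q_nonneg by (rule mult_right_mono)
  also have "(\<Sum>j\<in>?I. both_large ?L (D j) K x) \<le> C * both_large ?L G K x"
  proof (rule both_large_sum_mono)
    show "(\<Sum>j\<in>?I. tail (D j) z) \<le> C * tail G z" if "K \<le> z" for z
      unfolding D_tail using that by (rule C)
  qed (use \<open>0 \<le> C\<close> in \<open>simp_all add: real_distribution_mdt D_real G.real_distribution_axioms\<close>)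
  also have "both_large ?L G K x = both_large G ?L K x"
    by (rule both_large_commute) (simp_all add: real_distribution_mdt G.real_distribution_axioms)
  finally show ?thesis by simp
qed

text \<open>The tail of the supremum \<open>V\<close>, obtained for \<open>x \<ge> 0\<close> as the
  increasing limit of \<open>q n x\<close>.\<close>

definition qi :: "real \<Rightarrow> real" where
  "qi x = prob {f. \<exists>j\<ge>1. dt f j > x}"

lemma dt_greater_pred [measurable]: "Measurable.pred PX (\<lambda>f. \<exists>j\<ge>1. dt f j > x)"
  by measurable

lemma q_le_qi: "0 \<le> x \<Longrightarrow> q n x \<le> qi x"
  unfolding q_def qi_def by (rule prob_mono_pred) (auto simp: max_dater_greater_iff)

lemma q_tendsto: "0 \<le> x \<Longrightarrow> (\<lambda>n. q n x) \<longlonglongrightarrow> qi x"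
proof -
  assume x: "0 \<le> x"
  have "(\<lambda>n. prob {f. mdt f n > x}) \<longlonglongrightarrow> prob (\<Union>n. {f. mdt f n > x})"
  proof (rule finite_Lim_measure_incseq)
    show "incseq (\<lambda>n. {f. mdt f n > x})"
      unfolding incseq_def using max_dater_mono by (blast intro: less_le_trans)
    show "range (\<lambda>n. {f. mdt f n > x}) \<subseteq> sets N" by (auto intro!: sets_pred)
  qed
  moreover have "(\<Union>n. {f. mdt f n > x}) = {f. \<exists>j\<ge>1. dt f j > x}"
  proof -
    have "(\<exists>n. mdt f n > x) \<longleftrightarrow> (\<exists>j\<ge>1. dt f j > x)" for f
      unfolding max_dater_greater_iff[OF x] by (metis atLeastAtMost_iff order_refl)
    then show ?thesis by auto
  qed
  ultimately show ?thesis by (simp add: q_def qi_def)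
qed

lemma exists_line:
  assumes "c < a - b" "0 < \<gamma>"
  shows "\<exists>R\<ge>0. prob {f. \<exists>j\<ge>1. dt f j > R - real j * c} \<le> \<gamma>"
proof -
  let ?Q = "\<lambda>R f. \<forall>j\<ge>1. dt f j \<le> R - real j * c"
  have "\<forall>\<^sub>F R in at_top. prob {f \<in> space N. ?Q R f} > 1 - \<gamma>"
  proof (rule tight_of_AE_bounded)
    show "AE f in N. \<exists>R. ?Q R f" using assms(1) by (rule AE_dater_bounded)
    show "Measurable.pred N (?Q R)" for R by measurable
  qed (use assms in \<open>force+\<close>)
  then have "\<forall>\<^sub>F R in at_top. prob {f. ?Q R f} > 1 - \<gamma> \<and> 0 \<le> R"
    using eventually_ge_at_top[of 0] by eventually_elim simp
  then obtain R where R: "prob {f. ?Q R f} > 1 - \<gamma>" "0 \<le> R"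
    using eventually_happens'[OF trivial_limit_at_top_linorder] by blast
  have "{f. ?Q R f} \<in> sets N" by (rule sets_pred) measurable
  from prob_compl[OF this] have "prob (UNIV - {f. ?Q R f}) = 1 - prob {f. ?Q R f}" by simp
  moreover have "UNIV - {f. ?Q R f} = {f. \<not> ?Q R f}" by blast
  ultimately have "prob {f. \<not> ?Q R f} = 1 - prob {f. ?Q R f}" by simp
  then show ?thesis using R by (intro exI[of _ R]) (simp add: not_le)
qed

lemma H_upper:
  assumes "0 < \<delta>" shows "\<forall>\<^sub>F x in at_top. H x \<le> (d1 + d2 + \<delta>) * tail F x"
proof -
  have "\<forall>\<^sub>F x in at_top. tail (\<mu> First \<star> \<mu> Second) x \<le> ((d1 + \<delta> / 3) + (d2 + \<delta> / 3) + \<delta> / 3) * tail F x"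
  proof (rule tail_convolution_dominated[OF subexp law_real law_real])
    show "\<forall>\<^sub>F x in at_top. tail (\<mu> First) x \<le> (d1 + \<delta> / 3) * tail F x"
    proof (rule eventually_mono[OF tail_first[of "\<delta> / 3"]])
      fix x assume "\<bar>tail (\<mu> First) x - d1 * tail F x\<bar> \<le> \<delta> / 3 * tail F x"
      then show "tail (\<mu> First) x \<le> (d1 + \<delta> / 3) * tail F x" unfolding distrib_right by linarith
    qed (use assms in simp)
    show "\<forall>\<^sub>F x in at_top. tail (\<mu> Second) x \<le> (d2 + \<delta> / 3) * tail F x"
    proof (rule eventually_mono[OF tail_second[of "\<delta> / 3"]])
      fix x assume "\<bar>tail (\<mu> Second) x - d2 * tail F x\<bar> \<le> \<delta> / 3 * tail F x"
      then show "tail (\<mu> Second) x \<le> (d2 + \<delta> / 3) * tail F x" unfolding distrib_right by linarith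
    qed (use assms in simp)
  qed (use assms d_nonneg in auto)
  moreover have "(d1 + \<delta> / 3) + (d2 + \<delta> / 3) + \<delta> / 3 = d1 + d2 + \<delta>" by simp
  ultimately show ?thesis unfolding H_def by (simp only:)
qed

text \<open>Along a line of slope \<open>c\<close> the tails of \<open>F\<close> form a Riemann sum
  of mesh \<open>c\<close>, hence the factor \<open>1 / c\<close>. The shift by \<open>R + c\<close>
  is absorbed into \<open>1 + e\<close> because the integrated tail is long-tailed.\<close>

lemma sum_H_upper:
  assumes "0 < \<delta>" "0 < c" "0 < e"
  shows "\<exists>Z. \<forall>z\<ge>Z. \<forall>m. (\<Sum>j\<in>{1..m}. H (z - R + (real j - 1) * c))
    \<le> ((d1 + d2 + \<delta>) / c * (1 + e)) * tail G z"
proof -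
  let ?D = "d1 + d2 + \<delta>"
  obtain Z1 where Z1: "\<And>x. Z1 \<le> x \<Longrightarrow> H x \<le> ?D * tail F x"
    using H_upper[OF assms(1)] by (auto simp: eventually_at_top_linorder)
  have D: "0 < ?D" using assms d_nonneg by simp
  have "\<forall>\<^sub>F z in at_top. g (z + (- R - c)) / g z < 1 + e"
    using assms by (intro order_tendstoD(2)[OF g_shift_tendsto]) simp
  then have "\<forall>\<^sub>F z in at_top. \<forall>m. (\<Sum>j\<in>{1..m}. H (z - R + (real j - 1) * c)) \<le> (?D / c * (1 + e)) * tail G z"
    using eventually_g_eq eventually_ge_at_top[of "max 0 Z1 + R + c"] eventually_ge_at_top[of 0]
  proof eventually_elim
    case (elim z)
    let ?z = "z - R - c"
    have z: "0 \<le> ?z" "Z1 \<le> ?z" using elim by auto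
    show ?case
    proof
      fix m
      have "(\<Sum>j\<in>{1..m}. H (z - R + (real j - 1) * c)) = (\<Sum>n<m. H (?z + real (Suc n) * c))"
        by (simp add: sum.atLeast1_atMost_eq algebra_simps)
      also have "\<dots> \<le> (\<Sum>n<m. ?D * tail F (?z + real (Suc n) * c))"
        by (intro sum_mono Z1) (use z \<open>0 < c\<close> in \<open>simp add: add_increasing2\<close>)
      also have "\<dots> = ?D * (\<Sum>n<m. tail F (?z + real (Suc n) * c))"
        by (simp only: sum_distrib_left)
      also have "\<dots> \<le> ?D * (g ?z / c)"
        using D z assms by (intro mult_left_mono sum_tail_le) auto
      also have "g ?z \<le> (1 + e) * g z"
      proof -
        have "z + (- R - c) = ?z" by simp
        then show ?thesis using elim(1) g_pos[OF elim(4)] by (simp only: divide_less_eq) simp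
      qed
      finally show "(\<Sum>j\<in>{1..m}. H (z - R + (real j - 1) * c)) \<le> (?D / c * (1 + e)) * tail G z"
        using D assms elim by (simp add: divide_right_mono mult_left_mono)
    qed
  qed
  then show ?thesis by (auto simp: eventually_at_top_linorder)
qed

lemma both_large_mdt_le:
  assumes "\<And>z. K \<le> z \<Longrightarrow> q n z \<le> B * tail G z" "0 \<le> B"
  shows "both_large G (distr N borel (\<lambda>f. mdt f n)) K x \<le> B * both_large G G K x"
  by (rule both_large_mono) (simp_all add: assms tail_mdt real_distribution_mdt G.real_distribution_axioms)

text \<open>Let \<open>S\<close> be the set of constants \<open>B\<close> with
  \<open>qi x \<le> B * tail G x\<close> for large \<open>x\<close>. The recursion improves any such
  \<open>B\<close> to nearly \<open>C + \<gamma> * B\<close>, so the infimum of \<open>S\<close> is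
  at most the fixed point \<open>C / (1 - \<gamma>)\<close>. To start, some finite constant must be
  found; it comes from an induction on \<open>n\<close>.\<close>

lemma qi_upper_aux:
  assumes R: "0 \<le> R" and c: "0 < c" and C: "0 < C" and \<gamma>: "0 < \<gamma>" "\<gamma> \<le> 1 / 4"
    and Z: "\<And>z m. Z \<le> z \<Longrightarrow> (\<Sum>j\<in>{1..m}. H (z - R + (real j - 1) * c)) \<le> C * tail G z"
    and line: "prob {f. \<exists>j\<ge>1. dt f j > R - real j * c} \<le> \<gamma>"
    and "0 < \<eta>"
  shows "\<forall>\<^sub>F x in at_top. qi x \<le> (C / (1 - \<gamma>) + \<eta>) * tail G x"
proof -
  define S where "S = {B. 0 \<le> B \<and> (\<forall>\<^sub>F x in at_top. qi x \<le> B * tail G x)}"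
  have pick: "\<exists>K. Z \<le> K \<and> K0 \<le> K \<and> 0 \<le> K \<and> (\<forall>\<^sub>F x in at_top. both_large G G K x \<le> e * tail G x)"
    if "0 < e" for K0 e
  proof -
    have "\<forall>\<^sub>F K in at_top. Z \<le> K \<and> K0 \<le> K \<and> 0 \<le> K \<and> (\<forall>\<^sub>F x in at_top. both_large G G K x \<le> e * tail G x)"
      using that by (intro eventually_conj eventually_ge_at_top both_large_small[OF subexp_int])
    then show ?thesis using eventually_happens'[OF trivial_limit_at_top_linorder] by blast
  qed
  have step: "q (Suc n) x \<le> C * tail G (x - K) + \<gamma> * q n (x - K) + C * (B * both_large G G K x)"
    if K: "Z \<le> K" "0 \<le> K" "R \<le> x" "2 * K \<le> x" and B: "\<And>z. K \<le> z \<Longrightarrow> q n z \<le> B * tail G z" "0 \<le> B" for n x K B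
  proof -
    have "q (Suc n) x \<le> C * tail G (x - K) + \<gamma> * q n (x - K)
        + C * both_large G (distr N borel (\<lambda>f. mdt f n)) K x"
    proof (rule q_step[OF R c K(2,3,4) _ _ line])
      show "(\<Sum>j\<in>{1..m}. H (z - R + (real j - 1) * c)) \<le> C * tail G z" if "K \<le> z" for z m
        by (rule Z) (use that K in simp)
    qed (use C in simp)
    also have "both_large G (distr N borel (\<lambda>f. mdt f n)) K x \<le> B * both_large G G K x"
      by (rule both_large_mdt_le[OF B])
    finally show ?thesis using C by simp
  qed
  have "\<exists>B. B \<in> S"
  proof -
    obtain K where K: "Z \<le> K" "0 \<le> K" "\<forall>\<^sub>F x in at_top. both_large G G K x \<le> 1 / (4 * C) * tail G x"
      using pick[of "1 / (4 * C)" 0] C by auto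
    have "\<forall>\<^sub>F x in at_top. tail G (x - K) \<le> (1 + 1) * tail G x"
      by (rule long_tailed_le[OF subexp_int]) simp
    then have "\<forall>\<^sub>F x in at_top. both_large G G K x \<le> 1 / (4 * C) * tail G x \<and> tail G (x - K) \<le> (1 + 1) * tail G x
        \<and> R \<le> x \<and> 2 * K \<le> x \<and> 0 \<le> x"
      by (intro eventually_conj K(3) eventually_ge_at_top)
    then obtain x0 where x0: "\<And>x. x0 \<le> x \<Longrightarrow> both_large G G K x \<le> 1 / (4 * C) * tail G x \<and>
        tail G (x - K) \<le> 2 * tail G x \<and> R \<le> x \<and> 2 * K \<le> x \<and> 0 \<le> x"
      by (auto simp: eventually_at_top_linorder)
    \<comment> \<open>For \<open>x \<ge> x0\<close> the induction step gives
      \<open>2 * C + 3 / 4 * B\<close>, which is at most \<open>B\<close> once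
      \<open>B \<ge> 8 * C\<close>. For \<open>x < x0\<close> the second entry makes the bound at
      least 1.\<close>
    define B where "B = max (8 * C) (1 / tail G x0)"
    have B: "8 * C \<le> B" "1 / tail G x0 \<le> B" "0 \<le> B" using C by (auto simp: B_def)
    have bound: "q n x \<le> B * tail G x" if "0 \<le> x" for n x
      using that
    proof (induction n arbitrary: x)
      case 0
      have "q 0 x = 0" using 0 by (simp add: q_def max_dater_def)
      then show ?case using B by simp
    next
      case (Suc n)
      show ?case
      proof (cases "x0 \<le> x")
        case True
        note x = x0[OF True]
        have "q (Suc n) x \<le> C * tail G (x - K) + \<gamma> * q n (x - K) + C * (B * both_large G G K x)"
          by (rule step) (use K x Suc.IH B in auto)
        also have "\<dots> \<le> C * (2 * tail G x) + 1 / 4 * (B * (2 * tail G x)) + C * (B * (1 / (4 * C) * tail G x))"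
        proof (intro add_mono mult_left_mono mult_mono)
          have "q n (x - K) \<le> B * tail G (x - K)" using x K by (intro Suc.IH) simp
          also have "\<dots> \<le> B * (2 * tail G x)" using x B by (intro mult_left_mono) auto
          finally show "q n (x - K) \<le> B * (2 * tail G x)" .
        qed (use x C B \<gamma> q_nonneg in auto)
        also have "\<dots> = (2 * C + 3 / 4 * B) * tail G x" using C by (simp add: algebra_simps)
        also have "\<dots> \<le> B * tail G x" using B by (intro mult_right_mono) auto
        finally show ?thesis .
      next
        case False
        have "1 \<le> B * tail G x0" using B(2) tail_G_pos[of x0] by (simp add: field_simps)
        also have "\<dots> \<le> B * tail G x" using B False by (intro mult_left_mono G.tail_antimono) auto
        finally show ?thesis using q_le_1[of "Suc n" x] by simp
      qed
    qed
    have "qi x \<le> B * tail G x" if "0 \<le> x" for x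
      by (rule LIMSEQ_le_const2[OF q_tendsto[OF that]]) (use bound that in blast)
    then have "B \<in> S"
      unfolding S_def using B by (auto intro!: eventually_mono[OF eventually_ge_at_top[of 0]])
    then show ?thesis ..
  qed
  then have ne: "S \<noteq> {}" by blast
  have bdd: "bdd_below S" unfolding S_def by (rule bdd_belowI[of _ 0]) simp
  have improve: "C + \<gamma> * B + e \<in> S" if B: "B \<in> S" and e: "0 < e" for B e
  proof -
    have B0: "0 \<le> B" "\<forall>\<^sub>F x in at_top. qi x \<le> B * tail G x" using B by (auto simp: S_def)
    obtain K0 where K0: "\<And>z. K0 \<le> z \<Longrightarrow> qi z \<le> B * tail G z"
      using B0(2) by (auto simp: eventually_at_top_linorder)
    \<comment> \<open>\<open>?e2\<close> keeps the contribution of two large terms below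
      \<open>e / 2\<close>, and \<open>?e3\<close> does the same for the replacement of
      \<open>x - K\<close> by \<open>x\<close>. The \<open>1\<close> in \<open>B + 1\<close> covers
      \<open>B = 0\<close>.\<close>
    let ?e2 = "e / (2 * C * (B + 1))" and ?e3 = "e / (2 * (C + \<gamma> * B))"
    have pos: "0 < C + \<gamma> * B" using C \<gamma> B0 by (simp add: add_pos_nonneg)
    obtain K where K: "Z \<le> K" "K0 \<le> K" "0 \<le> K" "\<forall>\<^sub>F x in at_top. both_large G G K x \<le> ?e2 * tail G x"
      using pick[of ?e2 K0] C B0 e by auto
    have "\<forall>\<^sub>F x in at_top. tail G (x - K) \<le> (1 + ?e3) * tail G x"
      using pos e by (intro long_tailed_le[OF subexp_int]) simp
    then have "\<forall>\<^sub>F x in at_top. qi x \<le> (C + \<gamma> * B + e) * tail G x"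
      using K(4) eventually_ge_at_top[of R] eventually_ge_at_top[of "2 * K"]
    proof eventually_elim
      case (elim x)
      have xK: "0 \<le> x - K" "K0 \<le> x - K" "0 \<le> x" using elim K by auto
      have "q (Suc n) x \<le> C * tail G (x - K) + \<gamma> * qi (x - K) + C * (B * both_large G G K x)" for n
      proof -
        have "q (Suc n) x \<le> C * tail G (x - K) + \<gamma> * q n (x - K) + C * (B * both_large G G K x)"
        proof (rule step)
          show "q n z \<le> B * tail G z" if "K \<le> z" for z
            using q_le_qi[of z n] K0[of z] that K by linarith
        qed (use K elim B0 in auto)
        also have "\<gamma> * q n (x - K) \<le> \<gamma> * qi (x - K)"
          using \<gamma> xK by (intro mult_left_mono q_le_qi) auto
        finally show ?thesis by simp
      qed
      then have "qi x \<le> C * tail G (x - K) + \<gamma> * qi (x - K) + C * (B * both_large G G K x)"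
        by (intro LIMSEQ_le_const2[OF LIMSEQ_Suc[OF q_tendsto[OF xK(3)]]]) blast
      also have "\<dots> \<le> C * tail G (x - K) + \<gamma> * (B * tail G (x - K)) + C * (B * (?e2 * tail G x))"
        using C \<gamma> B0 K0[OF xK(2)] elim by (intro add_mono mult_left_mono) auto
      also have "\<dots> = (C + \<gamma> * B) * tail G (x - K) + C * B * ?e2 * tail G x"
        by (simp add: algebra_simps)
      also have "\<dots> \<le> (C + \<gamma> * B) * ((1 + ?e3) * tail G x) + e / 2 * tail G x"
      proof (intro add_mono mult_left_mono mult_right_mono)
        have "C * B * ?e2 = e / 2 * (B / (B + 1))" using C by simp
        also have "\<dots> \<le> e / 2 * 1" using B0 e by (intro mult_left_mono) auto
        finally show "C * B * ?e2 \<le> e / 2" by simp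
      qed (use elim pos in auto)
      also have "\<dots> = (C + \<gamma> * B + e) * tail G x" using pos by (simp add: field_simps)
      finally show ?case .
    qed
    then show ?thesis using C \<gamma> B0 e by (simp add: S_def)
  qed
  have "Inf S \<le> C + \<gamma> * Inf S + e" if e: "0 < e" for e
  proof -
    have "Inf S < Inf S + e" using e by simp
    then obtain B where B: "B \<in> S" "B < Inf S + e" using cInf_lessD[OF ne] by blast
    have "Inf S \<le> C + \<gamma> * B + e / 2" using improve[OF B(1), of "e / 2"] e bdd by (intro cInf_lower) auto
    also have "\<gamma> * B \<le> \<gamma> * (Inf S + e)" using B(2) \<gamma> by (intro mult_left_mono) auto
    also have "\<dots> = \<gamma> * Inf S + \<gamma> * e" by (rule distrib_left)
    also have "\<gamma> * e \<le> 1 / 4 * e" using \<gamma> e by (intro mult_right_mono) auto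
    finally show ?thesis using e by simp
  qed
  then have "Inf S \<le> C + \<gamma> * Inf S" by (rule field_le_epsilon)
  then have "(1 - \<gamma>) * Inf S \<le> C" by (simp add: algebra_simps)
  then have "Inf S \<le> C / (1 - \<gamma>)" using \<gamma> by (simp add: field_simps)
  then have "Inf S < C / (1 - \<gamma>) + \<eta>" using \<open>0 < \<eta>\<close> by simp
  then obtain B where B: "B \<in> S" "B < C / (1 - \<gamma>) + \<eta>" using cInf_lessD[OF ne] by blast
  have "\<forall>\<^sub>F x in at_top. qi x \<le> B * tail G x" using B by (simp add: S_def)
  then show ?thesis
    by eventually_elim (use B(2) in \<open>auto elim!: order_trans intro!: mult_right_mono\<close>)
qed

lemma qi_upper:
  assumes "0 < \<eta>"
  shows "\<forall>\<^sub>F x in at_top. qi x \<le> ((d1 + d2) / (a - b) + \<eta>) * g x"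
proof -
  \<comment> \<open>The constant obtained below with slope \<open>(a - b) * (1 - e)\<close> and all
    other tolerances, including \<open>\<gamma>\<close>, equal to \<open>e\<close>. It is continuous
    at 0 with the desired value there.\<close>
  let ?k = "\<lambda>e. (d1 + d2 + e) / ((a - b) * (1 - e)) * (1 + e) / (1 - e) + e"
  have "(?k \<longlongrightarrow> (d1 + d2 + 0) / ((a - b) * (1 - 0)) * (1 + 0) / (1 - 0) + 0) (at_right 0)"
    using stable by (intro tendsto_intros) auto
  then have "\<forall>\<^sub>F e in at_right 0. ?k e < (d1 + d2) / (a - b) + \<eta>"
    using assms by (intro order_tendstoD(2)[where y="(d1 + d2) / (a - b)"]) auto
  moreover have "\<forall>\<^sub>F e in at_right (0::real). e \<in> {0<..<1 / 4}"
    by (rule eventually_at_right_real) simp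
  ultimately have "\<forall>\<^sub>F e in at_right 0. ?k e < (d1 + d2) / (a - b) + \<eta> \<and> e \<in> {0<..<1 / 4}"
    by (rule eventually_conj)
  then obtain e where e: "?k e < (d1 + d2) / (a - b) + \<eta>" "0 < e" "e < 1 / 4"
    using eventually_happens'[OF trivial_limit_at_right_real] by auto
  define c where "c = (a - b) * (1 - e)"
  have c: "0 < c" "c < a - b" using e stable by (simp_all add: c_def)
  define C where "C = (d1 + d2 + e) / c * (1 + e)"
  have C: "0 < C" using c e d_nonneg by (simp add: C_def)
  obtain R where R: "0 \<le> R" "prob {f. \<exists>j\<ge>1. dt f j > R - real j * c} \<le> e"
    using exists_line[OF c(2) e(2)] by blast
  obtain Z where Z: "\<And>z m. Z \<le> z \<Longrightarrow> (\<Sum>j\<in>{1..m}. H (z - R + (real j - 1) * c)) \<le> C * tail G z"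
    using sum_H_upper[OF e(2) c(1) e(2), of R] unfolding C_def by blast
  have "\<forall>\<^sub>F x in at_top. qi x \<le> (C / (1 - e) + e) * tail G x"
    by (rule qi_upper_aux[OF R(1) c(1) C e(2) _ Z R(2) e(2)]) (use e in auto)
  then show ?thesis using eventually_g_eq eventually_ge_at_top[of 0]
  proof eventually_elim
    case (elim x)
    have "qi x \<le> (C / (1 - e) + e) * g x" using elim by simp
    also have "\<dots> \<le> ((d1 + d2) / (a - b) + \<eta>) * g x"
      using e(1) g_pos[of x] elim by (intro mult_right_mono) (auto simp: C_def c_def)
    finally show ?case .
  qed
qed

end

section \<open>Sums and integrals of the tail\<close>

lemma normal_tail_small:
  assumes "0 < v" "0 < e" "0 < k"
  shows "\<forall>\<^sub>F x in at_top. normal_tail ((x - y) / (v * sqrt k)) < e"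
proof (rule order_tendstoD)
  have "filterlim (\<lambda>x. - y + x) at_top at_top"
    by (rule filterlim_tendsto_add_at_top[OF tendsto_const filterlim_ident])
  then have "filterlim (\<lambda>x. (x - y) * (1 / (v * sqrt k))) at_top at_top"
    using assms by (intro filterlim_at_top_mult_tendsto_pos[OF tendsto_const]) simp_all
  then show "((\<lambda>x. normal_tail ((x - y) / (v * sqrt k))) \<longlongrightarrow> 0) at_top"
    using filterlim_compose[OF std_normal.tail_at_top] by simp
qed (rule assms)

text \<open>Two regimes: for \<open>n \<le> k\<close> the left side is itself below \<open>e\<close>
  once \<open>x\<close> is large; for \<open>n > k\<close> the argument moves by
  \<open>y / (v * sqrt n) \<le> e\<close>. The choice of \<open>k\<close> is what makes the second
  statement true.\<close>

lemma normal_tail_shift_uniform: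
  assumes "0 < v" "0 < e" "0 \<le> y"
  shows "\<forall>\<^sub>F x in at_top. \<forall>n\<ge>1. normal_tail ((x - y) / (v * sqrt (real n))) \<le> normal_tail (x / (v * sqrt (real n))) + e"
proof -
  define k where "k = max 1 ((y / (v * e))\<^sup>2)"
  have k: "0 < k" by (simp add: k_def)
  show ?thesis
    using normal_tail_small[OF assms(1,2) k, of y] eventually_ge_at_top[of y]
  proof eventually_elim
    case (elim x)
    show ?case
    proof (intro allI impI)
      fix n :: nat assume n: "1 \<le> n"
      have pos: "0 < v * sqrt (real n)" using n assms by simp
      show "normal_tail ((x - y) / (v * sqrt (real n))) \<le> normal_tail (x / (v * sqrt (real n))) + e"
      proof (cases "real n \<le> k")
        case True
        then have "(x - y) / (v * sqrt k) \<le> (x - y) / (v * sqrt (real n))"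
          using n elim assms k by (intro divide_left_mono mult_left_mono mult_pos_pos) auto
        from std_normal.tail_antimono[OF this] show ?thesis
          using elim std_normal.tail_nonneg[of "x / (v * sqrt (real n))"] by linarith
      next
        case False
        then have "(y / (v * e))\<^sup>2 \<le> real n" by (simp add: k_def)
        then have "y / (v * e) \<le> sqrt (real n)" by (rule real_le_rsqrt)
        then have "y \<le> e * (v * sqrt (real n))" using assms by (simp add: field_simps)
        then have "y / (v * sqrt (real n)) \<le> e" using pos by (simp add: divide_le_eq)
        moreover have "x / (v * sqrt (real n)) - (x - y) / (v * sqrt (real n)) = y / (v * sqrt (real n))"
          by (simp add: diff_divide_distrib)
        moreover have "(x - y) / (v * sqrt (real n)) \<le> x / (v * sqrt (real n))"
          using assms pos by (intro divide_right_mono) auto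
        ultimately show ?thesis
          using normal_tail_lipschitz[of "(x - y) / (v * sqrt (real n))" "x / (v * sqrt (real n))"] by linarith
      qed
    qed
  qed
qed

text \<open>As for the shift by a constant, bounded \<open>m\<close> are settled by \<open>x\<close>
  being large. For \<open>m > 1 / e\<close> the two square roots differ by a factor of at most
  \<open>1 + e\<close>, and \<open>normal_tail_scale\<close> applies.\<close>

lemma normal_tail_oscillation:
  assumes "0 < v" "0 < e"
  shows "\<forall>\<^sub>F x in at_top. \<forall>m y. real m < y \<and> y \<le> real (Suc m) \<longrightarrow>
    normal_tail (x / (v * sqrt (real (Suc m)))) - normal_tail (x / (v * sqrt y)) \<le> e"
proof -
  define k where "k = max 1 (1 / e)"
  have k: "0 < k" "1 / e \<le> k" by (simp_all add: k_def)
  have "\<forall>\<^sub>F x in at_top. normal_tail (x / (v * sqrt (k + 1))) < e"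
    using normal_tail_small[OF assms, of "k + 1" 0] k by simp
  then show ?thesis
    using eventually_gt_at_top[of 0]
  proof eventually_elim
    case (elim x)
    show ?case
    proof (intro allI impI)
      fix m :: nat and y :: real assume my: "real m < y \<and> y \<le> real (Suc m)"
      have x: "normal_tail (x / (v * sqrt (k + 1))) < e" "0 < x" using elim by simp_all
      have y: "real m < y" "y \<le> real (Suc m)" "0 < y" using my by (auto intro: le_less_trans[of 0 "real m"])
      show "normal_tail (x / (v * sqrt (real (Suc m)))) - normal_tail (x / (v * sqrt y)) \<le> e"
    proof (cases "real m \<le> k")
      case True
      then have "x / (v * sqrt (k + 1)) \<le> x / (v * sqrt (real (Suc m)))"
        using x assms k by (intro divide_left_mono mult_left_mono mult_pos_pos) auto
      from std_normal.tail_antimono[OF this] show ?thesis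
        using x std_normal.tail_nonneg[of "x / (v * sqrt y)"] by linarith
    next
      case False
      define r where "r = sqrt (real (Suc m) / y)"
      have m: "0 < real m" "1 / e < real m" using False k by linarith+
      have r1: "1 \<le> r" using y by (simp add: r_def)
      have "real (Suc m) / y \<le> 1 + e"
      proof -
        have "1 \<le> e * real m" using m assms by (simp add: field_simps)
        also have "e * real m \<le> e * y" using y assms by simp
        finally have "real (Suc m) \<le> (1 + e) * y" using y by (simp add: algebra_simps)
        then show ?thesis using y by (simp add: divide_le_eq)
      qed
      also have "1 + e \<le> (1 + e)\<^sup>2" using assms by (simp add: power2_eq_square algebra_simps)
      finally have r2: "r \<le> 1 + e" unfolding r_def using assms by (intro real_le_lsqrt) auto
      have "r * sqrt y = sqrt (real (Suc m))" using y by (simp add: r_def real_sqrt_divide)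
      then have "r * (x / (v * sqrt (real (Suc m)))) = x / (v * sqrt y)"
        using y r1 assms by (auto simp: field_simps)
      moreover have "0 < x / (v * sqrt (real (Suc m)))" using x assms by simp
      ultimately show ?thesis
        using normal_tail_scale[of "x / (v * sqrt (real (Suc m)))" r] r1 r2 by simp
    qed
    qed
  qed
qed

context integrated_tail
begin

text \<open>The integral of \<open>tail F (x + y * c)\<close> over \<open>m < y \<le> m + 1\<close>.
  Both the jump probabilities and the integral in the theorem are compared with these weights, whose
  total is exactly \<open>g x / c\<close>.\<close>

definition wt :: "real \<Rightarrow> real \<Rightarrow> nat \<Rightarrow> real" where
  "wt c x m = (g (x + real m * c) - g (x + real (Suc m) * c)) / c"

lemma wt_ge:
  assumes "0 \<le> x" "0 < c" shows "tail F (x + real (Suc m) * c) \<le> wt c x m"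
proof -
  have "c * tail F (x + real (Suc m) * c) \<le> g (x + real m * c) - g (x + real (Suc m) * c)"
    using g_diff(1)[of "x + real m * c" "x + real (Suc m) * c"] assms by (simp add: algebra_simps)
  then show ?thesis using assms by (simp add: wt_def field_simps)
qed

lemma wt_nonneg: "0 \<le> x \<Longrightarrow> 0 < c \<Longrightarrow> 0 \<le> wt c x m"
  using wt_ge[of x c m] F.tail_nonneg[of "x + real (Suc m) * c"] by linarith

lemma wt_sums: "0 \<le> x \<Longrightarrow> 0 < c \<Longrightarrow> wt c x sums (g x / c)"
proof -
  assume xc: "0 \<le> x" "0 < c"
  have "(\<lambda>m. g (x + real m * c)) \<longlonglongrightarrow> 0" by (rule g_sequence[OF xc])
  from telescope_sums'[OF this] have "(\<lambda>m. g (x + real m * c) - g (x + real (Suc m) * c)) sums (g x - 0)"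
    by simp
  from sums_divide[OF this, of c] show ?thesis by (simp add: wt_def [abs_def])
qed

lemma suminf_linear:
  fixes f h :: "nat \<Rightarrow> real"
  assumes "summable f" "summable h"
  shows "(\<Sum>m. \<alpha> * f m - \<beta> * h m) = \<alpha> * suminf f - \<beta> * suminf h"
  using suminf_diff[OF summable_mult[OF assms(1)] summable_mult[OF assms(2)], of \<alpha> \<beta>]
    suminf_mult[OF assms(1), of \<alpha>] suminf_mult[OF assms(2), of \<beta>] by simp

lemma mult_bounded_summable:
  fixes w \<rho> :: "nat \<Rightarrow> real"
  assumes "summable w" "\<And>m. 0 \<le> w m" "\<And>m. 0 \<le> \<rho> m \<and> \<rho> m \<le> 1"
  shows "summable (\<lambda>m. w m * \<rho> m)"
  by (rule summable_comparison_test'[OF assms(1), of 0]) (use assms in \<open>simp add: mult_left_le\<close>)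

text \<open>The slower rate \<open>c + e\<close> and the shift \<open>K\<close> perturb the weights by a small multiple of \<open>g x\<close>
  in total variation.\<close>

lemma weights:
  assumes A: "real_distribution A" and d: "0 \<le> d"
    and tails: "\<And>\<delta>. 0 < \<delta> \<Longrightarrow> \<forall>\<^sub>F x in at_top. \<bar>tail A x - d * tail F x\<bar> \<le> \<delta> * tail F x"
    and "0 < c" "0 < \<eta>"
  shows "\<exists>e0>0. \<forall>e. 0 < e \<and> e \<le> e0 \<longrightarrow> (\<forall>K\<ge>0. \<forall>\<^sub>F x in at_top. summable (\<lambda>m. tail A (x + real (Suc m) * (c + e) + K)) \<and>
    (\<forall>\<rho>. (\<forall>m. 0 \<le> \<rho> m \<and> \<rho> m \<le> 1) \<longrightarrow>
      \<bar>(\<Sum>m. tail A (x + real (Suc m) * (c + e) + K) * \<rho> m) - d * (\<Sum>m. wt c x m * \<rho> m)\<bar> \<le> \<eta> * g x))"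
proof -
  interpret A: real_distribution A by (rule A)
  \<comment> \<open>The sum of the majorant \<open>?D\<close> below will be at most
    \<open>?k e * g x\<close>, and \<open>?k\<close> tends to 0 with \<open>e\<close>.\<close>
  let ?k = "\<lambda>e. (d + 2 * e) / c - d * (1 - e) / (c + e) + e / c"
  have "(?k \<longlongrightarrow> (d + 2 * 0) / c - d * (1 - 0) / (c + 0) + 0 / c) (at_right 0)"
    using \<open>0 < c\<close> by (intro tendsto_intros) auto
  then have "\<forall>\<^sub>F e in at_right 0. ?k e < \<eta>"
    using \<open>0 < \<eta>\<close> by (intro order_tendstoD(2)[where y="d / c - d / c"]) auto
  then obtain e1 where e1: "0 < e1" "\<And>e. 0 < e \<Longrightarrow> e < e1 \<Longrightarrow> ?k e < \<eta>"
    unfolding eventually_at_right_field by auto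
  show ?thesis
  proof (intro exI[of _ "e1 / 2"] conjI allI impI)
    show "0 < e1 / 2" using e1 by simp
    fix e K :: real assume e': "0 < e \<and> e \<le> e1 / 2" and K: "0 \<le> K"
    then have e: "0 < e" "?k e < \<eta>" using e1 by auto
    obtain z0 where z0: "\<And>z. z0 \<le> z \<Longrightarrow> \<bar>tail A z - d * tail F z\<bar> \<le> e * tail F z"
      using tails[OF e(1)] by (auto simp: eventually_at_top_linorder)
    have "\<forall>\<^sub>F x in at_top. 1 - e < g (x + (c + e + K)) / g x"
      using e by (intro order_tendstoD(1)[OF g_shift_tendsto]) simp
    then show "\<forall>\<^sub>F x in at_top. summable (\<lambda>m. tail A (x + real (Suc m) * (c + e) + K)) \<and>
      (\<forall>\<rho>. (\<forall>m. 0 \<le> \<rho> m \<and> \<rho> m \<le> 1) \<longrightarrow>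
      \<bar>(\<Sum>m. tail A (x + real (Suc m) * (c + e) + K) * \<rho> m) - d * (\<Sum>m. wt c x m * \<rho> m)\<bar> \<le> \<eta> * g x)"
      using eventually_ge_at_top[of 0] eventually_ge_at_top[of z0]
    proof eventually_elim
      case (elim x)
      let ?w = "wt c x" and ?p = "\<lambda>m. tail A (x + real (Suc m) * (c + e) + K)"
        and ?f = "\<lambda>m. tail F ((x + K) + real (Suc m) * (c + e))"
      have gx: "0 < g x" using elim by (intro g_pos) simp
      have w: "?w sums (g x / c)" using elim \<open>0 < c\<close> by (intro wt_sums)
      have w0: "0 \<le> ?w m" for m using elim \<open>0 < c\<close> by (intro wt_nonneg)
      have fw: "?f m \<le> ?w m" for m
      proof -
        have "?f m \<le> tail F (x + real (Suc m) * c)"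
          using e K by (intro F.tail_antimono) (simp add: algebra_simps add_increasing)
        also have "\<dots> \<le> ?w m" using elim \<open>0 < c\<close> by (intro wt_ge)
        finally show ?thesis .
      qed
      have sf: "summable ?f" using elim K e \<open>0 < c\<close> by (intro summable_tail) auto
      have pf: "\<bar>?p m - d * ?f m\<bar> \<le> e * ?f m" for m
      proof -
        have "x + real (Suc m) * (c + e) + K = (x + K) + real (Suc m) * (c + e)" by simp
        moreover have "0 \<le> real (Suc m) * (c + e)" using e \<open>0 < c\<close> by (intro mult_nonneg_nonneg) auto
        then have "z0 \<le> (x + K) + real (Suc m) * (c + e)" using elim K by linarith
        note z0[OF this]
        ultimately show ?thesis by (simp only:)
      qed
      have pw: "?p m \<le> (d + e) * ?w m" for m
      proof -
        have "?p m \<le> (d + e) * ?f m" using pf[of m] unfolding distrib_right by linarith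
        also have "\<dots> \<le> (d + e) * ?w m" using fw d e by (intro mult_left_mono) auto
        finally show ?thesis .
      qed
      have sp: "summable ?p"
        by (rule summable_comparison_test'[OF summable_mult[OF sums_summable[OF w], of "d + e"], of 0])
           (use pw in simp)
      have f_ge: "g (x + (c + e + K)) / (c + e) \<le> suminf ?f"
        using suminf_tail_ge[of "x + K" "c + e"] elim K e \<open>0 < c\<close> by (simp add: algebra_simps)
      have f_le: "suminf ?f \<le> g x / c"
        using suminf_le[OF fw sf sums_summable[OF w]] sums_unique[OF w] by simp
      have p_ge: "d * (g (x + (c + e + K)) / (c + e)) - e * (g x / c) \<le> suminf ?p"
      proof -
        have "d * suminf ?f - e * suminf ?f = (\<Sum>m. d * ?f m - e * ?f m)"
          by (rule suminf_linear[OF sf sf, symmetric])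
        also have "\<dots> \<le> suminf ?p"
        proof (rule suminf_le)
          show "d * ?f m - e * ?f m \<le> ?p m" for m using pf[of m] by linarith
          show "summable (\<lambda>m. d * ?f m - e * ?f m)" using sf by (intro summable_diff summable_mult)
        qed (rule sp)
        finally have "d * suminf ?f - e * suminf ?f \<le> suminf ?p" .
        moreover have "d * (g (x + (c + e + K)) / (c + e)) \<le> d * suminf ?f"
          using f_ge d by (rule mult_left_mono)
        moreover have "e * suminf ?f \<le> e * (g x / c)" using f_le e by (intro mult_left_mono) auto
        ultimately show ?thesis by linarith
      qed
      show ?case
      proof (intro conjI allI impI sp)
        fix \<rho> :: "nat \<Rightarrow> real" assume \<rho>: "\<forall>m. 0 \<le> \<rho> m \<and> \<rho> m \<le> 1"
        \<comment> \<open>The one-sided bound \<open>?p m \<le> (d + e) * ?w m\<close> implies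
          \<open>\<bar>?p m - d * ?w m\<bar> \<le> ?D m\<close>. So nearly equal total masses
          already give closeness in total variation, and any \<open>\<rho>\<close> with values in
          the unit interval may be inserted.\<close>
        let ?D = "\<lambda>m. (d + 2 * e) * ?w m - ?p m"
        have sD: "summable ?D" by (intro summable_diff summable_mult sums_summable[OF w] sp)
        have s1: "summable (\<lambda>m. ?p m * \<rho> m)" by (rule mult_bounded_summable[OF sp]) (use \<rho> in auto)
        have s2: "summable (\<lambda>m. ?w m * \<rho> m)" by (rule mult_bounded_summable[OF sums_summable[OF w] w0]) (use \<rho> in auto)
        have eq: "(\<Sum>m. ?p m * \<rho> m) - d * (\<Sum>m. ?w m * \<rho> m) = (\<Sum>m. ?p m * \<rho> m - d * (?w m * \<rho> m))"
          using suminf_linear[OF s1 s2, of 1 d] by simp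
        have "\<bar>(\<Sum>m. ?p m * \<rho> m) - d * (\<Sum>m. ?w m * \<rho> m)\<bar> \<le> suminf ?D"
          unfolding eq
        proof -
          have bnd: "\<bar>?p m * \<rho> m - d * (?w m * \<rho> m)\<bar> \<le> ?D m" for m
          proof -
            have "\<bar>?p m - d * ?w m\<bar> \<le> ?D m"
            proof -
              have "0 \<le> e * ?w m" using w0 e by simp
              then show ?thesis using pw[of m] unfolding distrib_right mult_2 by linarith
            qed
            moreover have "?p m * \<rho> m - d * (?w m * \<rho> m) = (?p m - d * ?w m) * \<rho> m"
              by (simp only: left_diff_distrib mult.assoc)
            moreover have "\<bar>(?p m - d * ?w m) * \<rho> m\<bar> \<le> \<bar>?p m - d * ?w m\<bar>"
            proof -
              have "\<bar>\<rho> m\<bar> \<le> 1" using spec[OF \<rho>, of m] by linarith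
              then show ?thesis unfolding abs_mult by (rule mult_left_le) simp
            qed
            ultimately show ?thesis by linarith
          qed
          have sa: "summable (\<lambda>m. \<bar>?p m * \<rho> m - d * (?w m * \<rho> m)\<bar>)"
            by (rule summable_comparison_test'[OF sD, of 0]) (simp only: real_norm_def abs_idempotent bnd)
          have "\<bar>\<Sum>m. ?p m * \<rho> m - d * (?w m * \<rho> m)\<bar> \<le> (\<Sum>m. \<bar>?p m * \<rho> m - d * (?w m * \<rho> m)\<bar>)"
            by (rule summable_rabs[OF sa])
          also have "\<dots> \<le> suminf ?D" by (rule suminf_le[OF bnd sa sD])
          finally show "\<bar>\<Sum>m. ?p m * \<rho> m - d * (?w m * \<rho> m)\<bar> \<le> suminf ?D" .
        qed
        also have "suminf ?D = (d + 2 * e) * (g x / c) - suminf ?p"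
          using suminf_linear[OF sums_summable[OF w] sp, of "d + 2 * e" 1] sums_unique[OF w] by simp
        also have "\<dots> \<le> (d + 2 * e) * (g x / c) - (d * (g (x + (c + e + K)) / (c + e)) - e * (g x / c))"
          by (rule diff_left_mono[OF p_ge])
        also have "\<dots> \<le> (d + 2 * e) * (g x / c) - (d * ((1 - e) * g x / (c + e)) - e * (g x / c))"
        proof -
          have "(1 - e) * g x \<le> g (x + (c + e + K))" using elim(1) gx by (simp add: less_divide_eq less_imp_le)
          then have "d * ((1 - e) * g x / (c + e)) \<le> d * (g (x + (c + e + K)) / (c + e))"
            using d e \<open>0 < c\<close> by (intro mult_left_mono divide_right_mono) auto
          then show ?thesis by linarith
        qed
        also have "\<dots> = ?k e * g x"
        proof -
          have "A * (y / c) - (d * (B * y / k) - e * (y / c)) = (A / c - d * B / k + e / c) * y" for A B k y :: real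
            by (simp add: left_diff_distrib distrib_right)
          then show ?thesis .
        qed
        also have "\<dots> \<le> \<eta> * g x" using e gx by (intro mult_right_mono) auto
        finally show "\<bar>(\<Sum>m. ?p m * \<rho> m) - d * (\<Sum>m. ?w m * \<rho> m)\<bar> \<le> \<eta> * g x" .
      qed
    qed
  qed
qed

lemma integral_wt:
  assumes "0 \<le> x" "0 < c"
  shows "set_integrable lborel {0<..} (\<lambda>y. tail F (x + y * c))"
    and "(LBINT y:{real m<..real (Suc m)}. tail F (x + y * c)) = wt c x m"
proof -
  have c: "c \<noteq> 0" using assms by simp
  have aff: "(\<integral>u. indicator A u *\<^sub>R tail F u \<partial>lborel) = c * (\<integral>y. indicator A (x + c * y) *\<^sub>R tail F (x + c * y) \<partial>lborel)"
    for A
    using lborel_integral_real_affine[OF c, of "\<lambda>u. indicator A u *\<^sub>R tail F u" x] assms by simp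
  have "set_integrable lborel {x<..} (tail F)" using assms by (intro set_integrable_tail) auto
  then have "integrable lborel (\<lambda>y. indicator {x<..} (x + c * y) *\<^sub>R tail F (x + c * y))"
    unfolding set_integrable_def by (rule lborel_integrable_real_affine[OF _ c])
  moreover have "indicator {x<..} (x + c * y) = (indicator {0<..} y :: real)" for y
    using assms by (auto simp: indicator_def zero_less_mult_iff)
  ultimately show "set_integrable lborel {0<..} (\<lambda>y. tail F (x + y * c))"
    by (simp add: set_integrable_def mult.commute)
  have eq: "indicator {x + real m * c<..x + real (Suc m) * c} (x + c * y) = (indicator {real m<..real (Suc m)} y :: real)" for y
    using assms by (auto simp: indicator_def mult.commute)
  have "(LBINT y:{real m<..real (Suc m)}. tail F (x + y * c))
      = (LBINT u:{x + real m * c<..x + real (Suc m) * c}. tail F u) / c"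
    unfolding set_lebesgue_integral_def aff eq using assms by (simp add: mult.commute)
  also have "(LBINT u:{x + real m * c<..x + real (Suc m) * c}. tail F u)
      = (LBINT u:{x + real m * c..<x + real (Suc m) * c}. tail F u)"
  proof (rule set_integral_cong_set)
    have "AE u in lborel. u \<noteq> x + real m * c \<and> u \<noteq> x + real (Suc m) * c"
      using AE_lborel_singleton[of "x + real m * c"] AE_lborel_singleton[of "x + real (Suc m) * c"]
      by eventually_elim simp
    then show "AE u in lborel. (u \<in> {x + real m * c..<x + real (Suc m) * c}) = (u \<in> {x + real m * c<..x + real (Suc m) * c})"
      by eventually_elim auto
    have sub: "{x + real m * c<..x + real (Suc m) * c} \<subseteq> {0..}" "{x + real m * c..<x + real (Suc m) * c} \<subseteq> {0..}"
      using assms by (auto intro: order_trans[of 0 "x + real m * c"])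
    show "set_borel_measurable lborel {x + real m * c<..x + real (Suc m) * c} (tail F)"
      "set_borel_measurable lborel {x + real m * c..<x + real (Suc m) * c} (tail F)"
      using set_integrable_tail[OF _ sub(1)] set_integrable_tail[OF _ sub(2)]
      by (auto simp: set_integrable_def set_borel_measurable_def)
  qed
  also have "\<dots> = g (x + real m * c) - g (x + real (Suc m) * c)"
    using assms by (intro g_split[symmetric]) (auto intro!: mult_right_mono)
  finally show "(LBINT y:{real m<..real (Suc m)}. tail F (x + y * c)) = wt c x m"
    by (simp add: wt_def)
qed

text \<open>On each unit interval the normal factor varies by at most \<open>\<eta> * c\<close>, and
  the weights of these intervals add up to \<open>g x / c\<close>.\<close>

lemma integral_approx:
  assumes "0 < c" "0 < v" "0 < \<eta>"
  shows "\<forall>\<^sub>F x in at_top. \<bar>(LBINT y:{0<..}. tail F (x + y * c) * normal_tail (x / (v * sqrt y)))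
    - (\<Sum>m. wt c x m * normal_tail (x / (v * sqrt (real (Suc m)))))\<bar> \<le> \<eta> * g x"
proof -
  have "0 < \<eta> * c" using assms by simp
  from normal_tail_oscillation[OF assms(2) this] show ?thesis
    using eventually_gt_at_top[of 0]
  proof eventually_elim
    case (elim x)
    let ?h = "\<lambda>y. tail F (x + y * c)" and ?n = "\<lambda>y. normal_tail (x / (v * sqrt y))"
    let ?I = "\<lambda>m::nat. {real m<..real (Suc m)}"
    have cover: "(\<Union>m. ?I m) = {0<..}"
    proof safe
      fix y :: real assume "0 < y"
      then have "y \<in> ?I (nat (\<lceil>y\<rceil> - 1))" by (auto simp: of_nat_nat) linarith+
      then show "y \<in> (\<Union>m. ?I m)" by blast
    qed auto
    have anti: "mono (\<lambda>z. - tail D z)" if "real_distribution D" for D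
      using real_distribution.tail_antimono[OF that] by (auto simp: mono_def)
    have [measurable]: "normal_tail \<in> borel_measurable borel" "tail F \<in> borel_measurable borel"
      using borel_measurable_uminus[OF borel_measurable_mono[OF anti[OF std_normal.real_distribution_axioms]]]
        borel_measurable_uminus[OF borel_measurable_mono[OF anti[OF F.real_distribution_axioms]]] by simp_all
    have ih: "set_integrable lborel {0<..} ?h" using elim \<open>0 < c\<close> by (intro integral_wt) auto
    have ihn: "set_integrable lborel {0<..} (\<lambda>y. ?h y * ?n y)"
      unfolding set_integrable_def
    proof (rule Bochner_Integration.integrable_bound[OF ih[unfolded set_integrable_def]])
      show "AE y in lborel. norm (indicator {0<..} y *\<^sub>R (?h y * ?n y)) \<le> norm (indicator {0<..} y *\<^sub>R ?h y)"
        by (rule AE_I2) (simp add: abs_mult mult_left_le mult_left_le_one_le indicator_def)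
    qed measurable
    have Isub: "?I m \<subseteq> {0<..}" for m by auto
    have "(LBINT y:(\<Union>m. ?I m). ?h y * ?n y) = (\<Sum>m. LBINT y:?I m. ?h y * ?n y)"
    proof (rule lebesgue_integral_countable_add)
      show "set_integrable lborel (\<Union>m. ?I m) (\<lambda>y. ?h y * ?n y)" unfolding cover by (rule ihn)
      show "?I i \<inter> ?I j = {}" if "i \<noteq> j" for i j
        using that by (cases i j rule: linorder_cases) auto
    qed simp
    then have I_eq: "(LBINT y:{0<..}. ?h y * ?n y) = (\<Sum>m. LBINT y:?I m. ?h y * ?n y)"
      by (simp only: cover)
    have w: "wt c x sums (g x / c)" using elim \<open>0 < c\<close> by (intro wt_sums) auto
    have w0: "0 \<le> wt c x m" for m using elim \<open>0 < c\<close> by (intro wt_nonneg) auto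
    have piece: "wt c x m * (?n (real (Suc m)) - \<eta> * c) \<le> (LBINT y:?I m. ?h y * ?n y)"
      "(LBINT y:?I m. ?h y * ?n y) \<le> wt c x m * ?n (real (Suc m))" for m
    proof -
      have i1: "set_integrable lborel (?I m) ?h" by (rule set_integrable_subset[OF ih]) (use Isub in auto)
      have i2: "set_integrable lborel (?I m) (\<lambda>y. ?h y * ?n y)" by (rule set_integrable_subset[OF ihn]) (use Isub in auto)
      have ic: "set_integrable lborel (?I m) (\<lambda>y. ?h y * k)" for k using i1 by (rule set_integrable_mult_left)
      have vc: "(LBINT y:?I m. ?h y * k) = wt c x m * k" for k
        using integral_wt(2)[of x c m] elim \<open>0 < c\<close> by simp
      have "(LBINT y:?I m. ?h y * (?n (real (Suc m)) - \<eta> * c)) \<le> (LBINT y:?I m. ?h y * ?n y)"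
      proof (rule set_integral_mono[OF ic i2])
        fix y assume "y \<in> ?I m"
        then have "?n (real (Suc m)) - ?n y \<le> \<eta> * c" using elim(1) by simp
        then show "?h y * (?n (real (Suc m)) - \<eta> * c) \<le> ?h y * ?n y" by (intro mult_left_mono) auto
      qed
      then show "wt c x m * (?n (real (Suc m)) - \<eta> * c) \<le> (LBINT y:?I m. ?h y * ?n y)" by (simp only: vc)
      have "(LBINT y:?I m. ?h y * ?n y) \<le> (LBINT y:?I m. ?h y * ?n (real (Suc m)))"
      proof (rule set_integral_mono[OF i2 ic])
        fix y assume y: "y \<in> ?I m"
        then have "0 < y" by (auto intro: le_less_trans[of 0 "real m"])
        then have "x / (v * sqrt (real (Suc m))) \<le> x / (v * sqrt y)"
          using y elim assms by (intro divide_left_mono mult_left_mono mult_pos_pos) auto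
        from std_normal.tail_antimono[OF this]
        show "?h y * ?n y \<le> ?h y * ?n (real (Suc m))" by (intro mult_left_mono) auto
      qed
      then show "(LBINT y:?I m. ?h y * ?n y) \<le> wt c x m * ?n (real (Suc m))" by (simp only: vc)
    qed
    have s1: "summable (\<lambda>m. wt c x m * ?n (real (Suc m)))"
      by (rule mult_bounded_summable[OF sums_summable[OF w] w0]) auto
    have s2: "summable (\<lambda>m. LBINT y:?I m. ?h y * ?n y)"
    proof (rule summable_comparison_test'[OF s1, of 0])
      fix m
      have "0 \<le> (LBINT y:?I m. ?h y * ?n y)"
        unfolding set_lebesgue_integral_def by (intro integral_nonneg_AE) (auto simp: indicator_def)
      then show "norm (LBINT y:?I m. ?h y * ?n y) \<le> wt c x m * ?n (real (Suc m))" using piece(2)[of m] by simp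
    qed
    have s3: "summable (\<lambda>m. wt c x m * (\<eta> * c))" by (intro summable_mult2 sums_summable[OF w])
    have "(\<Sum>m. LBINT y:?I m. ?h y * ?n y) \<le> (\<Sum>m. wt c x m * ?n (real (Suc m)))"
      by (rule suminf_le[OF piece(2) s2 s1])
    moreover have "(\<Sum>m. wt c x m * ?n (real (Suc m))) - (\<Sum>m. wt c x m * (\<eta> * c)) \<le> (\<Sum>m. LBINT y:?I m. ?h y * ?n y)"
      unfolding suminf_diff[OF s1 s3]
      by (rule suminf_le[OF _ summable_diff[OF s1 s3] s2]) (use piece(1) in \<open>simp add: algebra_simps\<close>)
    moreover have "(\<Sum>m. wt c x m * (\<eta> * c)) = \<eta> * g x"
      using w \<open>0 < c\<close> by (subst suminf_mult2[symmetric]) (auto simp: sums_summable sums_unique[symmetric])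
    ultimately show ?case unfolding I_eq using g_nonneg[of x] assms by (simp add: abs_le_iff)
  qed
qed

end

section \<open>Single big jumps\<close>

text \<open>A Bonferroni inequality: the pairwise overlaps add up to at most the square of the total
  mass.\<close>

lemma (in prob_space) prob_Union_ge:
  fixes E :: "nat \<Rightarrow> 'a set"
  assumes E: "\<And>i. E i \<in> events" and p: "\<And>i. 0 \<le> p i" "summable p"
    and pair: "\<And>i j. i \<noteq> j \<Longrightarrow> prob (E i \<inter> E j) \<le> p i * p j" and single: "\<And>i. prob (E i) \<le> p i"
  shows "(\<Sum>i. prob (E i)) - (suminf p)\<^sup>2 \<le> prob (\<Union>i. E i)"
proof -
  have fin: "(\<Sum>i<n. prob (E i)) - (\<Sum>i<n. p i)\<^sup>2 \<le> prob (\<Union>i<n. E i)" for n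
  proof (induction n)
    case (Suc n)
    let ?U = "\<Union>i<n. E i"
    have U: "?U \<in> events" using E by auto
    have "prob (?U \<inter> E n) = prob (\<Union>i<n. E i \<inter> E n)" by (rule arg_cong[where f=prob]) auto
    also have "\<dots> \<le> (\<Sum>i<n. prob (E i \<inter> E n))"
      by (rule finite_measure_subadditive_finite) (use E in auto)
    also have "\<dots> \<le> (\<Sum>i<n. p i * p n)" by (intro sum_mono pair) auto
    finally have int: "prob (?U \<inter> E n) \<le> (\<Sum>i<n. p i) * p n" by (simp add: sum_distrib_right)
    have "prob (?U \<union> E n) = prob ?U + prob (E n - ?U)"
      using finite_measure_Union[of ?U "E n - ?U"] U E by (auto simp: Un_Diff_cancel)
    moreover have "prob (E n - ?U) = prob (E n) - prob (?U \<inter> E n)"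
      using finite_measure_Diff'[of "E n" ?U] U E by (simp add: Int_commute)
    moreover have "(\<Union>i<Suc n. E i) = ?U \<union> E n" by (auto simp: less_Suc_eq)
    then have "prob (\<Union>i<Suc n. E i) = prob (?U \<union> E n)" by (rule arg_cong)
    moreover have "0 \<le> (\<Sum>i<n. p i) * p n" "0 \<le> (p n)\<^sup>2" using p by (simp_all add: sum_nonneg)
    moreover have "((\<Sum>i<n. p i) + p n)\<^sup>2 = (\<Sum>i<n. p i)\<^sup>2 + 2 * ((\<Sum>i<n. p i) * p n) + (p n)\<^sup>2"
      by (simp add: power2_eq_square algebra_simps)
    ultimately show ?case using Suc int unfolding sum.lessThan_Suc by linarith
  qed simp
  have sE: "summable (\<lambda>i. prob (E i))"
    by (rule summable_comparison_test'[OF p(2), of 0]) (simp add: single)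
  have "(\<lambda>n. (\<Sum>i<n. prob (E i)) - (\<Sum>i<n. p i)\<^sup>2) \<longlonglongrightarrow> (\<Sum>i. prob (E i)) - (suminf p)\<^sup>2"
    by (intro tendsto_intros summable_LIMSEQ sE p)
  then show ?thesis
  proof (rule LIMSEQ_le_const2)
    have "prob (\<Union>i<n. E i) \<le> prob (\<Union>i. E i)" for n
      by (rule finite_measure_mono) (use E in auto)
    then show "\<exists>N. \<forall>n\<ge>N. (\<Sum>i<n. prob (E i)) - (\<Sum>i<n. p i)\<^sup>2 \<le> prob (\<Union>i. E i)"
      using fin by (meson order_trans)
  qed
qed

lemma max_sum_cong: "(\<And>i. i < n \<Longrightarrow> f i = h i) \<Longrightarrow> max_sum n f = max_sum n h"
proof (induction n arbitrary: f h)
  case (Suc n)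
  have "max_sum n (\<lambda>i. f (Suc i)) = max_sum n (\<lambda>i. h (Suc i))" by (rule Suc.IH) (simp add: Suc.prems)
  then show ?case by (simp add: Suc.prems)
qed simp

lemma measurable_lind [measurable]:
  assumes [measurable]: "\<And>i. (\<lambda>x. S x i) \<in> borel_measurable M" "\<And>i. (\<lambda>x. U x i) \<in> borel_measurable M"
  shows "(\<lambda>x. lind (S x) (U x)) \<in> borel_measurable M"
  unfolding lind_def by measurable

lemma measurable_gap [measurable]:
  assumes [measurable]: "\<And>i. (\<lambda>x. S x i) \<in> borel_measurable M" "\<And>i. (\<lambda>x. U x i) \<in> borel_measurable M"
  shows "(\<lambda>x. gap (S x) (U x) i) \<in> borel_measurable M"
proof -
  have [measurable]: "(\<lambda>x. shift i (S x) j) \<in> borel_measurable M" "(\<lambda>x. shift i (U x) j) \<in> borel_measurable M" for j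
    unfolding shift_def by measurable
  show ?thesis unfolding gap_def by measurable
qed

text \<open>Take the path that switches already at index 1.\<close>

lemma dater_ge_first:
  assumes "1 \<le> k" "0 \<le> t 1"
  shows "(\<Sum>i=1..k. s i - u i) \<le> dater s t u k"
proof -
  obtain j where j: "k = Suc j" using assms by (cases k) auto
  have "t 1 + (\<Sum>i=1..Suc j. s i) \<le> passage s t (Suc j)"
    using passage_ge_path[of 1 t s j] by (simp del: passage.simps sum.cl_ivl_Suc)
  then show ?thesis unfolding dater_def sum_subtractf j using assms(2) by linarith
qed

section \<open>Effect of one large service time\<close>

locale tandem_clt = tandem_law F \<mu> a b d1 d2 for F \<mu> a b d1 d2 +
  fixes v :: real
  assumes v_pos: "0 < v"
    and sq_first: "integrable (\<mu> First) (\<lambda>x. x\<^sup>2)" and sq_second: "integrable (\<mu> Second) (\<lambda>x. x\<^sup>2)"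
    and variances: "((\<integral>x. x\<^sup>2 \<partial>\<mu> First) - b\<^sup>2) + ((\<integral>x. x\<^sup>2 \<partial>\<mu> Second) - b\<^sup>2) = v\<^sup>2"
begin

lemma expectation_cs: "h \<in> borel_measurable borel \<Longrightarrow> expectation (\<lambda>f. h (cs k f i)) = (\<integral>x. h x \<partial>\<mu> k)" for h :: "real \<Rightarrow> real"
  using integral_distr[OF cs_measurable_N, of h k i] by (simp add: distr_cs)

lemma integrable_cs: "h \<in> borel_measurable borel \<Longrightarrow> integrable N (\<lambda>f. h (cs k f i)) \<longleftrightarrow> integrable (\<mu> k) h" for h :: "real \<Rightarrow> real"
  using integrable_distr_eq[OF cs_measurable_N, of h k i] by (simp add: distr_cs)

text \<open>Increments of the second queue while the first station is busy and emits customers at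
  the spacing of its own service times; hence the offset of one index.\<close>

definition X :: "nat \<Rightarrow> (kind \<times> nat \<Rightarrow> real) \<Rightarrow> real" where
  "X i f = cs Second f (Suc i) - cs First f i"

lemma X_measurable [measurable]: "X i \<in> borel_measurable PX"
  unfolding X_def by measurable

lemma sum_X: "(\<Sum>i<k. X i f) = (\<Sum>i=1..k. cs Second f i - cs First f (i - 1))"
  by (simp add: X_def sum.atLeast1_atMost_eq)

lemma indep_first_second: "indep_var borel (\<lambda>f. cs Second f i) borel (\<lambda>f. cs First f j)"
  by (rule indep_var_N[of _ _ _ _ "{(Second, i)}" "{(First, j)}"]) (auto intro!: depends_onI simp: cs_def)

lemma distr_X: "distr N borel (X i) = distr (\<mu> Second \<Otimes>\<^sub>M \<mu> First) borel (\<lambda>p. fst p - snd p)"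
proof -
  have eq: "\<mu> Second \<Otimes>\<^sub>M \<mu> First = distr N (borel \<Otimes>\<^sub>M borel) (\<lambda>f. (cs Second f (Suc i), cs First f i))"
    using indep_first_second[of "Suc i" i] unfolding indep_var_distribution_eq by (simp add: distr_cs)
  have m: "(\<lambda>f. (cs Second f (Suc i), cs First f i)) \<in> measurable N (borel \<Otimes>\<^sub>M borel)" by measurable
  show ?thesis unfolding eq
    by (subst distr_distr[OF _ m]) (simp_all add: comp_def X_def [abs_def])
qed

text \<open>Because of the offset, different \<open>X i\<close> use disjoint pairs of coordinates
  and are independent. Equal means at the two stations centre them, and the two variances add up to
  \<open>v^2\<close>.\<close>

lemma walk_clt:
  assumes "0 < e"
  shows "\<forall>\<^sub>F x in at_top. \<forall>n\<ge>1. \<bar>prob {f. max_sum n (\<lambda>i. X i f) > x} - 2 * normal_tail (x / (v * sqrt (real n)))\<bar> \<le> e"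
proof -
  define \<nu> where "\<nu> = distr N borel (X 0)"
  have X_N: "X i \<in> borel_measurable N" for i by measurable
  have \<nu>: "real_distribution \<nu>" unfolding \<nu>_def by (rule real_distribution_distr[OF X_N])
  have id: "distr N borel (X i) = \<nu>" for i by (simp only: \<nu>_def distr_X)
  have ind: "indep_vars (\<lambda>_. borel) X UNIV"
  proof (rule indep_vars_blocks[where K="\<lambda>i. {(Second, Suc i), (First, i)}"])
    show "disjoint_family (\<lambda>i. {(Second, Suc i), (First, i)})" by (auto simp: disjoint_family_on_def)
    show "depends_on {(Second, Suc i), (First, i)} (X i)" for i by (rule depends_onI) (simp add: X_def cs_def)
  qed (rule X_measurable)
  have idm: "(\<lambda>x. x) \<in> borel_measurable (borel :: real measure)" by (rule measurable_ident_sets[OF refl])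
  have sqm: "(\<lambda>x. x\<^sup>2) \<in> borel_measurable (borel :: real measure)" by measurable
  have i1: "integrable N (\<lambda>f. cs k f i)" for k i
    by (rule iffD2[OF integrable_cs[OF idm] integrable_law])
  have m1: "expectation (\<lambda>f. cs First f i) = b" "expectation (\<lambda>f. cs Second f i) = b" for i
    unfolding expectation_cs[OF idm] by (rule mean_first, rule mean_second)
  have i2: "integrable N (\<lambda>f. (cs First f i)\<^sup>2)" "integrable N (\<lambda>f. (cs Second f i)\<^sup>2)" for i
    by (rule iffD2[OF integrable_cs[OF sqm] sq_first], rule iffD2[OF integrable_cs[OF sqm] sq_second])
  have m2: "expectation (\<lambda>f. (cs First f i)\<^sup>2) = (\<integral>x. x\<^sup>2 \<partial>\<mu> First)"
      "expectation (\<lambda>f. (cs Second f i)\<^sup>2) = (\<integral>x. x\<^sup>2 \<partial>\<mu> Second)" for i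
    by (rule expectation_cs[OF sqm])+
  have ip: "integrable N (\<lambda>f. cs Second f 1 * cs First f 0)"
    by (rule indep_var_integrable[OF indep_first_second i1 i1])
  have mp: "expectation (\<lambda>f. cs Second f 1 * cs First f 0) = b * b"
    using indep_var_lebesgue_integral[OF indep_first_second i1 i1, of 1 0] by (simp add: m1)
  have X2: "(X 0 f)\<^sup>2 = (cs Second f 1)\<^sup>2 + (cs First f 0)\<^sup>2 - 2 * (cs Second f 1 * cs First f 0)" for f
    by (simp add: X_def power2_eq_square algebra_simps)
  have iX2: "integrable N (\<lambda>f. (X 0 f)\<^sup>2)"
    unfolding X2 by (intro Bochner_Integration.integrable_diff Bochner_Integration.integrable_add i2 integrable_mult_right ip)
  have mX2: "expectation (\<lambda>f. (X 0 f)\<^sup>2) = v\<^sup>2"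
  proof -
    have i3: "integrable N (\<lambda>f. 2 * (cs Second f 1 * cs First f 0))" by (rule integrable_mult_right[OF ip])
    have "expectation (\<lambda>f. (X 0 f)\<^sup>2)
        = expectation (\<lambda>f. (cs Second f 1)\<^sup>2 + (cs First f 0)\<^sup>2) - expectation (\<lambda>f. 2 * (cs Second f 1 * cs First f 0))"
      unfolding X2 by (rule Bochner_Integration.integral_diff[OF Bochner_Integration.integrable_add[OF i2(2) i2(1)] i3])
    also have "expectation (\<lambda>f. (cs Second f 1)\<^sup>2 + (cs First f 0)\<^sup>2)
        = expectation (\<lambda>f. (cs Second f 1)\<^sup>2) + expectation (\<lambda>f. (cs First f 0)\<^sup>2)"
      by (rule Bochner_Integration.integral_add[OF i2(2) i2(1)])
    also have "expectation (\<lambda>f. 2 * (cs Second f 1 * cs First f 0)) = 2 * expectation (\<lambda>f. cs Second f 1 * cs First f 0)"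
      by (rule integral_mult_right_zero)
    finally show ?thesis using variances by (simp only: m2 mp) (simp add: power2_eq_square)
  qed
  have "expectation (X 0) = expectation (\<lambda>f. cs Second f 1) - expectation (\<lambda>f. cs First f 0)"
    unfolding X_def [abs_def] One_nat_def by (rule Bochner_Integration.integral_diff[OF i1 i1])
  then have mX: "expectation (X 0) = 0" by (simp only: m1 diff_self)
  have "\<forall>\<^sub>F x in at_top. \<forall>n\<ge>1. \<bar>measure (PiM UNIV (\<lambda>_::nat. \<nu>)) {f. max_sum n f > x}
      - 2 * normal_tail (x / (v * sqrt (real n)))\<bar> \<le> e"
  proof (rule max_sum_clt_uniform[OF \<nu>])
    show "integrable \<nu> (\<lambda>x. x\<^sup>2)" unfolding \<nu>_def integrable_distr_eq[OF X_N sqm] by (rule iX2)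
    show "(\<integral>x. x \<partial>\<nu>) = 0" unfolding \<nu>_def integral_distr[OF X_N idm] by (rule mX)
    show "(\<integral>x. x\<^sup>2 \<partial>\<nu>) = v\<^sup>2" unfolding \<nu>_def integral_distr[OF X_N sqm] by (rule mX2)
  qed (rule v_pos assms)+
  moreover have "measure (PiM UNIV (\<lambda>_::nat. \<nu>)) {f. max_sum n f > x} = prob {f. max_sum n (\<lambda>i. X i f) > x}" for n x
  proof -
    have s: "{f. max_sum n f > x} \<in> sets (PiM UNIV (\<lambda>_::nat. borel))"
    proof -
      have "(\<lambda>f. max_sum n f) \<in> borel_measurable (PiM UNIV (\<lambda>_::nat. borel))" by measurable
      from measurable_sets[OF this, of "{x<..}"] show ?thesis by (simp add: vimage_def space_PiM)
    qed
    show ?thesis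
      unfolding distr_iid[OF ind id, symmetric]
      by (subst measure_distr[OF random_sequence[OF ind] s]) (simp add: vimage_def)
  qed
  ultimately show ?thesis by simp
qed

definition W :: "(kind \<times> nat \<Rightarrow> real) \<Rightarrow> ereal" where
  "W f = lind (cs Second f) (gap (cs First f) (cs Arrival f))"

lemma W_measurable [measurable]: "W \<in> borel_measurable PX"
  unfolding W_def by measurable

text \<open>Typical behaviour up to a level \<open>K\<close>. The sums of \<open>\<sigma>1\<close>
  serve for jumps at the first station, the bounds on \<open>lind\<close>, on
  \<open>cs First f 0\<close> and on the sums of \<open>\<sigma>2\<close> for jumps at the second;
  the interarrival sums serve for both.\<close>

definition good :: "real \<Rightarrow> real \<Rightarrow> (kind \<times> nat \<Rightarrow> real) \<Rightarrow> bool" where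
  "good e K f \<longleftrightarrow> lind (cs First f) (cs Arrival f) \<le> ereal K \<and> cs First f 0 \<le> K \<and>
    (\<forall>n. (\<Sum>i=1..n. cs Arrival f i) \<le> real n * (a + e) + K) \<and>
    (\<forall>n. real n * (b - e) - K \<le> (\<Sum>i=1..n. cs First f i)) \<and>
    (\<forall>n. real n * (b - e) - K \<le> (\<Sum>i=1..n. cs Second f i))"

text \<open>To be applied to the sequences moved by \<open>n + 1\<close>: what lies beyond a jump at
  \<open>n\<close> in reversed time then adds at most \<open>2 * K\<close> to the waiting
  time.\<close>

definition calm :: "real \<Rightarrow> (kind \<times> nat \<Rightarrow> real) \<Rightarrow> bool" where
  "calm K f \<longleftrightarrow> cs Second f 0 \<le> K \<and> (\<forall>j\<ge>1. dt f j \<le> K)"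

lemma good_measurable [measurable]: "Measurable.pred PX (good e K)"
  unfolding good_def by measurable

lemma calm_measurable [measurable]: "Measurable.pred PX (calm K)"
  unfolding calm_def by measurable

lemma AE_dt_bounded: "AE f in N. \<exists>R\<ge>0. \<forall>j\<ge>1. dt f j \<le> R"
proof -
  have "AE f in N. \<exists>R. \<forall>j\<ge>1. dt f j \<le> R - real j * 0"
    by (rule AE_dater_bounded) (use stable in simp)
  then show ?thesis
  proof eventually_elim
    case (elim f)
    then obtain R where "\<And>j. 1 \<le> j \<Longrightarrow> dt f j \<le> R" by auto
    then show ?case by (intro exI[of _ "max R 0"]) (auto simp: le_max_iff_disj)
  qed
qed

lemma eventually_good:
  assumes "0 < e" "0 < \<delta>" shows "\<forall>\<^sub>F K in at_top. prob {f. good e K f} > 1 - \<delta>"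
proof -
  have "\<forall>\<^sub>F K in at_top. prob {f \<in> space N. good e K f} > 1 - \<delta>"
  proof (rule tight_of_AE_bounded[OF _ _ _ assms(2)])
    show "Measurable.pred N (good e K)" for K
      using good_measurable by (simp cong: measurable_cong_sets add: sets_N)
    show "good e L f" if KL: "K \<le> L" and K: "good e K f" for K L f
      unfolding good_def
    proof (intro conjI allI)
      show "lind (cs First f) (cs Arrival f) \<le> ereal L"
        using K KL unfolding good_def by (meson ereal_less_eq(3) order_trans)
      show "cs First f 0 \<le> L" using K KL unfolding good_def by linarith
      fix n
      have "(\<Sum>i=1..n. cs Arrival f i) \<le> real n * (a + e) + K"
        "real n * (b - e) - K \<le> (\<Sum>i=1..n. cs First f i)" "real n * (b - e) - K \<le> (\<Sum>i=1..n. cs Second f i)"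
        using K unfolding good_def by blast+
      then show "(\<Sum>i=1..n. cs Arrival f i) \<le> real n * (a + e) + L"
        "real n * (b - e) - L \<le> (\<Sum>i=1..n. cs First f i)" "real n * (b - e) - L \<le> (\<Sum>i=1..n. cs Second f i)"
        using KL by linarith+
    qed
    have 1: "AE f in N. \<exists>K. \<forall>n. (\<Sum>i=1..n. cs Arrival f i) \<le> real n * (a + e) + K"
      by (rule AE_sum_cs_le) (use assms in \<open>simp add: mean_arrival\<close>)
    have 2: "AE f in N. \<exists>K. \<forall>n. real n * (b - e) - K \<le> (\<Sum>i=1..n. cs First f i)"
      by (rule AE_sum_cs_ge) (use assms in \<open>simp add: mean_first\<close>)
    have 3: "AE f in N. \<exists>K. \<forall>n. real n * (b - e) - K \<le> (\<Sum>i=1..n. cs Second f i)"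
      by (rule AE_sum_cs_ge) (use assms in \<open>simp add: mean_second\<close>)
    show "AE f in N. \<exists>K. good e K f"
      using 1 2 3 AE_dt_bounded
    proof eventually_elim
      case (elim f)
      obtain K1 where K1: "\<And>n. (\<Sum>i=1..n. cs Arrival f i) \<le> real n * (a + e) + K1" using elim(1) by blast
      obtain K2 where K2: "\<And>n. real n * (b - e) - K2 \<le> (\<Sum>i=1..n. cs First f i)" using elim(2) by blast
      obtain K3 where K3: "\<And>n. real n * (b - e) - K3 \<le> (\<Sum>i=1..n. cs Second f i)" using elim(3) by blast
      obtain R where R: "0 \<le> R" "\<And>j. 1 \<le> j \<Longrightarrow> dt f j \<le> R" using elim(4) by blast
      define K where "K = max (max K1 K2) (max K3 (max R (cs First f 0)))"
      have K: "K1 \<le> K" "K2 \<le> K" "K3 \<le> K" "R \<le> K" "cs First f 0 \<le> K" by (simp_all add: K_def)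
      have "lind (cs First f) (cs Arrival f) \<le> ereal K"
      proof (rule lind_le)
        fix k show "(\<Sum>i=1..k. cs First f i - cs Arrival f i) \<le> K"
        proof (cases k)
          case 0
          then show ?thesis using R(1) K by simp
        next
          case (Suc j)
          have "(\<Sum>i=1..k. cs First f i - cs Arrival f i) \<le> dt f k"
            by (rule dater_ge_first) (simp_all add: Suc)
          then show ?thesis using R(2)[of k] K Suc by simp
        qed
      qed
      moreover have "(\<Sum>i=1..n. cs Arrival f i) \<le> real n * (a + e) + K" for n using K1[of n] K by linarith
      moreover have "real n * (b - e) - K \<le> (\<Sum>i=1..n. cs First f i)" for n using K2[of n] K by linarith
      moreover have "real n * (b - e) - K \<le> (\<Sum>i=1..n. cs Second f i)" for n using K3[of n] K by linarith
      ultimately show ?case using K unfolding good_def by blast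
    qed
  qed
  then show ?thesis by simp
qed

lemma eventually_calm:
  assumes "0 < \<delta>" shows "\<forall>\<^sub>F K in at_top. prob {f. calm K f} > 1 - \<delta>"
proof -
  have "\<forall>\<^sub>F K in at_top. prob {f \<in> space N. calm K f} > 1 - \<delta>"
  proof (rule tight_of_AE_bounded[OF _ _ _ assms])
    show "Measurable.pred N (calm K)" for K
      using calm_measurable by (simp cong: measurable_cong_sets add: sets_N)
    show "calm L f" if "K \<le> L" "calm K f" for K L f
      using that unfolding calm_def by (meson order_trans)
    show "AE f in N. \<exists>K. calm K f"
      using AE_dt_bounded
    proof eventually_elim
      case (elim f)
      then obtain R where "\<And>j. 1 \<le> j \<Longrightarrow> dt f j \<le> R" by blast
      then show ?case unfolding calm_def
        by (intro exI[of _ "max R (cs Second f 0)"]) (auto simp: le_max_iff_disj)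
    qed
  qed
  then show ?thesis by simp
qed

lemma prob_neg: "Measurable.pred PX P \<Longrightarrow> prob {f. \<not> P f} = 1 - prob {f. P f}"
proof -
  assume "Measurable.pred PX P"
  then have "{f. P f} \<in> sets N" by (rule sets_pred)
  from prob_compl[OF this] have "prob (UNIV - {f. P f}) = 1 - prob {f. P f}" by simp
  moreover have "UNIV - {f. P f} = {f. \<not> P f}" by blast
  ultimately show ?thesis by simp
qed

lemma prob_conj_ge:
  assumes "Measurable.pred PX P" "Measurable.pred PX Q"
  shows "prob {f. P f} + prob {f. Q f} - 1 \<le> prob {f. P f \<and> Q f}"
proof -
  have "prob {f. P f} \<le> prob ({f. P f \<and> Q f} \<union> {f. \<not> Q f})"
    by (rule finite_measure_mono) (use assms in \<open>auto intro!: sets.Un sets_pred\<close>)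
  also have "\<dots> \<le> prob {f. P f \<and> Q f} + prob {f. \<not> Q f}"
    by (rule measure_Un_le) (use assms in \<open>auto intro!: sets_pred\<close>)
  finally show ?thesis using prob_neg[OF assms(2)] by simp
qed

text \<open>The service time of customer \<open>n\<close> at the first station stays in place, because it is the large one.\<close>

definition reversal :: "nat \<Rightarrow> kind \<times> nat \<Rightarrow> kind \<times> nat" where
  "reversal n p = (fst p,
     if fst p = First then if 1 \<le> snd p \<and> snd p < n then n - snd p else snd p
     else if 1 \<le> snd p \<and> snd p \<le> n then n + 1 - snd p else snd p)"

lemma reversal_reversal: "reversal n (reversal n p) = p"
  by (cases p) (auto simp: reversal_def)

lemma inj_reversal: "inj (reversal n)"
  by (rule inj_on_inverseI[of _ "reversal n"]) (rule reversal_reversal)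

text \<open>The sums that decide whether the first station is busy, without the service time at
  \<open>n\<close>. The event is thus independent of a jump there, and a jump above
  \<open>x + n * r + K\<close> outweighs every one of them.\<close>

definition no_idle :: "nat \<Rightarrow> real \<Rightarrow> real \<Rightarrow> (kind \<times> nat \<Rightarrow> real) \<Rightarrow> bool" where
  "no_idle n r K f \<longleftrightarrow> (\<forall>k\<in>{1..n}. (\<Sum>i=k..n. cs Arrival f i) - (\<Sum>i=k..<n. cs First f i) \<le> real n * r + K - real (k - 1) * r)"

text \<open>The right side is tuned to \<open>lind_gap_ge\<close>: all terms cancel there except
  \<open>cs Second f n - n * r - K\<close>. The service time \<open>cs Second f n\<close> itself is
  left out, which makes the event independent of its jump.\<close>

definition drained :: "nat \<Rightarrow> real \<Rightarrow> real \<Rightarrow> (kind \<times> nat \<Rightarrow> real) \<Rightarrow> bool" where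
  "drained n r K f \<longleftrightarrow> lind (cs First f) (cs Arrival f)
     \<le> ereal (real n * r + K - cs First f 0 - (\<Sum>i=1..n. cs Arrival f i) + (\<Sum>i=1..<n. cs Second f i))"

lemma no_idle_measurable [measurable]: "Measurable.pred PX (no_idle n r K)"
  unfolding no_idle_def by measurable

lemma drained_measurable [measurable]: "Measurable.pred PX (drained n r K)"
proof -
  have 1: "(\<lambda>f. lind (cs First f) (cs Arrival f)) \<in> borel_measurable PX" by measurable
  have "(\<lambda>f. real n * r + K - cs First f 0 - (\<Sum>i=1..n. cs Arrival f i) + (\<Sum>i=1..<n. cs Second f i)) \<in> borel_measurable PX"
    by measurable
  from borel_measurable_ereal[OF this] show ?thesis
    unfolding drained_def pred_def by (rule borel_measurable_le[OF 1])
qed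

text \<open>The sums in \<open>no_idle\<close> end at \<open>n\<close> instead of starting at 1, so
  the bounds of \<open>good\<close> are applied in reversed order. There is one interarrival time
  more than service times, which leaves \<open>b - e\<close> over; the constant \<open>4 * K\<close>
  is shared with \<open>drained\<close>.\<close>

lemma good_imp_no_idle:
  assumes "good e K (\<lambda>p. f (reversal n p))" "0 < e"
  shows "no_idle n (a - b + 2 * e) (4 * K + \<bar>b\<bar>) f"
  unfolding no_idle_def
proof
  fix k assume k: "k \<in> {1..n}"
  let ?f = "\<lambda>p. f (reversal n p)"
  have "0 \<le> cs First ?f 0" by simp
  then have K: "0 \<le> K" using assms unfolding good_def by linarith
  have u: "(\<Sum>i=k..n. cs Arrival f i) = (\<Sum>i=1..n - k + 1. cs Arrival ?f i)"
    by (rule sum.reindex_bij_witness[where i="\<lambda>i. n + 1 - i" and j="\<lambda>i. n + 1 - i"])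
       (use k in \<open>auto simp: cs_def reversal_def\<close>)
  have s: "(\<Sum>i=k..<n. cs First f i) = (\<Sum>i=1..n - k. cs First ?f i)"
    by (rule sum.reindex_bij_witness[where i="\<lambda>i. n - i" and j="\<lambda>i. n - i"])
       (use k in \<open>auto simp: cs_def reversal_def\<close>)
  have "(\<Sum>i=1..n - k + 1. cs Arrival ?f i) \<le> real (n - k + 1) * (a + e) + K"
    "real (n - k) * (b - e) - K \<le> (\<Sum>i=1..n - k. cs First ?f i)"
    using assms(1) unfolding good_def by blast+
  then have "(\<Sum>i=k..n. cs Arrival f i) - (\<Sum>i=k..<n. cs First f i)
      \<le> real (n - k + 1) * (a + e) + K - (real (n - k) * (b - e) - K)"
    unfolding u s by linarith
  also have "\<dots> = (real n - real (k - 1)) * (a - b + 2 * e) + (b - e) + 2 * K"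
    using k by (simp add: of_nat_diff algebra_simps)
  also have "\<dots> \<le> real n * (a - b + 2 * e) + (4 * K + \<bar>b\<bar>) - real (k - 1) * (a - b + 2 * e)"
    using K assms(2) unfolding left_diff_distrib by linarith
  finally show "(\<Sum>i=k..n. cs Arrival f i) - (\<Sum>i=k..<n. cs First f i)
      \<le> real n * (a - b + 2 * e) + (4 * K + \<bar>b\<bar>) - real (k - 1) * (a - b + 2 * e)" .
qed

text \<open>Four uses of \<open>K\<close> are paid for: the bound on \<open>lind\<close>, the
  service time at index 0, and the two linear bounds. The sum of \<open>\<sigma>2\<close> lacks the
  term at \<open>n\<close>, which accounts for \<open>\<bar>b\<bar>\<close>.\<close>

lemma good_imp_drained:
  assumes "good e K f" "0 < e" "1 \<le> n"
  shows "drained n (a - b + 2 * e) (4 * K + \<bar>b\<bar>) f"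
proof -
  have "0 \<le> cs First f 0" by simp
  moreover have f0: "cs First f 0 \<le> K" using assms unfolding good_def by blast
  ultimately have K: "0 \<le> K" by linarith
  have "(\<Sum>i=1..n. cs Arrival f i) \<le> real n * (a + e) + K"
    "real (n - 1) * (b - e) - K \<le> (\<Sum>i=1..n - 1. cs Second f i)"
    using assms(1) unfolding good_def by blast+
  moreover have "{1..n - 1} = {1..<n}" using assms(3) by auto
  moreover have "real (n - 1) * (b - e) = real n * (b - e) - (b - e)"
    using assms(3) by (simp add: of_nat_diff algebra_simps)
  moreover have "real n * (a - b + 2 * e) = real n * (a + e) - real n * (b - e)" by (simp add: algebra_simps)
  ultimately have "K \<le> real n * (a - b + 2 * e) + (4 * K + \<bar>b\<bar>) - cs First f 0 - (\<Sum>i=1..n. cs Arrival f i) + (\<Sum>i=1..<n. cs Second f i)"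
    using K f0 assms(2) by simp
  then show ?thesis
    using assms(1) unfolding good_def drained_def by (meson ereal_less_eq(3) order_trans)
qed

text \<open>The point is that \<open>K\<close> does not depend on \<open>n\<close>: reversing the
  first \<open>n\<close> steps preserves the law, so a single level for \<open>good\<close> serves
  for all \<open>n\<close>.\<close>

lemma exists_level:
  assumes "0 < e" "0 < \<delta>"
  shows "\<exists>K\<ge>0. (\<forall>n\<ge>1. prob {f. no_idle n (a - b + 2 * e) K f} \<ge> 1 - \<delta> \<and> prob {f. drained n (a - b + 2 * e) K f} \<ge> 1 - \<delta>)"
proof -
  have "\<forall>\<^sub>F K in at_top. prob {f. good e K f} > 1 - \<delta> \<and> 0 \<le> K"
    by (intro eventually_conj eventually_good assms eventually_ge_at_top)
  then obtain K where K: "prob {f. good e K f} > 1 - \<delta>" "0 \<le> K"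
    using eventually_happens'[OF trivial_limit_at_top_linorder] by blast
  show ?thesis
  proof (intro exI[of _ "4 * K + \<bar>b\<bar>"] conjI allI impI)
    fix n :: nat assume n: "1 \<le> n"
    have "prob {f. good e K f} = prob {f. good e K (\<lambda>p. f (reversal n p))}"
    proof (rule prob_reindex[symmetric])
      show "\<mu> (fst (reversal n p)) = \<mu> (fst p)" for p by (simp add: reversal_def)
    qed (measurable, rule inj_reversal)
    also have "\<dots> \<le> prob {f. no_idle n (a - b + 2 * e) (4 * K + \<bar>b\<bar>) f}"
      by (rule prob_mono_pred) (measurable, rule good_imp_no_idle[OF _ assms(1)])
    finally show "1 - \<delta> \<le> prob {f. no_idle n (a - b + 2 * e) (4 * K + \<bar>b\<bar>) f}" using K by simp
    have "prob {f. good e K f} \<le> prob {f. drained n (a - b + 2 * e) (4 * K + \<bar>b\<bar>) f}"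
      by (rule prob_mono_pred) (measurable, rule good_imp_drained[OF _ assms(1) n])
    then show "1 - \<delta> \<le> prob {f. drained n (a - b + 2 * e) (4 * K + \<bar>b\<bar>) f}" using K by simp
  qed (use K in simp)
qed

text \<open>Serves twice: the sums are positive, so the first station stays busy, and they exceed
  \<open>x\<close>, so the event lies inside \<open>V > x\<close>.\<close>

lemma no_idle_big:
  assumes "no_idle n r K f" "x + real n * r + K < cs First f n" "0 \<le> r" "0 \<le> x" "1 \<le> i" "i \<le> n"
  shows "x < (\<Sum>j=i..n. cs First f j - cs Arrival f j)"
proof -
  have "(\<Sum>j=i..n. cs Arrival f j) - (\<Sum>j=i..<n. cs First f j) \<le> real n * r + K - real (i - 1) * r"
    using assms unfolding no_idle_def by simp
  moreover have "(\<Sum>j=i..n. cs First f j) = (\<Sum>j=i..<n. cs First f j) + cs First f n"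
    using assms(6) by (simp add: sum.last_plus add.commute)
  moreover have "0 \<le> real (i - 1) * r" using assms by simp
  ultimately show ?thesis using assms unfolding sum_subtractf by linarith
qed

lemma depends_on_conj:
  fixes P Q :: "(kind \<times> nat \<Rightarrow> real) \<Rightarrow> bool"
  shows "depends_on A P \<Longrightarrow> depends_on A Q \<Longrightarrow> depends_on A (\<lambda>f. P f \<and> Q f)"
proof (rule depends_onI)
  fix f f' :: "kind \<times> nat \<Rightarrow> real"
  assume d: "depends_on A P" "depends_on A Q" and eq: "\<And>i. i \<in> A \<Longrightarrow> f i = f' i"
  have "P f = P f'" "Q f = Q f'" by (rule depends_onD[OF d(1) eq], assumption, rule depends_onD[OF d(2) eq])
  then show "(P f \<and> Q f) = (P f' \<and> Q f')" by simp
qed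

lemma cs_eq: "f (k, i) = f' (k, i) \<Longrightarrow> cs k f i = cs k f' i"
  by (simp add: cs_def)

lemma no_idle_dep: "depends_on (- {(First, n)}) (no_idle n r K)"
proof (rule depends_onI)
  fix f f' :: "kind \<times> nat \<Rightarrow> real" assume eq: "\<And>p. p \<in> - {(First, n)} \<Longrightarrow> f p = f' p"
  have "(\<Sum>i=k..n. cs Arrival f i) = (\<Sum>i=k..n. cs Arrival f' i)" "(\<Sum>i=k..<n. cs First f i) = (\<Sum>i=k..<n. cs First f' i)" for k
    by (auto intro!: sum.cong cs_eq eq)
  then show "no_idle n r K f = no_idle n r K f'" by (simp only: no_idle_def)
qed

lemma drained_dep: "1 \<le> n \<Longrightarrow> depends_on (- {(Second, n)}) (drained n r K)"
proof (rule depends_onI)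
  fix f f' :: "kind \<times> nat \<Rightarrow> real" assume eq: "\<And>p. p \<in> - {(Second, n)} \<Longrightarrow> f p = f' p"
  have "cs First f = cs First f'" "cs Arrival f = cs Arrival f'" by (auto intro!: ext cs_eq eq)
  moreover have "(\<Sum>i=1..<n. cs Second f i) = (\<Sum>i=1..<n. cs Second f' i)"
    by (auto intro!: sum.cong cs_eq eq)
  ultimately show "drained n r K f = drained n r K f'" by (simp only: drained_def)
qed

lemma walk_dep: "depends_on (- {(First, n)}) (\<lambda>f. max_sum n (\<lambda>i. X i f))"
proof (rule depends_onI)
  fix f f' :: "kind \<times> nat \<Rightarrow> real" assume eq: "\<And>p. p \<in> - {(First, n)} \<Longrightarrow> f p = f' p"
  show "max_sum n (\<lambda>i. X i f) = max_sum n (\<lambda>i. X i f')"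
  proof (rule max_sum_cong)
    fix i assume "i < n"
    then show "X i f = X i f'" unfolding X_def by (intro arg_cong2[where f=minus] cs_eq eq) auto
  qed
qed

lemma calm_move_dep: "depends_on (- {(First, n)}) (\<lambda>f. calm K (\<lambda>p. f (move (Suc n) p)))"
proof (rule depends_onI)
  fix f f' :: "kind \<times> nat \<Rightarrow> real" assume eq: "\<And>p. p \<in> - {(First, n)} \<Longrightarrow> f p = f' p"
  have "(\<lambda>p. f (move (Suc n) p)) = (\<lambda>p. f' (move (Suc n) p))"
    by (rule ext, rule eq) (auto simp: move_def)
  then show "calm K (\<lambda>p. f (move (Suc n) p)) = calm K (\<lambda>p. f' (move (Suc n) p))" by simp
qed

lemma calm_move_measurable [measurable]: "Measurable.pred PX (\<lambda>f. calm K (\<lambda>p. f (move m p)))"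
  by (rule measurable_compose[OF measurable_coordinate_map calm_measurable])

lemma walk_measurable [measurable]: "(\<lambda>f. max_sum n (\<lambda>i. X i f)) \<in> borel_measurable PX"
  by measurable

lemma big_measurable: "Measurable.pred PX (\<lambda>f. cs k f n > h)"
  by measurable

lemma big_dep: "depends_on {(k, n)} (\<lambda>f. cs k f n > h)"
  by (rule depends_onI) (simp add: cs_def)

text \<open>The jump is independent of the walk, of the absence of idle time and of the calm beyond
  \<open>n + 1\<close>. If the walk stays below \<open>x - 2 * K2\<close>, the service time at index
  \<open>n + 1\<close> and the rest of the past add at most \<open>K2\<close> each.\<close>

lemma prob_first_big_small_wait:
  assumes r: "0 \<le> r" and x: "0 \<le> x" "0 \<le> K2" and n: "1 \<le> n"
    and ni: "1 - \<delta> \<le> prob {f. no_idle n r K f}" and ca: "1 - \<delta> \<le> prob {f. calm K2 f}"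
  shows "tail (\<mu> First) (x + real n * r + K) * (1 - prob {f. max_sum n (\<lambda>i. X i f) > x - 2 * K2} - 2 * \<delta>)
    \<le> prob {f. cs First f n > x + real n * r + K \<and> no_idle n r K f \<and> W f \<le> ereal x}"
proof -
  let ?h = "x + real n * r + K"
  let ?w = "\<lambda>f. max_sum n (\<lambda>i. X i f)"
  let ?R = "\<lambda>f. (no_idle n r K f \<and> calm K2 (\<lambda>p. f (move (Suc n) p))) \<and> \<not> ?w f > x - 2 * K2"
  have ca': "prob {f. calm K2 (\<lambda>p. f (move (Suc n) p))} = prob {f. calm K2 f}"
    by (rule prob_reindex) (simp_all add: inj_move)
  have m: "Measurable.pred PX (\<lambda>f. ?w f > x - 2 * K2)" by measurable
  have "1 - prob {f. ?w f > x - 2 * K2} - 2 * \<delta> \<le> prob {f. ?R f}"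
    using prob_conj_ge[of "no_idle n r K" "\<lambda>f. calm K2 (\<lambda>p. f (move (Suc n) p))"]
      prob_conj_ge[of "\<lambda>f. no_idle n r K f \<and> calm K2 (\<lambda>p. f (move (Suc n) p))" "\<lambda>f. \<not> ?w f > x - 2 * K2"]
      prob_neg[OF m] ni ca ca' by simp
  then have "tail (\<mu> First) ?h * (1 - prob {f. ?w f > x - 2 * K2} - 2 * \<delta>)
      \<le> tail (\<mu> First) ?h * prob {f. ?R f}"
    by (rule mult_left_mono) (rule real_distribution.tail_nonneg[OF law_real])
  also have "\<dots> = prob {f. cs First f n > ?h \<and> ?R f}"
    unfolding prob_cs_greater[where k=First and i=n, symmetric]
  proof (rule prob_conj_indep[symmetric, OF big_measurable _ big_dep])
    show "depends_on (- {(First, n)}) ?R"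
      by (intro depends_on_conj no_idle_dep calm_move_dep depends_on_compose[OF walk_dep])
    show "Measurable.pred PX ?R" by measurable
  qed simp
  also have "\<dots> \<le> prob {f. cs First f n > ?h \<and> no_idle n r K f \<and> W f \<le> ereal x}"
  proof (rule prob_mono_pred)
    fix f assume f: "cs First f n > ?h \<and> ?R f"
    have "lind (cs Second f) (gap (cs First f) (cs Arrival f)) \<le> ereal ((x - 2 * K2) + cs Second f (Suc n) + K2)"
    proof (rule lind_gap_busy_le)
      show "0 \<le> (\<Sum>j=i..n. cs First f j - cs Arrival f j)" if "1 \<le> i" "i \<le> n" for i
        using no_idle_big[of n r K f x i] f r x that by simp
      show "(\<Sum>i=1..k. cs Second f i - cs First f (i - 1)) \<le> x - 2 * K2" if "k \<le> n" for k
        unfolding sum_X[symmetric] using max_sum_ge[OF that, of "\<lambda>i. X i f"] f by linarith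
      show "dater (shift (Suc n) (cs First f)) (shift (Suc n) (cs Second f)) (shift (Suc n) (cs Arrival f)) j \<le> K2"
        if "1 \<le> j" for j
        using f that unfolding calm_def cs_move by blast
    qed (use x in simp_all)
    moreover have "cs Second f (Suc n) \<le> K2"
      using f unfolding calm_def cs_move by (simp add: shift_def)
    ultimately show "cs First f n > ?h \<and> no_idle n r K f \<and> W f \<le> ereal x"
      using f unfolding W_def by (auto elim!: order_trans)
  qed measurable
  finally show ?thesis .
qed

text \<open>Here the walk alone lifts \<open>W\<close> above \<open>x\<close>, so nothing beyond
  \<open>n\<close> has to be controlled.\<close>

lemma prob_first_big_large_wait:
  assumes r: "0 \<le> r" and x: "0 \<le> x" and n: "1 \<le> n" and ni: "1 - \<delta> \<le> prob {f. no_idle n r K f}"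
  shows "tail (\<mu> First) (x + real n * r + K) * (prob {f. max_sum n (\<lambda>i. X i f) > x} - \<delta>)
    \<le> prob {f. cs First f n > x + real n * r + K \<and> W f > ereal x}"
proof -
  let ?h = "x + real n * r + K"
  let ?w = "\<lambda>f. max_sum n (\<lambda>i. X i f)"
  let ?R = "\<lambda>f. no_idle n r K f \<and> ?w f > x"
  have "prob {f. ?w f > x} - \<delta> \<le> prob {f. ?R f}"
    using prob_conj_ge[of "no_idle n r K" "\<lambda>f. ?w f > x"] ni by simp
  then have "tail (\<mu> First) ?h * (prob {f. ?w f > x} - \<delta>) \<le> tail (\<mu> First) ?h * prob {f. ?R f}"
    by (rule mult_left_mono) (rule real_distribution.tail_nonneg[OF law_real])
  also have "\<dots> = prob {f. cs First f n > ?h \<and> ?R f}"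
    unfolding prob_cs_greater[where k=First and i=n, symmetric]
  proof (rule prob_conj_indep[symmetric, OF big_measurable _ big_dep])
    show "depends_on (- {(First, n)}) ?R"
      by (intro depends_on_conj no_idle_dep depends_on_compose[OF walk_dep])
    show "Measurable.pred PX ?R" by measurable
  qed simp
  also have "\<dots> \<le> prob {f. cs First f n > ?h \<and> W f > ereal x}"
  proof (rule prob_mono_pred)
    fix f assume f: "cs First f n > ?h \<and> ?R f"
    then obtain k where k: "k \<le> n" "(\<Sum>i<k. X i f) > x" by (auto simp: max_sum_greater_iff)
    have "ereal (\<Sum>i=1..k. cs Second f i - cs First f (i - 1)) \<le> W f"
      unfolding W_def
    proof (rule lind_gap_busy_ge[OF _ k(1)])
      show "0 \<le> (\<Sum>j=i..n. cs First f j - cs Arrival f j)" if "1 \<le> i" "i \<le> n" for i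
        using no_idle_big[of n r K f x i] f r x that by simp
    qed
    then have le: "ereal (\<Sum>i<k. X i f) \<le> W f" unfolding sum_X .
    have "ereal x < ereal (\<Sum>i<k. X i f)" using k(2) by simp
    from less_le_trans[OF this le] show "cs First f n > ?h \<and> W f > ereal x" using f by blast
  qed measurable
  finally show ?thesis .
qed

lemma prob_second_big:
  assumes n: "1 \<le> n" and dr: "1 - \<delta> \<le> prob {f. drained n r K f}"
  shows "tail (\<mu> Second) (x + real n * r + K) * (1 - \<delta>)
    \<le> prob {f. cs Second f n > x + real n * r + K \<and> W f > ereal x}"
proof -
  let ?h = "x + real n * r + K"
  have "tail (\<mu> Second) ?h * (1 - \<delta>) \<le> tail (\<mu> Second) ?h * prob {f. drained n r K f}"
    using dr by (rule mult_left_mono) (rule real_distribution.tail_nonneg[OF law_real])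
  also have "\<dots> = prob {f. cs Second f n > ?h \<and> drained n r K f}"
    unfolding prob_cs_greater[where k=Second and i=n, symmetric]
    by (rule prob_conj_indep[symmetric, OF big_measurable drained_measurable big_dep drained_dep[OF n]]) simp
  also have "\<dots> \<le> prob {f. cs Second f n > ?h \<and> W f > ereal x}"
  proof (rule prob_mono_pred)
    fix f assume f: "cs Second f n > ?h \<and> drained n r K f"
    let ?w = "real n * r + K - cs First f 0 - (\<Sum>i=1..n. cs Arrival f i) + (\<Sum>i=1..<n. cs Second f i)"
    have "ereal ((\<Sum>i=1..n. cs Second f i - cs Arrival f i) - ?w - cs First f 0) \<le> W f"
      unfolding W_def by (rule lind_gap_ge) (use f in \<open>simp_all add: drained_def\<close>)
    moreover have eq: "(\<Sum>i=1..n. cs Second f i - cs Arrival f i) - ?w - cs First f 0 = cs Second f n - real n * r - K"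
    proof -
      have "(\<Sum>i=1..n. cs Second f i) = (\<Sum>i=1..<n. cs Second f i) + cs Second f n"
        using n by (simp add: sum.last_plus add.commute)
      then show ?thesis unfolding sum_subtractf by linarith
    qed
    ultimately have le: "ereal (cs Second f n - real n * r - K) \<le> W f" by (simp only: eq)
    have "x < cs Second f n - real n * r - K" using f by linarith
    then have "ereal x < ereal (cs Second f n - real n * r - K)" by simp
    from less_le_trans[OF this le] show "cs Second f n > ?h \<and> W f > ereal x" using f by blast
  qed measurable
  finally show ?thesis .
qed

lemma prob_two_big:
  assumes "(k, i) \<noteq> (l, j)"
  shows "prob {f. cs k f i > h \<and> cs l f j > h'} = tail (\<mu> k) h * tail (\<mu> l) h'"
  unfolding prob_cs_greater[where k=k and i=i, symmetric] prob_cs_greater[where k=l and i=j, symmetric]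
  by (rule prob_conj_indep[OF big_measurable big_measurable big_dep big_dep]) (use assms in auto)

text \<open>The events \<open>E m\<close> (a jump of \<open>\<sigma>1\<close> but
  \<open>W \<le> x\<close>) and the event \<open>W > x\<close> are disjoint and both lie inside
  \<open>V > x\<close>. Bounding the union of the \<open>E m\<close> from below therefore bounds the
  probability of \<open>W > x\<close> from above.\<close>

lemma upper_raw:
  assumes r: "0 \<le> r" and x: "0 \<le> x" "0 \<le> K2"
    and ni: "\<And>n. 1 \<le> n \<Longrightarrow> 1 - \<delta> \<le> prob {f. no_idle n r K f}" and ca: "1 - \<delta> \<le> prob {f. calm K2 f}"
    and p: "p = (\<lambda>m. tail (\<mu> First) (x + real (Suc m) * r + K))" "summable p"
    and bnd: "\<And>m. c m \<le> 1 - prob {f. max_sum (Suc m) (\<lambda>i. X i f) > x - 2 * K2} - 2 * \<delta>"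
    and sc: "summable (\<lambda>m. p m * c m)"
  shows "prob {f. W f > ereal x} \<le> qi x - (\<Sum>m. p m * c m) + (suminf p)\<^sup>2"
proof -
  define E where "E m = {f. cs First f (Suc m) > x + real (Suc m) * r + K \<and> no_idle (Suc m) r K f \<and> W f \<le> ereal x}" for m
  have E: "E m \<in> sets N" for m unfolding E_def by (rule sets_pred) measurable
  have p0: "0 \<le> p m" for m unfolding p(1) by (rule real_distribution.tail_nonneg[OF law_real])
  have single: "prob (E m) \<le> p m" for m
    unfolding E_def p(1) prob_cs_greater[where k=First and i="Suc m", symmetric] by (rule prob_mono_pred[OF big_measurable]) simp
  have "(\<Sum>m. prob (E m)) - (suminf p)\<^sup>2 \<le> prob (\<Union>m. E m)"
  proof (rule prob_Union_ge[OF E p0 p(2) _ single])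
    fix i j :: nat assume "i \<noteq> j"
    have "prob (E i \<inter> E j) \<le> prob {f. cs First f (Suc i) > x + real (Suc i) * r + K \<and> cs First f (Suc j) > x + real (Suc j) * r + K}"
      by (rule finite_measure_mono) (auto simp: E_def intro!: sets_pred)
    also have "\<dots> = p i * p j" unfolding p(1) using \<open>i \<noteq> j\<close> by (intro prob_two_big) simp
    finally show "prob (E i \<inter> E j) \<le> p i * p j" .
  qed
  moreover have "(\<Sum>m. p m * c m) \<le> (\<Sum>m. prob (E m))"
  proof (rule suminf_le[OF _ sc])
    fix m
    have "p m * c m \<le> p m * (1 - prob {f. max_sum (Suc m) (\<lambda>i. X i f) > x - 2 * K2} - 2 * \<delta>)"
      by (rule mult_left_mono[OF bnd p0])
    also have "\<dots> \<le> prob (E m)"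
      unfolding E_def p(1) by (rule prob_first_big_small_wait[OF r x _ ni ca]) simp_all
    finally show "p m * c m \<le> prob (E m)" .
  next
    show "summable (\<lambda>m. prob (E m))"
      by (rule summable_comparison_test'[OF p(2), of 0]) (simp add: single)
  qed
  moreover have "prob {f. W f > ereal x} + prob (\<Union>m. E m) \<le> qi x"
  proof -
    have sW: "{f. W f > ereal x} \<in> sets N" by (rule sets_pred) measurable
    have sE: "(\<Union>m. E m) \<in> sets N" using E by auto
    have "prob {f. W f > ereal x} + prob (\<Union>m. E m) = prob ({f. W f > ereal x} \<union> (\<Union>m. E m))"
      by (rule finite_measure_Union[symmetric, OF sW sE]) (auto simp: E_def)
    also have "\<dots> \<le> qi x"
      unfolding qi_def
    proof (rule finite_measure_mono)
      show "{f. W f > ereal x} \<union> (\<Union>m. E m) \<subseteq> {f. \<exists>j\<ge>1. dt f j > x}"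
      proof
        fix f assume f: "f \<in> {f. W f > ereal x} \<union> (\<Union>m. E m)"
        show "f \<in> {f. \<exists>j\<ge>1. dt f j > x}"
        proof (cases "f \<in> (\<Union>m. E m)")
          case True
          then obtain m where m: "cs First f (Suc m) > x + real (Suc m) * r + K" "no_idle (Suc m) r K f"
            unfolding E_def by blast
          have "x < (\<Sum>j=1..Suc m. cs First f j - cs Arrival f j)"
            by (rule no_idle_big[OF m(2,1) r x(1)]) simp_all
          also have "\<dots> \<le> dt f (Suc m)" by (rule dater_ge_first) simp_all
          finally show ?thesis by (intro CollectI exI[of _ "Suc m"]) simp
        next
          case False
          then have nW: "\<not> W f \<le> ereal x" using f by auto
          \<comment> \<open>If no path weight exceeded \<open>x\<close>, neither would
            \<open>W\<close>.\<close>
          have "\<exists>j\<ge>1. dt f j > x"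
          proof (rule ccontr)
            assume "\<not> ?thesis"
            then have le: "\<And>j. 1 \<le> j \<Longrightarrow> dt f j \<le> x" by (metis not_le)
            have "W f \<le> ereal x"
              unfolding W_def by (rule lind_gap_le_dater[OF cs_nonneg cs_nonneg le x(1)])
            then show False using nW by simp
          qed
          then show ?thesis by blast
        qed
      qed
    qed (rule sets_pred, measurable)
    finally show ?thesis .
  qed
  ultimately show ?thesis by linarith
qed

text \<open>Jumps at either station and any time contribute to \<open>W > x\<close>. Two squares are
  lost, one for jumps at different times and one for jumps of both stations at the same
  time.\<close>

lemma lower_raw:
  assumes r: "0 \<le> r" and x: "0 \<le> x"
    and ni: "\<And>n. 1 \<le> n \<Longrightarrow> 1 - \<delta> \<le> prob {f. no_idle n r K f}"
    and dr: "\<And>n. 1 \<le> n \<Longrightarrow> 1 - \<delta> \<le> prob {f. drained n r K f}"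
    and p: "p = (\<lambda>m. tail (\<mu> First) (x + real (Suc m) * r + K))" "summable p"
    and q: "q' = (\<lambda>m. tail (\<mu> Second) (x + real (Suc m) * r + K))" "summable q'"
    and bnd: "\<And>m. c m \<le> prob {f. max_sum (Suc m) (\<lambda>i. X i f) > x} - \<delta>"
    and sc: "summable (\<lambda>m. p m * c m)"
  shows "(\<Sum>m. p m * c m) + (1 - \<delta>) * suminf q' - 2 * (suminf p + suminf q')\<^sup>2 \<le> prob {f. W f > ereal x}"
proof -
  define A where "A m = {f. cs First f (Suc m) > x + real (Suc m) * r + K \<and> W f > ereal x}" for m
  define C where "C m = {f. cs Second f (Suc m) > x + real (Suc m) * r + K \<and> W f > ereal x}" for m
  have A: "A m \<in> sets N" for m unfolding A_def by (rule sets_pred) measurable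
  have C: "C m \<in> sets N" for m unfolding C_def by (rule sets_pred) measurable
  let ?g = "\<lambda>m. p m + q' m"
  have p0: "0 \<le> p m" for m unfolding p(1) by (rule real_distribution.tail_nonneg[OF law_real])
  have q0: "0 \<le> q' m" for m unfolding q(1) by (rule real_distribution.tail_nonneg[OF law_real])
  have A1: "prob (A m) \<le> p m" for m
    unfolding A_def p(1) prob_cs_greater[where k=First and i="Suc m", symmetric] by (rule prob_mono_pred[OF big_measurable]) simp
  have C1: "prob (C m) \<le> q' m" for m
    unfolding C_def q(1) prob_cs_greater[where k=Second and i="Suc m", symmetric] by (rule prob_mono_pred[OF big_measurable]) simp
  have AC: "prob (A m \<union> C m) \<le> prob (A m) + prob (C m)" for m by (rule measure_Un_le[OF A C])
  have two: "prob ({f. cs k f (Suc i) > x + real (Suc i) * r + K \<and> W f > ereal x} \<inter>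
      {f. cs l f (Suc j) > x + real (Suc j) * r + K \<and> W f > ereal x})
      \<le> tail (\<mu> k) (x + real (Suc i) * r + K) * tail (\<mu> l) (x + real (Suc j) * r + K)" if "(k, i) \<noteq> (l, j)" for k l i j
  proof -
    have "prob ({f. cs k f (Suc i) > x + real (Suc i) * r + K \<and> W f > ereal x} \<inter>
      {f. cs l f (Suc j) > x + real (Suc j) * r + K \<and> W f > ereal x})
      \<le> prob {f. cs k f (Suc i) > x + real (Suc i) * r + K \<and> cs l f (Suc j) > x + real (Suc j) * r + K}"
      by (rule finite_measure_mono) (auto intro!: sets_pred)
    also have "\<dots> = tail (\<mu> k) (x + real (Suc i) * r + K) * tail (\<mu> l) (x + real (Suc j) * r + K)"
      using that by (intro prob_two_big) auto
    finally show ?thesis .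
  qed
  have sg: "summable ?g" by (rule summable_add[OF p(2) q(2)])
  have single: "prob (A m \<union> C m) \<le> ?g m" for m using AC[of m] A1[of m] C1[of m] by linarith
  have B: "(\<Sum>m. prob (A m \<union> C m)) - (suminf ?g)\<^sup>2 \<le> prob (\<Union>m. A m \<union> C m)"
  proof (rule prob_Union_ge[OF _ _ sg _ single])
    show "A m \<union> C m \<in> sets N" for m by (rule sets.Un[OF A C])
    show "0 \<le> ?g m" for m using p0 q0 by (rule add_nonneg_nonneg)
    fix i j :: nat assume ij: "i \<noteq> j"
    have "(A i \<union> C i) \<inter> (A j \<union> C j) = ((A i \<inter> A j) \<union> (A i \<inter> C j)) \<union> ((C i \<inter> A j) \<union> (C i \<inter> C j))" by auto
    then have "prob ((A i \<union> C i) \<inter> (A j \<union> C j))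
        \<le> (prob (A i \<inter> A j) + prob (A i \<inter> C j)) + (prob (C i \<inter> A j) + prob (C i \<inter> C j))"
      using A C by (simp only:) (intro order_trans[OF measure_Un_le] add_mono measure_Un_le sets.Un sets.Int; blast)
    also have "\<dots> \<le> (p i * p j + p i * q' j) + (q' i * p j + q' i * q' j)"
      unfolding A_def C_def p(1) q(1) using ij by (intro add_mono two) auto
    also have "\<dots> = ?g i * ?g j" by (simp add: algebra_simps)
    finally show "prob ((A i \<union> C i) \<inter> (A j \<union> C j)) \<le> ?g i * ?g j" .
  qed
  have lower: "p m * c m + (1 - \<delta>) * q' m - ?g m * suminf ?g \<le> prob (A m \<union> C m)" for m
  proof -
    have "p m * c m \<le> p m * (prob {f. max_sum (Suc m) (\<lambda>i. X i f) > x} - \<delta>)"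
      by (rule mult_left_mono[OF bnd p0])
    also have "\<dots> \<le> prob (A m)"
      unfolding A_def p(1) by (rule prob_first_big_large_wait[OF r x _ ni]) simp_all
    finally have a: "p m * c m \<le> prob (A m)" .
    have "q' m * (1 - \<delta>) \<le> prob (C m)"
      unfolding C_def q(1) by (rule prob_second_big[OF _ dr]) simp_all
    then have c: "(1 - \<delta>) * q' m \<le> prob (C m)" by (simp only: mult.commute)
    have "prob (A m \<inter> C m) \<le> p m * q' m" unfolding A_def C_def p(1) q(1) by (rule two) simp
    also have "\<dots> \<le> ?g m * ?g m" using p0[of m] q0[of m] by (intro mult_mono) auto
    \<comment> \<open>A crude bound, chosen so that its sum over \<open>m\<close> is again the
      square of the total mass.\<close>
    also have "\<dots> \<le> ?g m * suminf ?g"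
    proof (rule mult_left_mono)
      have "sum ?g {m} \<le> suminf ?g" using p0 q0 by (intro sum_le_suminf[OF sg]) (auto intro: add_nonneg_nonneg)
      then show "?g m \<le> suminf ?g" by simp
    qed (use p0[of m] q0[of m] in simp)
    finally have ac: "prob (A m \<inter> C m) \<le> ?g m * suminf ?g" .
    have "prob (A m \<union> C m) = prob (A m) + prob (C m) - prob (A m \<inter> C m)"
      by (rule measure_Un3) (use A C in \<open>auto simp: fmeasurable_eq_sets\<close>)
    then show ?thesis using a c ac by linarith
  qed
  have s1: "(\<lambda>m. p m * c m + (1 - \<delta>) * q' m - ?g m * suminf ?g) sums
      ((\<Sum>m. p m * c m) + (1 - \<delta>) * suminf q' - suminf ?g * suminf ?g)"
    by (intro sums_diff sums_add sums_mult sums_mult2 summable_sums sc q sg)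
  have "(\<Sum>m. p m * c m) + (1 - \<delta>) * suminf q' - suminf ?g * suminf ?g \<le> (\<Sum>m. prob (A m \<union> C m))"
  proof (rule sums_le[OF lower s1])
    show "(\<lambda>m. prob (A m \<union> C m)) sums (\<Sum>m. prob (A m \<union> C m))"
      by (rule summable_sums, rule summable_comparison_test'[OF sg, of 0]) (simp add: single)
  qed
  moreover have "prob (\<Union>m. A m \<union> C m) \<le> prob {f. W f > ereal x}"
    by (rule finite_measure_mono) (auto simp: A_def C_def intro!: sets_pred)
  moreover have "suminf ?g = suminf p + suminf q'" by (rule suminf_add[OF p(2) q(2), symmetric])
  ultimately show ?thesis using B by (simp only: power2_eq_square)
qed

end

section \<open>Asymptotics of the waiting time\<close>

context tandem_clt
begin

definition I :: "real \<Rightarrow> real" where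
  "I x = (LBINT y:{0<..}. tail F (x + y * (a - b)) * normal_tail (x / (v * sqrt y)))"

lemma I_nonneg: "0 \<le> I x"
  unfolding I_def set_lebesgue_integral_def by (intro integral_nonneg_AE) (auto simp: F.tail_nonneg indicator_def)

text \<open>The order of choices matters: first the excess rate \<open>e\<close>, then the levels
  \<open>K\<close> and \<open>K2\<close>, and only then a large \<open>x\<close>. The explicit
  factors of \<open>\<delta>\<close> collect the errors of the weights, the normal approximation,
  the discretised integral and the overlaps.\<close>

lemma asymptotics_aux:
  assumes "0 < \<delta>" "\<delta> \<le> 1"
  shows "\<forall>\<^sub>F x in at_top.
     prob {f. W f > ereal x} \<le> 2 * d1 * I x + d2 / (a - b) * g x
       + \<delta> * (2 * d1 + 2 + 5 * (d1 / (a - b) + 1) + (d1 / (a - b) + 1)\<^sup>2) * g x \<and>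
     2 * d1 * I x + d2 / (a - b) * g x
       - \<delta> * (2 * d1 + 3 + 2 * (d1 / (a - b) + 1) + (d2 / (a - b) + 1) + 2 * ((d1 + d2) / (a - b) + 2)\<^sup>2) * g x
       \<le> prob {f. W f > ereal x}"
proof -
  define c where "c = a - b"
  have c: "0 < c" using stable by (simp add: c_def)
  obtain e1 where e1: "0 < e1" "\<And>e. 0 < e \<Longrightarrow> e \<le> e1 \<Longrightarrow> \<forall>K\<ge>0. \<forall>\<^sub>F x in at_top. summable (\<lambda>m. tail (\<mu> First) (x + real (Suc m) * (c + e) + K)) \<and>
    (\<forall>\<rho>. (\<forall>m. 0 \<le> \<rho> m \<and> \<rho> m \<le> 1) \<longrightarrow>
      \<bar>(\<Sum>m. tail (\<mu> First) (x + real (Suc m) * (c + e) + K) * \<rho> m) - d1 * (\<Sum>m. wt c x m * \<rho> m)\<bar> \<le> \<delta> * g x)"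
    using weights[OF law_real d_nonneg(1) tail_first c assms(1)] by auto
  obtain e2 where e2: "0 < e2" "\<And>e. 0 < e \<Longrightarrow> e \<le> e2 \<Longrightarrow> \<forall>K\<ge>0. \<forall>\<^sub>F x in at_top. summable (\<lambda>m. tail (\<mu> Second) (x + real (Suc m) * (c + e) + K)) \<and>
    (\<forall>\<rho>. (\<forall>m. 0 \<le> \<rho> m \<and> \<rho> m \<le> 1) \<longrightarrow>
      \<bar>(\<Sum>m. tail (\<mu> Second) (x + real (Suc m) * (c + e) + K) * \<rho> m) - d2 * (\<Sum>m. wt c x m * \<rho> m)\<bar> \<le> \<delta> * g x)"
    using weights[OF law_real d_nonneg(2) tail_second c assms(1)] by auto
  define e where "e = min e1 e2"
  have e: "0 < e" "e \<le> e1" "e \<le> e2" using e1 e2 by (simp_all add: e_def)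
  \<comment> \<open>The rate must serve two purposes: \<open>weights\<close> tolerates any excess up
    to \<open>min e1 e2\<close>, and \<open>exists_level\<close> needs an excess of twice its own
    parameter, hence \<open>e / 2\<close> there.\<close>
  define r where "r = c + e"
  have r: "0 \<le> r" "r = a - b + 2 * (e / 2)" using c e by (simp_all add: r_def c_def)
  have "0 < e / 2" using e by simp
  from exists_level[OF this assms(1)] obtain K where K: "0 \<le> K"
    "\<And>n. 1 \<le> n \<Longrightarrow> 1 - \<delta> \<le> prob {f. no_idle n r K f}"
    "\<And>n. 1 \<le> n \<Longrightarrow> 1 - \<delta> \<le> prob {f. drained n r K f}"
    unfolding r(2) by blast
  have "\<forall>\<^sub>F K2 in at_top. prob {f. calm K2 f} > 1 - \<delta> \<and> 0 \<le> K2"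
    by (intro eventually_conj eventually_calm assms eventually_ge_at_top)
  then obtain K2 where K2: "prob {f. calm K2 f} > 1 - \<delta>" "0 \<le> K2"
    using eventually_happens'[OF trivial_limit_at_top_linorder] by blast
  define p where "p x m = tail (\<mu> First) (x + real (Suc m) * r + K)" for x m
  define q' where "q' x m = tail (\<mu> Second) (x + real (Suc m) * r + K)" for x m
  define Q where "Q x m = normal_tail (x / (v * sqrt (real (Suc m))))" for x m
  define mx where "mx x m = prob {f. max_sum (Suc m) (\<lambda>i. X i f) > x}" for x m
  have w1: "\<forall>\<^sub>F x in at_top. summable (p x) \<and> (\<forall>\<rho>. (\<forall>m. 0 \<le> \<rho> m \<and> \<rho> m \<le> 1) \<longrightarrow>
      \<bar>(\<Sum>m. p x m * \<rho> m) - d1 * (\<Sum>m. wt c x m * \<rho> m)\<bar> \<le> \<delta> * g x)"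
    using e1(2)[OF e(1,2)] K(1) unfolding p_def r_def by blast
  have w2: "\<forall>\<^sub>F x in at_top. summable (q' x) \<and> (\<forall>\<rho>. (\<forall>m. 0 \<le> \<rho> m \<and> \<rho> m \<le> 1) \<longrightarrow>
      \<bar>(\<Sum>m. q' x m * \<rho> m) - d2 * (\<Sum>m. wt c x m * \<rho> m)\<bar> \<le> \<delta> * g x)"
    using e2(2)[OF e(1,3)] K(1) unfolding q'_def r_def by blast
  have int: "\<forall>\<^sub>F x in at_top. \<bar>I x - (\<Sum>m. wt c x m * Q x m)\<bar> \<le> \<delta> * g x"
    using integral_approx[OF c v_pos assms(1)] unfolding I_def Q_def c_def .
  have clt0: "\<forall>\<^sub>F x in at_top. \<forall>m. \<bar>mx x m - 2 * Q x m\<bar> \<le> \<delta>"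
    using walk_clt[OF assms(1)] by eventually_elim (auto simp: mx_def Q_def)
  have "filterlim (\<lambda>x. - (2 * K2) + x) at_top at_top"
    by (rule filterlim_tendsto_add_at_top[OF tendsto_const filterlim_ident])
  then have "\<forall>\<^sub>F x in at_top. \<forall>m. \<bar>mx (- (2 * K2) + x) m - 2 * Q (- (2 * K2) + x) m\<bar> \<le> \<delta>"
    by (rule eventually_compose_filterlim[OF clt0])
  then have clt2: "\<forall>\<^sub>F x in at_top. \<forall>m. \<bar>mx (x - 2 * K2) m - 2 * Q (x - 2 * K2) m\<bar> \<le> \<delta>" by simp
  have "0 \<le> 2 * K2" using K2 by simp
  have "\<forall>\<^sub>F x in at_top. \<forall>n\<ge>1. normal_tail ((x - 2 * K2) / (v * sqrt (real n))) \<le> normal_tail (x / (v * sqrt (real n))) + \<delta>"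
    by (rule normal_tail_shift_uniform[OF v_pos assms(1) \<open>0 \<le> 2 * K2\<close>])
  then have sh: "\<forall>\<^sub>F x in at_top. \<forall>m. Q (x - 2 * K2) m \<le> Q x m + \<delta>"
    by eventually_elim (auto simp: Q_def)
  have gs: "\<forall>\<^sub>F x in at_top. g x < \<delta>"
    using g_at_top assms(1) by (rule order_tendstoD)
  show ?thesis
    using w1 w2 int clt0 clt2 sh gs qi_upper[OF assms(1)] eventually_ge_at_top[of 0]
  proof eventually_elim
    case (elim x)
    let ?S = "\<Sum>m. wt c x m * Q x m"
    have x: "0 \<le> x" by (rule elim(9))
    have gx: "0 < g x" using x by (rule g_pos)
    have Q01: "0 \<le> Q x m" "Q x m \<le> 1 / 2" for m
    proof -
      have "0 \<le> x / (v * sqrt (real (Suc m)))" using x v_pos by simp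
      then show "Q x m \<le> 1 / 2" unfolding Q_def by (rule normal_tail_le_half)
      show "0 \<le> Q x m" unfolding Q_def by simp
    qed
    have Q1: "0 \<le> Q x m \<and> Q x m \<le> 1" for m using Q01[of m] by linarith
    \<comment> \<open>This is where the bound \<open>1 / 2\<close> for the normal tail enters: the
      probability of staying low is itself an admissible factor in \<open>weights\<close>.\<close>
    have Q2: "0 \<le> 1 - 2 * Q x m \<and> 1 - 2 * Q x m \<le> 1" for m using Q01[of m] by linarith
    have wsum: "wt c x sums (g x / c)" using x c by (rule wt_sums)
    have w0: "0 \<le> wt c x m" for m using x c by (rule wt_nonneg)
    have sp: "summable (p x)" and sq: "summable (q' x)" using elim(1,2) by blast+
    have p0: "0 \<le> p x m" for m unfolding p_def by (rule real_distribution.tail_nonneg[OF law_real])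
    have P\<rho>: "\<bar>(\<Sum>m. p x m * \<rho> m) - d1 * (\<Sum>m. wt c x m * \<rho> m)\<bar> \<le> \<delta> * g x"
      if "\<And>m. 0 \<le> \<rho> m \<and> \<rho> m \<le> 1" for \<rho> using elim(1) that by blast
    have "\<bar>(\<Sum>m. q' x m * 1) - d2 * (\<Sum>m. wt c x m * 1)\<bar> \<le> \<delta> * g x"
      using elim(2)[THEN conjunct2, THEN spec, of "\<lambda>_. 1"] by simp
    then have Sq: "\<bar>suminf (q' x) - d2 * (g x / c)\<bar> \<le> \<delta> * g x" by (simp add: sums_unique[OF wsum, symmetric])
    have "\<bar>(\<Sum>m. p x m * 1) - d1 * (\<Sum>m. wt c x m * 1)\<bar> \<le> \<delta> * g x" by (rule P\<rho>) simp
    then have Sp: "\<bar>suminf (p x) - d1 * (g x / c)\<bar> \<le> \<delta> * g x" by (simp add: sums_unique[OF wsum, symmetric])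
    have sw: "summable (\<lambda>m. wt c x m * Q x m)"
      by (rule mult_bounded_summable[OF sums_summable[OF wsum] w0 Q1])
    have spQ: "summable (\<lambda>m. p x m * Q x m)"
      by (rule mult_bounded_summable[OF sp p0 Q1])
    have f1: "\<bar>(\<Sum>m. p x m * Q x m) - d1 * ?S\<bar> \<le> \<delta> * g x"
      by (rule P\<rho>[OF Q1])
    have f2: "\<bar>(\<Sum>m. p x m * (1 - 2 * Q x m)) - d1 * (\<Sum>m. wt c x m * (1 - 2 * Q x m))\<bar> \<le> \<delta> * g x"
      by (rule P\<rho>[OF Q2])
    have f3: "(\<Sum>m. wt c x m * (1 - 2 * Q x m)) = g x / c - 2 * ?S"
      using suminf_linear[OF sums_summable[OF wsum] sw, of 1 2] sums_unique[OF wsum]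
      by (simp add: algebra_simps)
    have f4: "(\<Sum>m. p x m * (1 - 2 * Q x m - 5 * \<delta>)) = (\<Sum>m. p x m * (1 - 2 * Q x m)) - 5 * \<delta> * suminf (p x)"
    proof -
      have "summable (\<lambda>m. p x m * (1 - 2 * Q x m))"
        by (rule mult_bounded_summable[OF sp p0 Q2])
      from suminf_linear[OF this sp, of 1 "5 * \<delta>"] show ?thesis by (simp add: algebra_simps)
    qed
    have f5: "(\<Sum>m. p x m * (2 * Q x m - 2 * \<delta>)) = 2 * (\<Sum>m. p x m * Q x m) - 2 * \<delta> * suminf (p x)"
      using suminf_linear[OF spQ sp, of 2 "2 * \<delta>"] by (simp add: algebra_simps)
    have f6: "prob {f. W f > ereal x} \<le> qi x - (\<Sum>m. p x m * (1 - 2 * Q x m - 5 * \<delta>)) + (suminf (p x))\<^sup>2"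
    proof (rule upper_raw[OF r(1) x K2(2) K(2) _ _ sp])
      show "p x = (\<lambda>m. tail (\<mu> First) (x + real (Suc m) * r + K))" by (simp add: p_def fun_eq_iff)
      \<comment> \<open>The walk probability at level \<open>x - 2 * K2\<close> costs
        \<open>\<delta>\<close>, the return to level \<open>x\<close> costs
        \<open>2 * \<delta>\<close>, and the events \<open>no_idle\<close> and \<open>calm\<close>
        cost the remaining \<open>2 * \<delta>\<close>.\<close>
      show "1 - 2 * Q x m - 5 * \<delta> \<le> 1 - prob {f. max_sum (Suc m) (\<lambda>i. X i f) > x - 2 * K2} - 2 * \<delta>" for m
        using spec[OF elim(5), of m] spec[OF elim(6), of m] unfolding mx_def by linarith
      have "summable (\<lambda>m. p x m - 2 * (p x m * Q x m) - 5 * \<delta> * p x m)"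
        by (intro summable_diff summable_mult sp spQ)
      then show "summable (\<lambda>m. p x m * (1 - 2 * Q x m - 5 * \<delta>))" by (simp add: algebra_simps)
    qed (use K2 in simp_all)
    have f7: "(\<Sum>m. p x m * (2 * Q x m - 2 * \<delta>)) + (1 - \<delta>) * suminf (q' x)
        - 2 * (suminf (p x) + suminf (q' x))\<^sup>2 \<le> prob {f. W f > ereal x}"
    proof (rule lower_raw[OF r(1) x K(2) K(3) _ sp _ sq])
      show "p x = (\<lambda>m. tail (\<mu> First) (x + real (Suc m) * r + K))" by (simp add: p_def fun_eq_iff)
      show "q' x = (\<lambda>m. tail (\<mu> Second) (x + real (Suc m) * r + K))" by (simp add: q'_def fun_eq_iff)
      show "2 * Q x m - 2 * \<delta> \<le> prob {f. max_sum (Suc m) (\<lambda>i. X i f) > x} - \<delta>" for m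
        using spec[OF elim(4), of m] unfolding mx_def by linarith
      have "summable (\<lambda>m. 2 * (p x m * Q x m) - 2 * \<delta> * p x m)"
        by (intro summable_diff summable_mult sp spQ)
      then show "summable (\<lambda>m. p x m * (2 * Q x m - 2 * \<delta>))" by (simp add: algebra_simps)
    qed simp_all
    \<comment> \<open>After insertion of the bound for \<open>qi x\<close> the terms
      \<open>d1 * (g x / c)\<close> cancel, leaving \<open>2 * d1 * ?S\<close> and
      \<open>d2 * (g x / c)\<close>.\<close>
    have U: "prob {f. W f > ereal x} \<le> qi x - (d1 * (g x / c - 2 * ?S) - \<delta> * g x - 5 * \<delta> * suminf (p x)) + (suminf (p x))\<^sup>2"
      using f2 f6 unfolding f3 f4 by linarith
    have L: "2 * (d1 * ?S - \<delta> * g x) - 2 * \<delta> * suminf (p x) + (1 - \<delta>) * suminf (q' x)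
        - 2 * (suminf (p x) + suminf (q' x))\<^sup>2 \<le> prob {f. W f > ereal x}"
    proof -
      have "y - A + B - C \<le> D" if "y \<le> z" "z - A + B - C \<le> D" for y z A B C D :: real
        using that by linarith
      moreover have "2 * (d1 * ?S - \<delta> * g x) \<le> 2 * (\<Sum>m. p x m * Q x m)"
        by (rule mult_left_mono[OF conjunct1[OF f1[unfolded abs_diff_le_iff]]]) simp
      ultimately show ?thesis using f7 unfolding f5 by blast
    qed
    have sp0: "0 \<le> suminf (p x)" by (rule suminf_nonneg[OF sp p0])
    have sq0: "0 \<le> suminf (q' x)"
      by (rule suminf_nonneg[OF sq]) (simp add: q'_def real_distribution.tail_nonneg[OF law_real])
    have d\<delta>: "\<delta> * g x \<le> g x" using assms gx by simp
    have spB: "suminf (p x) \<le> (d1 / c + 1) * g x" using Sp d\<delta> by (simp add: algebra_simps)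
    have sqB: "suminf (q' x) \<le> (d2 / c + 1) * g x" using Sq d\<delta> by (simp add: algebra_simps)
    have sp2: "(suminf (p x))\<^sup>2 \<le> (d1 / c + 1)\<^sup>2 * (\<delta> * g x)"
    proof -
      have "(suminf (p x))\<^sup>2 \<le> ((d1 / c + 1) * g x)\<^sup>2" using spB sp0 by (rule power_mono)
      also have "\<dots> = (d1 / c + 1)\<^sup>2 * (g x * g x)" by (simp add: power2_eq_square)
      also have "\<dots> \<le> (d1 / c + 1)\<^sup>2 * (\<delta> * g x)" using elim(7) gx by (intro mult_left_mono mult_right_mono) auto
      finally show ?thesis .
    qed
    have spq2: "(suminf (p x) + suminf (q' x))\<^sup>2 \<le> ((d1 + d2) / c + 2)\<^sup>2 * (\<delta> * g x)"
    proof -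
      have "suminf (p x) + suminf (q' x) \<le> ((d1 + d2) / c + 2) * g x"
        using spB sqB by (simp add: algebra_simps add_divide_distrib)
      then have "(suminf (p x) + suminf (q' x))\<^sup>2 \<le> (((d1 + d2) / c + 2) * g x)\<^sup>2"
        using sp0 sq0 by (intro power_mono) auto
      also have "\<dots> = ((d1 + d2) / c + 2)\<^sup>2 * (g x * g x)" by (simp add: power2_eq_square)
      also have "\<dots> \<le> ((d1 + d2) / c + 2)\<^sup>2 * (\<delta> * g x)" using elim(7) gx by (intro mult_left_mono mult_right_mono) auto
      finally show ?thesis .
    qed
    have \<delta>p: "\<delta> * suminf (p x) \<le> \<delta> * ((d1 / c + 1) * g x)" using spB assms by (intro mult_left_mono) auto
    have \<delta>q: "\<delta> * suminf (q' x) \<le> \<delta> * ((d2 / c + 1) * g x)" using sqB assms by (intro mult_left_mono) auto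
    have dS: "\<bar>d1 * I x - d1 * ?S\<bar> \<le> d1 * (\<delta> * g x)"
    proof -
      have "\<bar>d1 * I x - d1 * ?S\<bar> = d1 * \<bar>I x - ?S\<bar>"
        using d_nonneg by (simp add: abs_mult right_diff_distrib[symmetric])
      also have "\<dots> \<le> d1 * (\<delta> * g x)" using elim(3) d_nonneg by (intro mult_left_mono) auto
      finally show ?thesis .
    qed
    have q: "qi x \<le> ((d1 + d2) / c + \<delta>) * g x" using elim(8) by (simp only: c_def)
    have q': "((d1 + d2) / c + \<delta>) * g x = d1 * (g x / c) + d2 * (g x / c) + \<delta> * g x"
      by (simp add: algebra_simps add_divide_distrib)
    have d1e: "d1 * (g x / c - 2 * ?S) = d1 * (g x / c) - 2 * (d1 * ?S)" by (simp add: algebra_simps)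
    have "prob {f. W f > ereal x} \<le> d2 * (g x / c) + 2 * (d1 * I x) + 2 * (d1 * (\<delta> * g x)) + 2 * (\<delta> * g x)
        + 5 * (\<delta> * ((d1 / c + 1) * g x)) + (d1 / c + 1)\<^sup>2 * (\<delta> * g x)"
      using U q sp2 \<delta>p dS unfolding q' d1e by linarith
    also have "\<dots> = 2 * d1 * I x + d2 / c * g x + \<delta> * (2 * d1 + 2 + 5 * (d1 / c + 1) + (d1 / c + 1)\<^sup>2) * g x"
      by (simp add: algebra_simps)
    finally have upper: "prob {f. W f > ereal x} \<le> 2 * d1 * I x + d2 / c * g x
        + \<delta> * (2 * d1 + 2 + 5 * (d1 / c + 1) + (d1 / c + 1)\<^sup>2) * g x" .
    have "2 * d1 * I x + d2 / c * g x
       - \<delta> * (2 * d1 + 3 + 2 * (d1 / c + 1) + (d2 / c + 1) + 2 * ((d1 + d2) / c + 2)\<^sup>2) * g x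
      = 2 * (d1 * I x) + d2 * (g x / c) - 2 * (d1 * (\<delta> * g x)) - 3 * (\<delta> * g x) - 2 * (\<delta> * ((d1 / c + 1) * g x))
        - \<delta> * ((d2 / c + 1) * g x) - 2 * (((d1 + d2) / c + 2)\<^sup>2 * (\<delta> * g x))"
      by (simp add: algebra_simps)
    also have "\<dots> \<le> 2 * (d1 * ?S - \<delta> * g x) - 2 * \<delta> * suminf (p x) + (1 - \<delta>) * suminf (q' x)
        - 2 * (suminf (p x) + suminf (q' x))\<^sup>2"
    proof -
      have lin: "2 * u + w - 2 * e1 - 3 * e0 - 2 * e2 - e3 - 2 * e4 \<le> 2 * (t - e0) - 2 * y + (z - y') - 2 * k"
        if "u - t \<le> e1" "w - e0 \<le> z" "k \<le> e4" "y \<le> e2" "y' \<le> e3" for u w t z k y y' e0 e1 e2 e3 e4 :: real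
        using that by (simp add: algebra_simps)
      have "2 * \<delta> * suminf (p x) = 2 * (\<delta> * suminf (p x))"
        "(1 - \<delta>) * suminf (q' x) = suminf (q' x) - \<delta> * suminf (q' x)" by (simp_all add: left_diff_distrib)
      then show ?thesis
        using lin[OF abs_le_D1[OF dS] conjunct1[OF Sq[unfolded abs_diff_le_iff]] spq2 \<delta>p \<delta>q] by (simp only:)
    qed
    also have "\<dots> \<le> prob {f. W f > ereal x}" by (rule L)
    finally show ?case using upper unfolding c_def by blast
  qed
qed

theorem wait_asymptotics:
  assumes "0 < \<eta>"
  shows "\<forall>\<^sub>F x in at_top. \<bar>prob {f. W f > ereal x} - (2 * d1 * I x + d2 / (a - b) * g x)\<bar> \<le> \<eta> * g x"
proof -
  define A where "A = 2 * d1 + 2 + 5 * (d1 / (a - b) + 1) + (d1 / (a - b) + 1)\<^sup>2"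
  define B where "B = 2 * d1 + 3 + 2 * (d1 / (a - b) + 1) + (d2 / (a - b) + 1) + 2 * ((d1 + d2) / (a - b) + 2)\<^sup>2"
  have nn: "0 \<le> d1 / (a - b)" "0 \<le> d2 / (a - b)" using d_nonneg stable by simp_all
  have AB: "0 < A" "0 < B" unfolding A_def B_def using nn d_nonneg by (auto intro!: add_pos_nonneg)
  define \<delta> where "\<delta> = min 1 (\<eta> / (A + B))"
  have \<delta>: "0 < \<delta>" "\<delta> \<le> 1" "\<delta> \<le> \<eta> / (A + B)" using assms AB by (simp_all add: \<delta>_def)
  have "\<delta> * (A + B) \<le> \<eta>" using \<delta>(3) AB by (simp add: le_divide_eq)
  moreover have "\<delta> * A \<le> \<delta> * (A + B)" "\<delta> * B \<le> \<delta> * (A + B)" using \<delta> AB by (auto intro!: mult_left_mono)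
  ultimately have le: "\<delta> * A \<le> \<eta>" "\<delta> * B \<le> \<eta>" by linarith+
  show ?thesis
    using asymptotics_aux[OF \<delta>(1,2)] eventually_ge_at_top[of 0]
  proof eventually_elim
    case (elim x)
    have "\<delta> * A * g x \<le> \<eta> * g x" "\<delta> * B * g x \<le> \<eta> * g x"
      using le g_nonneg[of x] by (auto intro: mult_right_mono)
    then show ?case using elim(1) unfolding A_def[symmetric] B_def[symmetric] by linarith
  qed
qed

text \<open>Only the part \<open>y > x\<^sup>2\<close> of the integral is needed for a lower bound of the order of the
  integrated tail at \<open>x\<^sup>4\<close>.\<close>

lemma I_lower:
  assumes "0 < l" and l: "\<forall>\<^sub>F x in at_top. l * g x \<le> g (x\<^sup>2)"
  shows "\<exists>k>0. \<forall>\<^sub>F x in at_top. k * g x \<le> I x"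
proof -
  define c where "c = a - b"
  have c: "0 < c" using stable by (simp add: c_def)
  define k where "k = normal_tail (1 / v) * l\<^sup>2 / c"
  have k: "0 < k" using normal_tail_pos[of "1 / v"] assms c by (simp add: k_def)
  have "filterlim (\<lambda>x::real. x\<^sup>2) at_top at_top" by (rule filterlim_pow_at_top[OF _ filterlim_ident]) simp
  then have l2: "\<forall>\<^sub>F x in at_top. l * g (x\<^sup>2) \<le> g ((x\<^sup>2)\<^sup>2)"
    by (rule eventually_compose_filterlim[OF l])
  have "0 < k / 2" using k by simp
  from integral_approx[OF c v_pos this]
  have int: "\<forall>\<^sub>F x in at_top. \<bar>I x - (\<Sum>m. wt c x m * normal_tail (x / (v * sqrt (real (Suc m)))))\<bar> \<le> k / 2 * g x"
    unfolding I_def c_def .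
  have "\<forall>\<^sub>F x in at_top. k / 2 * g x \<le> I x"
    using l l2 int eventually_ge_at_top[of "1 + 2 * c"]
  proof eventually_elim
    case (elim x)
    let ?n = "\<lambda>m. normal_tail (x / (v * sqrt (real (Suc m))))"
    \<comment> \<open>From this index on \<open>x / sqrt (m + 1) \<le> 1\<close>, so the normal
      factor is at least \<open>normal_tail (1 / v)\<close>.\<close>
    define M where "M = nat \<lceil>x\<^sup>2\<rceil>"
    have x: "0 < x" "1 \<le> x" "1 + 2 * c \<le> x" using elim c by linarith+
    have M: "x\<^sup>2 \<le> real M" "real M \<le> x\<^sup>2 + 1" unfolding M_def using zero_le_power2[of x] by linarith+
    have w: "wt c x sums (g x / c)" using x c by (intro wt_sums) auto
    have s: "summable (\<lambda>m. wt c x m * ?n m)"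
      by (rule mult_bounded_summable[OF sums_summable[OF w]]) (use x c in \<open>auto intro: wt_nonneg\<close>)
    have "wt c x (m + M) = wt c (x + real M * c) m" for m
      by (simp add: wt_def algebra_simps)
    moreover have "wt c (x + real M * c) sums (g (x + real M * c) / c)"
      using x c by (intro wt_sums) auto
    ultimately have w': "(\<lambda>m. wt c x (m + M)) sums (g (x + real M * c) / c)" by simp
    have "normal_tail (1 / v) * (g (x + real M * c) / c) = (\<Sum>m. normal_tail (1 / v) * wt c x (m + M))"
      using sums_mult[OF w', of "normal_tail (1 / v)"] by (rule sums_unique)
    also have "\<dots> \<le> (\<Sum>m. wt c x (m + M) * ?n (m + M))"
    proof (rule suminf_le)
      fix m
      have "x \<le> sqrt (real (Suc (m + M)))" using M x by (intro real_le_rsqrt) simp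
      then have "x / (v * sqrt (real (Suc (m + M)))) \<le> 1 / v" using v_pos by (simp add: field_simps)
      from std_normal.tail_antimono[OF this]
      have "wt c x (m + M) * normal_tail (1 / v) \<le> wt c x (m + M) * ?n (m + M)"
        using x c by (intro mult_left_mono wt_nonneg) auto
      then show "normal_tail (1 / v) * wt c x (m + M) \<le> wt c x (m + M) * ?n (m + M)" by (simp only: mult.commute)
    next
      show "summable (\<lambda>m. normal_tail (1 / v) * wt c x (m + M))" using w' by (intro summable_mult sums_summable)
      show "summable (\<lambda>m. wt c x (m + M) * ?n (m + M))" using s by (rule summable_ignore_initial_segment)
    qed
    also have "\<dots> \<le> (\<Sum>m. wt c x m * ?n m)"
    proof -
      have "0 \<le> (\<Sum>m<M. wt c x m * ?n m)" using x c by (intro sum_nonneg mult_nonneg_nonneg wt_nonneg) auto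
      then show ?thesis using suminf_split_initial_segment[OF s, of M] by simp
    qed
    finally have 1: "normal_tail (1 / v) * (g (x + real M * c) / c) \<le> (\<Sum>m. wt c x m * ?n m)" .
    \<comment> \<open>For large \<open>c\<close> the remaining mass starts beyond
      \<open>x^2\<close>, so the hypothesis is used twice, which costs \<open>l^2\<close>. The
      threshold \<open>1 + 2 * c\<close> for \<open>x\<close> is chosen for this inequality.\<close>
    have "x + real M * c \<le> (x\<^sup>2)\<^sup>2"
    proof -
      have x2: "x \<le> x\<^sup>2" using x by (simp add: power2_eq_square)
      have "real M * c \<le> (2 * x\<^sup>2) * c" using M x2 x c by (intro mult_right_mono) auto
      then have "x + real M * c \<le> x\<^sup>2 * (1 + 2 * c)" using x2 by (simp add: algebra_simps)
      also have "\<dots> \<le> x\<^sup>2 * x\<^sup>2" using x x2 by (intro mult_left_mono) auto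
      finally show ?thesis by (simp add: power2_eq_square)
    qed
    then have "g ((x\<^sup>2)\<^sup>2) \<le> g (x + real M * c)" using x c by (intro g_antimono) auto
    moreover have "l * (l * g x) \<le> l * g (x\<^sup>2)" using elim(1) assms by (intro mult_left_mono) auto
    ultimately have "l\<^sup>2 * g x \<le> g (x + real M * c)" using elim(2) by (simp add: power2_eq_square)
    then have "normal_tail (1 / v) * (l\<^sup>2 * g x / c) \<le> normal_tail (1 / v) * (g (x + real M * c) / c)"
      using c by (intro mult_left_mono divide_right_mono) auto
    then have "k * g x \<le> (\<Sum>m. wt c x m * ?n m)" using 1 by (simp add: k_def)
    then show ?case using elim(3) by linarith
  qed
  then show ?thesis using \<open>0 < k / 2\<close> by blast
qed

end

section \<open>Reduction to the product space\<close>

lemma UNIV_kind: "UNIV = {Arrival, First, Second}"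
  by (auto intro: kind.exhaust)

context tandem_queue
begin

definition seq :: "kind \<Rightarrow> int \<Rightarrow> 'a \<Rightarrow> real" where
  "seq k = (case k of Arrival \<Rightarrow> \<tau> | First \<Rightarrow> \<sigma>1 | Second \<Rightarrow> \<sigma>2)"

text \<open>The waiting time of customer 0 involves customers of index at most 0 only, so natural
  numbers suffice in reversed time.\<close>

definition past :: "kind \<times> nat \<Rightarrow> 'a \<Rightarrow> real" where
  "past p = seq (fst p) (- int (snd p))"

definition marginal :: "kind \<Rightarrow> real measure" where
  "marginal k = distr M borel (seq k 0)"

lemma iid_seq: "iid_nonneg (seq k)"
  using iid_\<tau> iid_\<sigma>1 iid_\<sigma>2 by (cases k) (simp_all add: seq_def)

lemma seq_measurable [measurable]: "seq k n \<in> borel_measurable M"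
  using iid_seq[of k] by (simp add: iid_nonneg_def indep_vars_def)

lemma distr_seq: "distr M borel (seq k n) = marginal k"
  using iid_seq[of k] unfolding iid_nonneg_def marginal_def by blast

lemma past_measurable [measurable]: "past p \<in> borel_measurable M"
  unfolding past_def by measurable

lemma marginal_real: "real_distribution (marginal k)"
  unfolding marginal_def by (rule real_distribution_distr) measurable

lemma prob_seq_events:
  assumes "finite J" "\<And>n. n \<in> J \<Longrightarrow> B n \<in> sets borel"
  shows "prob {\<omega> \<in> space M. \<forall>n\<in>J. seq k n \<omega> \<in> B n} = (\<Prod>n\<in>J. prob (seq k n -` B n \<inter> space M))"
proof (cases "J = {}")
  case False
  have "indep_vars (\<lambda>_. borel) (seq k) UNIV" using iid_seq[of k] by (simp add: iid_nonneg_def)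
  from indep_varsD[OF this False assms(1), of B] assms(2)
  have "prob (\<Inter>n\<in>J. seq k n -` B n \<inter> space M) = (\<Prod>n\<in>J. prob (seq k n -` B n \<inter> space M))" by simp
  moreover have "(\<Inter>n\<in>J. seq k n -` B n \<inter> space M) = {\<omega> \<in> space M. \<forall>n\<in>J. seq k n \<omega> \<in> B n}"
    using False by auto
  ultimately show ?thesis by simp
qed (simp add: prob_space)

lemma prob_three:
  assumes C: "\<And>k. C k \<in> sets (PiM UNIV (\<lambda>_::int. borel :: real measure))"
  shows "prob {\<omega> \<in> space M. \<forall>k. (\<lambda>n. seq k n \<omega>) \<in> C k} = (\<Prod>k\<in>UNIV. prob {\<omega> \<in> space M. (\<lambda>n. seq k n \<omega>) \<in> C k})"
proof -
  let ?A = "\<lambda>j::nat. if j = 0 then C Arrival else if j = 1 then C First else C Second"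
  let ?Y = "\<lambda>j \<omega> n. ([\<tau>, \<sigma>1, \<sigma>2] ! j) n \<omega>"
  have "prob (\<Inter>j\<in>{..<3}. ?Y j -` ?A j \<inter> space M) = (\<Prod>j\<in>{..<3}. prob (?Y j -` ?A j \<inter> space M))"
    by (rule indep_varsD[OF indep]) (use C in \<open>simp_all add: lessThan_empty_iff\<close>)
  moreover have three: "{..<3} = {0, 1, 2 :: nat}" by auto
  moreover have "(\<Inter>j\<in>{..<3}. ?Y j -` ?A j \<inter> space M) = {\<omega> \<in> space M. \<forall>k. (\<lambda>n. seq k n \<omega>) \<in> C k}"
  proof -
    have "(\<forall>k. P k) \<longleftrightarrow> P Arrival \<and> P First \<and> P Second" for P by (metis kind.exhaust)
    then show ?thesis by (auto simp: three seq_def)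
  qed
  moreover have "(\<Prod>j\<in>{..<3}. prob (?Y j -` ?A j \<inter> space M)) = (\<Prod>k\<in>UNIV. prob {\<omega> \<in> space M. (\<lambda>n. seq k n \<omega>) \<in> C k})"
    by (simp add: three UNIV_kind seq_def vimage_def Int_def conj_commute)
  ultimately show ?thesis by simp
qed

text \<open>Two kinds of independence are combined: among the three sequences, applied to cylinder
  sets, and within each sequence, applied to the coordinates of each cylinder.\<close>

lemma indep_past: "indep_vars (\<lambda>_. borel) past UNIV"
  unfolding indep_vars_def2
proof (intro conjI ballI indep_setsI)
  fix p :: "kind \<times> nat"
  show "random_variable borel (past p)" by (rule past_measurable)
  show "{past p -` A \<inter> space M |A. A \<in> sets borel} \<subseteq> events" by auto
next
  fix E :: "kind \<times> nat \<Rightarrow> 'a set" and J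
  assume J: "J \<noteq> {}" "J \<subseteq> UNIV" "finite J"
    and E: "\<forall>p\<in>J. E p \<in> {past p -` A \<inter> space M |A. A \<in> sets borel}"
  have "\<forall>p\<in>J. \<exists>A. A \<in> sets borel \<and> E p = past p -` A \<inter> space M" using E by blast
  from bchoice[OF this] obtain B where "\<forall>p\<in>J. B p \<in> sets borel \<and> E p = past p -` B p \<inter> space M" ..
  then have B: "\<And>p. p \<in> J \<Longrightarrow> B p \<in> sets borel" "\<And>p. p \<in> J \<Longrightarrow> E p = past p -` B p \<inter> space M" by blast+
  define Jk where "Jk k = {i. (k, i) \<in> J}" for k
  have fin: "finite (Jk k)" for k
    unfolding Jk_def by (rule finite_subset[OF _ finite_imageI[OF J(3), of snd]]) force
  have JS: "J = Sigma UNIV Jk" by (auto simp: Jk_def)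
  have inj: "inj_on (\<lambda>i. - int i) S" for S by (auto simp: inj_on_def)
  \<comment> \<open>The finite set of conditions is sorted by sequence; a sequence without
    conditions gets the whole space.\<close>
  define C where "C k = {f \<in> space (PiM UNIV (\<lambda>_::int. borel)). \<forall>i\<in>Jk k. f (- int i) \<in> B (k, i)}" for k
  have C: "C k \<in> sets (PiM UNIV (\<lambda>_::int. borel))" for k
  proof -
    have "{f \<in> space (PiM UNIV (\<lambda>_::int. borel :: real measure)). f (- int i) \<in> B (k, i)} \<in> sets (PiM UNIV (\<lambda>_::int. borel))"
      if "i \<in> Jk k" for i
    proof -
      have m: "(\<lambda>f. f (- int i)) \<in> borel_measurable (PiM UNIV (\<lambda>_::int. borel :: real measure))" by measurable
      have "B (k, i) \<in> sets borel" using that B(1) by (simp add: Jk_def)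
      from measurable_sets[OF m this] show ?thesis by (simp add: vimage_def Int_def conj_commute)
    qed
    then have fin_all: "Jk k \<noteq> {} \<Longrightarrow> C k \<in> sets (PiM UNIV (\<lambda>_::int. borel))"
      unfolding C_def by (intro sets.sets_Collect_finite_All' fin)
    show ?thesis
    proof (cases "Jk k = {}")
      case True
      then have "C k = space (PiM UNIV (\<lambda>_::int. borel))" by (simp add: C_def)
      then show ?thesis by (simp only: sets.top)
    qed (rule fin_all)
  qed
  have memE: "\<omega> \<in> E p \<longleftrightarrow> \<omega> \<in> space M \<and> past p \<omega> \<in> B p" if "p \<in> J" for \<omega> p
    unfolding B(2)[OF that] by blast
  have memC: "(\<lambda>n. seq k n \<omega>) \<in> C k \<longleftrightarrow> (\<forall>i\<in>Jk k. past (k, i) \<omega> \<in> B (k, i))" for k \<omega>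
    by (simp add: C_def space_PiM past_def)
  have eq: "{\<omega> \<in> space M. (\<lambda>n. seq k n \<omega>) \<in> C k} = {\<omega> \<in> space M. \<forall>n\<in>(\<lambda>i. - int i) ` Jk k. seq k n \<omega> \<in> B (k, nat (- n))}" for k
    unfolding memC by (simp add: past_def)
  have "prob (\<Inter>p\<in>J. E p) = prob {\<omega> \<in> space M. \<forall>k. (\<lambda>n. seq k n \<omega>) \<in> C k}"
  proof (rule arg_cong[where f=prob], rule set_eqI)
    fix \<omega>
    have "\<omega> \<in> (\<Inter>p\<in>J. E p) \<longleftrightarrow> (\<forall>p\<in>J. \<omega> \<in> space M \<and> past p \<omega> \<in> B p)"
      unfolding INT_iff using memE by (intro ball_cong refl)
    also have "\<dots> \<longleftrightarrow> \<omega> \<in> space M \<and> (\<forall>p\<in>J. past p \<omega> \<in> B p)" using J(1) by blast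
    also have "(\<forall>p\<in>J. past p \<omega> \<in> B p) \<longleftrightarrow> (\<forall>k. \<forall>i\<in>Jk k. past (k, i) \<omega> \<in> B (k, i))"
      unfolding Jk_def by auto
    finally show "\<omega> \<in> (\<Inter>p\<in>J. E p) \<longleftrightarrow> \<omega> \<in> {\<omega> \<in> space M. \<forall>k. (\<lambda>n. seq k n \<omega>) \<in> C k}"
      by (simp only: mem_Collect_eq memC)
  qed
  also have "\<dots> = (\<Prod>k\<in>UNIV. prob {\<omega> \<in> space M. (\<lambda>n. seq k n \<omega>) \<in> C k})"
    by (rule prob_three[OF C])
  also have "\<dots> = (\<Prod>k\<in>UNIV. \<Prod>i\<in>Jk k. prob (E (k, i)))"
  proof (rule prod.cong[OF refl])
    fix k
    have "prob {\<omega> \<in> space M. (\<lambda>n. seq k n \<omega>) \<in> C k}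
        = (\<Prod>n\<in>(\<lambda>i. - int i) ` Jk k. prob (seq k n -` B (k, nat (- n)) \<inter> space M))"
      unfolding eq by (rule prob_seq_events) (use fin B(1) in \<open>auto simp: Jk_def\<close>)
    also have "\<dots> = (\<Prod>i\<in>Jk k. prob (seq k (- int i) -` B (k, i) \<inter> space M))"
      by (subst prod.reindex[OF inj]) simp
    also have "\<dots> = (\<Prod>i\<in>Jk k. prob (E (k, i)))"
      by (intro prod.cong refl) (simp add: B(2) Jk_def past_def)
    finally show "prob {\<omega> \<in> space M. (\<lambda>n. seq k n \<omega>) \<in> C k} = (\<Prod>i\<in>Jk k. prob (E (k, i)))" .
  qed
  also have "\<dots> = (\<Prod>p\<in>J. prob (E p))"
    unfolding JS using fin by (subst prod.Sigma) (auto simp: UNIV_kind)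
  finally show "prob (\<Inter>p\<in>J. E p) = (\<Prod>p\<in>J. prob (E p))" .
qed

lemma past_nonneg: "AE \<omega> in M. \<forall>p. 0 \<le> past p \<omega>"
proof -
  have "AE \<omega> in M. 0 \<le> past p \<omega>" for p
    using iid_seq[of "fst p"] unfolding iid_nonneg_def past_def by blast
  then have all: "AE \<omega> in M. \<forall>i. 0 \<le> past (k, i) \<omega>" for k unfolding AE_all_countable by blast
  show ?thesis
    using all[of Arrival] all[of First] all[of Second]
  proof eventually_elim
    case (elim \<omega>)
    have "0 \<le> past (k, i) \<omega>" for k i using elim by (cases k) auto
    then show ?case by auto
  qed
qed

lemma stationary_wait_lind:
  "stationary_wait s u (- int i) \<omega> = lind (shift i (\<lambda>i. s (- int i) \<omega>)) (shift i (\<lambda>i. u (- int i) \<omega>))"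
proof -
  have "- int (i + j) = - int i - int j" for j by simp
  then show ?thesis by (simp only: stationary_wait_def lind_def shift_def)
qed

lemma wait2_lind:
  "wait2 \<tau> \<sigma>1 \<sigma>2 \<omega> = lind (\<lambda>i. \<sigma>2 (- int i) \<omega>) (gap (\<lambda>i. \<sigma>1 (- int i) \<omega>) (\<lambda>i. \<tau> (- int i) \<omega>))"
proof -
  have "interarrival2 \<sigma>1 \<tau> (- int i) \<omega> = gap (\<lambda>i. \<sigma>1 (- int i) \<omega>) (\<lambda>i. \<tau> (- int i) \<omega>) i" if "1 \<le> i" for i
  proof -
    have "- int i + 1 = - int (i - 1)" using that by simp
    then show ?thesis unfolding interarrival2_def gap_def stationary_wait_lind by (simp only:)
  qed
  then have "(\<Sum>i=1..k. \<sigma>2 (0 - int i) \<omega> - interarrival2 \<sigma>1 \<tau> (0 - int i) \<omega>)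
      = (\<Sum>i=1..k. \<sigma>2 (- int i) \<omega> - gap (\<lambda>i. \<sigma>1 (- int i) \<omega>) (\<lambda>i. \<tau> (- int i) \<omega>) i)" for k
    by (intro sum.cong refl) simp
  then show ?thesis unfolding wait2_def stationary_wait_def lind_def by (simp only:)
qed

end

text \<open>Unifies the two readings of the tail relation: for \<open>d = 0\<close> and for
  \<open>d > 0\<close> the same two-sided estimate results.\<close>

lemma tail_equivD:
  assumes "tail_equiv d f h" "\<And>x. 0 < h x" "0 < \<delta>"
  shows "\<forall>\<^sub>F x in at_top. \<bar>f x - d * h x\<bar> \<le> \<delta> * h x"
proof (cases "d = 0")
  case True
  then have "f \<in> o(h)" using assms(1) by (simp add: tail_equiv_def)
  from landau_o.smallD[OF this assms(3)] show ?thesis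
    by eventually_elim (use assms(2) True in \<open>simp add: less_imp_le\<close>)
next
  case False
  then have "((\<lambda>x. f x / h x) \<longlongrightarrow> d) at_top" using assms(1) by (simp add: tail_equiv_def)
  from tendstoD[OF this assms(3)] show ?thesis
  proof eventually_elim
    case (elim x)
    have "\<bar>f x - d * h x\<bar> = \<bar>f x / h x - d\<bar> * h x"
      using assms(2)[of x] by (simp add: abs_mult_pos' field_simps flip: abs_mult_pos)
    also have "\<dots> \<le> \<delta> * h x" using elim assms(2)[of x] by (intro mult_right_mono) (auto simp: dist_real_def)
    finally show ?case .
  qed
qed

lemma (in prob_space) second_moment:
  fixes Y :: "'a \<Rightarrow> real"
  assumes Y: "integrable M Y" "expectation Y = m" and sq: "integrable M (\<lambda>\<omega>. (Y \<omega> - m)\<^sup>2)"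
  shows "integrable M (\<lambda>\<omega>. (Y \<omega>)\<^sup>2)" "expectation (\<lambda>\<omega>. (Y \<omega>)\<^sup>2) = expectation (\<lambda>\<omega>. (Y \<omega> - m)\<^sup>2) + m\<^sup>2"
proof -
  have eq: "(Y \<omega>)\<^sup>2 = (Y \<omega> - m)\<^sup>2 + (2 * m * Y \<omega> - m\<^sup>2)" for \<omega>
    by (simp add: power2_eq_square algebra_simps)
  have i: "integrable M (\<lambda>\<omega>. 2 * m * Y \<omega> - m\<^sup>2)"
    by (intro Bochner_Integration.integrable_diff integrable_mult_right Y(1) integrable_const)
  show "integrable M (\<lambda>\<omega>. (Y \<omega>)\<^sup>2)" unfolding eq by (rule Bochner_Integration.integrable_add[OF sq i])
  have "expectation (\<lambda>\<omega>. 2 * m * Y \<omega> - m\<^sup>2) = expectation (\<lambda>\<omega>. 2 * m * Y \<omega>) - expectation (\<lambda>\<omega>. m\<^sup>2)"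
    by (intro Bochner_Integration.integral_diff integrable_mult_right Y(1) integrable_const)
  also have "expectation (\<lambda>\<omega>. 2 * m * Y \<omega>) = 2 * m * expectation Y" by (rule integral_mult_right_zero)
  finally have "expectation (\<lambda>\<omega>. 2 * m * Y \<omega> - m\<^sup>2) = m\<^sup>2"
    by (simp add: Y(2) prob_space power2_eq_square)
  then show "expectation (\<lambda>\<omega>. (Y \<omega>)\<^sup>2) = expectation (\<lambda>\<omega>. (Y \<omega> - m)\<^sup>2) + m\<^sup>2"
    unfolding eq Bochner_Integration.integral_add[OF sq i] by (simp only:)
qed

context tandem_queue
begin

lemma seq_0_measurable: "seq k 0 \<in> measurable M borel"
  by measurable

lemma integral_marginal:
  fixes h :: "real \<Rightarrow> real"
  assumes h: "h \<in> borel_measurable borel"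
  shows "integrable (marginal k) h \<longleftrightarrow> integrable M (\<lambda>\<omega>. h (seq k 0 \<omega>))"
    and "(\<integral>x. h x \<partial>marginal k) = expectation (\<lambda>\<omega>. h (seq k 0 \<omega>))"
  unfolding marginal_def
  by (rule integrable_distr_eq[OF seq_0_measurable h], rule integral_distr[OF seq_0_measurable h])

lemma tail_marginal: "tail (marginal k) x = prob {\<omega> \<in> space M. seq k 0 \<omega> > x}"
proof -
  have "tail (marginal k) x = measure (distr M borel (seq k 0)) {x<..}"
    by (simp only: real_distribution.tail_eq[OF marginal_real]) (simp only: marginal_def)
  also have "\<dots> = prob (seq k 0 -` {x<..} \<inter> space M)"
    by (rule measure_distr[OF seq_0_measurable]) simp
  finally show ?thesis by (simp add: vimage_def Int_def conj_commute)
qed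

lemma marginal_nonneg: "distribution_nonneg (marginal k)"
proof -
  have "AE \<omega> in M. 0 \<le> seq k 0 \<omega>" using iid_seq[of k] by (simp add: iid_nonneg_def)
  then have "AE x in marginal k. 0 \<le> x"
    unfolding marginal_def by (subst AE_distr_iff[OF seq_0_measurable]) auto
  then show ?thesis using marginal_real by (simp add: distribution_nonneg_def)
qed

lemma distr_past: "distr M (PiM UNIV (\<lambda>_. borel)) (\<lambda>\<omega> p. past p \<omega>) = PiM UNIV (\<lambda>p. marginal (fst p))"
proof -
  have "distr M borel (past p) = marginal (fst p)" for p unfolding past_def by (rule distr_seq)
  then show ?thesis
    using indep_vars_iff_distr_eq_PiM'[of UNIV past "\<lambda>_. borel"] indep_past
    by (simp add: restrict_UNIV)
qed

text \<open>Serves to exclude \<open>v = 0\<close>, in which case the service times would be almost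
  surely equal to \<open>b\<close>.\<close>

lemma variance_tail_zero:
  assumes "expectation (\<lambda>\<omega>. (seq k 0 \<omega> - b)\<^sup>2) = 0" "integrable M (\<lambda>\<omega>. (seq k 0 \<omega> - b)\<^sup>2)" "b \<le> x"
  shows "tail (marginal k) x = 0"
proof -
  have "AE \<omega> in M. (seq k 0 \<omega> - b)\<^sup>2 = 0"
    using assms integral_nonneg_eq_0_iff_AE[OF assms(2)] by simp
  then have "AE \<omega> in M. \<not> seq k 0 \<omega> > x" by eventually_elim (use assms(3) in simp)
  then have "prob {\<omega> \<in> space M. seq k 0 \<omega> > x} = 0"
    by (subst prob_eq_0) (auto intro: seq_0_measurable, measurable)
  then show ?thesis by (simp only: tail_marginal)
qed

end

theorem theorem11:
  fixes M :: "'a measure" and \<tau> \<sigma>1 \<sigma>2 :: "int \<Rightarrow> 'a \<Rightarrow> real"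
    and F :: "real measure" and a b d1 d2 v :: real
  assumes "tandem_queue M \<tau> \<sigma>1 \<sigma>2 a b b"
    and "a > b"
    and "integrable M (\<lambda>\<omega>. (\<sigma>1 0 \<omega> - prob_space.expectation M (\<sigma>1 0))\<^sup>2)"
    and "integrable M (\<lambda>\<omega>. (\<sigma>2 0 \<omega> - prob_space.expectation M (\<sigma>2 0))\<^sup>2)"
    and "v = sqrt (prob_space.variance M (\<sigma>1 0) + prob_space.variance M (\<sigma>2 0))"
    and "distribution_nonneg F" and "integrable F (\<lambda>x. x)"
    and "subexponential F" and "subexponential (int_tail_distribution F)"
    and "d1 \<ge> 0" and "d2 \<ge> 0" and "d1 + d2 > 0"
    and "tail_equiv d1 (\<lambda>x. \<P>(\<omega> in M. \<sigma>1 0 \<omega> > x)) (tail F)"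
    and "tail_equiv d2 (\<lambda>x. \<P>(\<omega> in M. \<sigma>2 0 \<omega> > x)) (tail F)"
  defines "P \<equiv> \<lambda>x::real. \<P>(\<omega> in M. wait2 \<tau> \<sigma>1 \<sigma>2 \<omega> > ereal x)"
    and "R \<equiv> \<lambda>x::real.
      2 * d1 * (LBINT y:{0<..}. tail F (x + y * (a - b)) * tail std_normal_distribution (x / (v * sqrt y)))
      + d2 / (a - b) * int_tail F x"
  shows "(\<lambda>x. P x - R x) \<in> o(int_tail F) \<and>
    (d2 > 0 \<or>
     (d2 = 0 \<and> d1 > 0 \<and> Liminf at_top (\<lambda>x. ereal (int_tail F (x\<^sup>2) / int_tail F x)) > 0)
     \<longrightarrow> tail_equiv 1 P R)"
proof -
  interpret Q: tandem_queue M \<tau> \<sigma>1 \<sigma>2 a b b by (rule assms(1))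
  have seq_simps: "Q.seq Arrival = \<tau>" "Q.seq First = \<sigma>1" "Q.seq Second = \<sigma>2"
    by (simp_all add: Q.seq_def)
  have idm: "(\<lambda>x. x) \<in> borel_measurable (borel :: real measure)" by (rule measurable_ident_sets[OF refl])
  have sqm: "(\<lambda>x. x\<^sup>2) \<in> borel_measurable (borel :: real measure)" by measurable
  have sq1: "integrable M (\<lambda>\<omega>. (\<sigma>1 0 \<omega> - b)\<^sup>2)" using assms(3) unfolding Q.mean_\<sigma>1 .
  have sq2: "integrable M (\<lambda>\<omega>. (\<sigma>2 0 \<omega> - b)\<^sup>2)" using assms(4) unfolding Q.mean_\<sigma>2 .
  let ?v1 = "Q.expectation (\<lambda>\<omega>. (\<sigma>1 0 \<omega> - b)\<^sup>2)" and ?v2 = "Q.expectation (\<lambda>\<omega>. (\<sigma>2 0 \<omega> - b)\<^sup>2)"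
  have v: "v = sqrt (?v1 + ?v2)" using assms(5) unfolding Q.mean_\<sigma>1 Q.mean_\<sigma>2 .
  have v1: "0 \<le> ?v1" and v2: "0 \<le> ?v2" by simp_all
  have Fpos: "0 < tail F x" for x by (rule tail_pos[OF assms(8)])
  have tails: "\<forall>\<^sub>F x in at_top. \<bar>tail (Q.marginal First) x - d1 * tail F x\<bar> \<le> \<delta> * tail F x"
    "\<forall>\<^sub>F x in at_top. \<bar>tail (Q.marginal Second) x - d2 * tail F x\<bar> \<le> \<delta> * tail F x" if "0 < \<delta>" for \<delta>
    unfolding Q.tail_marginal seq_simps
    by (rule tail_equivD[OF assms(13) Fpos that], rule tail_equivD[OF assms(14) Fpos that])
  have v_pos: "0 < v"
  proof (rule ccontr)
    assume "\<not> 0 < v"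
    then have "?v1 + ?v2 \<le> 0" unfolding v by simp
    then have "?v1 = 0" "?v2 = 0" using v1 v2 by linarith+
    then have zero: "tail (Q.marginal First) x = 0" "tail (Q.marginal Second) x = 0" if "b \<le> x" for x
      using Q.variance_tail_zero[of First b x] Q.variance_tail_zero[of Second b x] sq1 sq2 that
      unfolding seq_simps by blast+
    \<comment> \<open>With this tolerance, vanishing tails would make \<open>d1\<close> and
      \<open>d2\<close> at most a quarter of their sum each, contrary to
      \<open>d1 + d2 > 0\<close>.\<close>
    have half: "0 < (d1 + d2) / 4" using assms(12) by simp
    have "\<forall>\<^sub>F x in at_top. \<bar>tail (Q.marginal First) x - d1 * tail F x\<bar> \<le> (d1 + d2) / 4 * tail F x
        \<and> \<bar>tail (Q.marginal Second) x - d2 * tail F x\<bar> \<le> (d1 + d2) / 4 * tail F x \<and> b \<le> x"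
      by (intro eventually_conj tails[OF half] eventually_ge_at_top)
    then obtain x where x: "\<bar>tail (Q.marginal First) x - d1 * tail F x\<bar> \<le> (d1 + d2) / 4 * tail F x"
        "\<bar>tail (Q.marginal Second) x - d2 * tail F x\<bar> \<le> (d1 + d2) / 4 * tail F x" "b \<le> x"
      using eventually_happens'[OF trivial_limit_at_top_linorder] by blast
    have le: "d1 * tail F x \<le> (d1 + d2) / 4 * tail F x" "d2 * tail F x \<le> (d1 + d2) / 4 * tail F x"
      using x(1,2) zero[OF x(3)] Fpos[of x] assms(10,11) by (simp_all add: abs_mult)
    have "d1 \<le> (d1 + d2) / 4" by (rule mult_right_le_imp_le[OF le(1) Fpos])
    moreover have "d2 \<le> (d1 + d2) / 4" by (rule mult_right_le_imp_le[OF le(2) Fpos])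
    ultimately have False using assms(12) by simp
    then show False by simp
  qed
  have m1: "integrable M (\<lambda>\<omega>. (\<sigma>1 0 \<omega>)\<^sup>2)" "Q.expectation (\<lambda>\<omega>. (\<sigma>1 0 \<omega>)\<^sup>2) = ?v1 + b\<^sup>2"
    by (rule Q.second_moment[OF Q.mean_\<sigma>1 sq1])+
  have m2: "integrable M (\<lambda>\<omega>. (\<sigma>2 0 \<omega>)\<^sup>2)" "Q.expectation (\<lambda>\<omega>. (\<sigma>2 0 \<omega>)\<^sup>2) = ?v2 + b\<^sup>2"
    by (rule Q.second_moment[OF Q.mean_\<sigma>2 sq2])+
  interpret T: tandem_clt F Q.marginal a b d1 d2 v
  proof (intro tandem_clt.intro tandem_law.intro integrated_tail.intro tandem_law_axioms.intro tandem_clt_axioms.intro)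
    fix k
    show "integrable (Q.marginal k) (\<lambda>x. x)"
      unfolding Q.integral_marginal(1)[OF idm]
      by (cases k) (simp_all only: seq_simps Q.mean_\<tau> Q.mean_\<sigma>1 Q.mean_\<sigma>2)
  next
    show "(\<integral>x. x \<partial>Q.marginal Arrival) = a" "(\<integral>x. x \<partial>Q.marginal First) = b" "(\<integral>x. x \<partial>Q.marginal Second) = b"
      unfolding Q.integral_marginal(2)[OF idm] seq_simps by (rule Q.mean_\<tau> Q.mean_\<sigma>1 Q.mean_\<sigma>2)+
    show "integrable (Q.marginal First) (\<lambda>x. x\<^sup>2)" "integrable (Q.marginal Second) (\<lambda>x. x\<^sup>2)"
      unfolding Q.integral_marginal(1)[OF sqm] seq_simps by (rule m1 m2)+
    have "v\<^sup>2 = ?v1 + ?v2" using v v1 v2 by simp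
    then show "(\<integral>x. x\<^sup>2 \<partial>Q.marginal First) - b\<^sup>2 + ((\<integral>x. x\<^sup>2 \<partial>Q.marginal Second) - b\<^sup>2) = v\<^sup>2"
      unfolding Q.integral_marginal(2)[OF sqm] seq_simps m1(2) m2(2) by simp
  qed (rule assms Q.marginal_nonneg tails v_pos | assumption)+
  have P_eq: "P x = T.prob {f. T.W f > ereal x}" for x
  proof -
    have s: "{f. T.W f > ereal x} \<in> sets (PiM UNIV (\<lambda>_. borel))"
      using T.sets_pred[of "\<lambda>f. T.W f > ereal x"] unfolding T.sets_N by measurable
    have m: "(\<lambda>\<omega> p. Q.past p \<omega>) \<in> measurable M (PiM UNIV (\<lambda>_. borel))"
      by (rule Q.random_sequence[OF Q.indep_past])
    have "T.prob {f. T.W f > ereal x} = measure (distr M (PiM UNIV (\<lambda>_. borel)) (\<lambda>\<omega> p. Q.past p \<omega>)) {f. T.W f > ereal x}"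
      unfolding Q.distr_past T.N_def ..
    also have "\<dots> = measure M ((\<lambda>\<omega> p. Q.past p \<omega>) -` {f. T.W f > ereal x} \<inter> space M)"
      by (rule measure_distr[OF m s])
    also have "\<dots> = P x"
      unfolding P_def
    proof (rule Q.finite_measure_eq_AE)
      \<comment> \<open>The absolute values in \<open>T.cs\<close> change nothing almost surely, as
        all variables are nonnegative.\<close>
      show "AE \<omega> in M. \<omega> \<in> (\<lambda>\<omega> p. Q.past p \<omega>) -` {f. T.W f > ereal x} \<inter> space M
          \<longleftrightarrow> \<omega> \<in> {\<omega> \<in> space M. wait2 \<tau> \<sigma>1 \<sigma>2 \<omega> > ereal x}"
        using Q.past_nonneg
      proof eventually_elim
        case (elim \<omega>)
        have "T.cs k (\<lambda>p. Q.past p \<omega>) = (\<lambda>i. Q.seq k (- int i) \<omega>)" for k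
          using elim by (simp add: fun_eq_iff T.cs_def) (simp add: Q.past_def)
        then have "T.W (\<lambda>p. Q.past p \<omega>) = wait2 \<tau> \<sigma>1 \<sigma>2 \<omega>"
          by (simp only: T.W_def Q.wait2_lind seq_simps)
        then show ?case by auto
      qed
      show "(\<lambda>\<omega> p. Q.past p \<omega>) -` {f. T.W f > ereal x} \<inter> space M \<in> sets M"
        by (rule measurable_sets[OF m s])
      have [measurable]: "\<sigma>1 n \<in> borel_measurable M" "\<sigma>2 n \<in> borel_measurable M" "\<tau> n \<in> borel_measurable M" for n
        using Q.seq_measurable[of First n] Q.seq_measurable[of Second n] Q.seq_measurable[of Arrival n]
        by (simp_all only: seq_simps)
      show "{\<omega> \<in> space M. wait2 \<tau> \<sigma>1 \<sigma>2 \<omega> > ereal x} \<in> sets M"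
        unfolding Q.wait2_lind by measurable
    qed
    finally show ?thesis ..
  qed
  have key: "\<forall>\<^sub>F x in at_top. \<bar>P x - R x\<bar> \<le> \<eta> * int_tail F x \<and> 0 < int_tail F x" if "0 < \<eta>" for \<eta>
    using T.wait_asymptotics[OF that] T.eventually_g_eq eventually_ge_at_top[of 0]
  proof eventually_elim
    case (elim x)
    have "R x = 2 * d1 * T.I x + d2 / (a - b) * T.g x" using elim(2) by (simp add: R_def T.I_def)
    then show ?case using elim T.g_pos[of x] by (simp add: P_eq)
  qed
  have small: "(\<lambda>x. P x - R x) \<in> o(int_tail F)"
  proof (rule landau_o.smallI)
    fix c :: real assume "0 < c"
    from key[OF this] show "\<forall>\<^sub>F x in at_top. norm (P x - R x) \<le> c * norm (int_tail F x)"
      by eventually_elim simp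
  qed
  \<comment> \<open>An error \<open>o(int_tail F)\<close> becomes a relative error as soon as
    \<open>R\<close> is at least a fixed multiple of \<open>int_tail F\<close>.\<close>
  have equiv: "tail_equiv 1 P R" if k: "0 < k" "\<forall>\<^sub>F x in at_top. k * int_tail F x \<le> R x" for k
  proof -
    have "((\<lambda>x. P x / R x) \<longlongrightarrow> 1) at_top"
    proof (rule tendstoI)
      fix e :: real assume e: "0 < e"
      have "0 < e * k / 2" using e k by simp
      from key[OF this] k(2) show "\<forall>\<^sub>F x in at_top. dist (P x / R x) 1 < e"
      proof eventually_elim
        case (elim x)
        have Rx: "0 < R x" using elim k(1) by (meson less_le_trans mult_pos_pos)
        have "\<bar>P x - R x\<bar> \<le> e / 2 * (k * int_tail F x)" using elim by (simp add: mult.assoc)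
        also have "\<dots> \<le> e / 2 * R x" using elim e by (intro mult_left_mono) auto
        also have "\<dots> < e * R x" using e Rx by simp
        finally have "\<bar>P x - R x\<bar> / R x < e" using Rx by (simp add: divide_less_eq)
        moreover have "P x / R x - 1 = (P x - R x) / R x" using Rx by (simp add: diff_divide_distrib)
        ultimately show ?case using Rx by (simp add: dist_real_def abs_divide)
      qed
    qed
    then show ?thesis by (simp add: tail_equiv_def)
  qed
  have R_ge: "\<forall>\<^sub>F x in at_top. d2 / (a - b) * int_tail F x \<le> R x"
  proof (rule always_eventually, rule allI)
    fix x
    have "0 \<le> 2 * d1 * T.I x" using T.I_nonneg[of x] assms(10) by simp
    then show "d2 / (a - b) * int_tail F x \<le> R x" by (simp add: R_def T.I_def)
  qed
  have "tail_equiv 1 P R" if "d2 > 0"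
    by (rule equiv[OF _ R_ge]) (use that assms(2) in simp)
  moreover have "tail_equiv 1 P R"
    if "d2 = 0" "d1 > 0" and lim: "Liminf at_top (\<lambda>x. ereal (int_tail F (x\<^sup>2) / int_tail F x)) > 0"
  proof -
    \<comment> \<open>A positive real number below the limit inferior, which may be infinite a
      priori.\<close>
    obtain l where l: "0 < ereal l" "ereal l < Liminf at_top (\<lambda>x. ereal (int_tail F (x\<^sup>2) / int_tail F x))"
      using ereal_dense2[OF lim] by blast
    have l0: "0 < l" using l(1) by simp
    have "filterlim (\<lambda>x::real. x\<^sup>2) at_top at_top" by (rule filterlim_pow_at_top[OF _ filterlim_ident]) simp
    then have sq_eq: "\<forall>\<^sub>F x in at_top. tail T.G (x\<^sup>2) = T.g (x\<^sup>2) \<and> int_tail F (x\<^sup>2) = T.g (x\<^sup>2)"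
      by (rule eventually_compose_filterlim[OF T.eventually_g_eq])
    have "\<forall>\<^sub>F x in at_top. l * T.g x \<le> T.g (x\<^sup>2)"
      using less_LiminfD[OF l(2)] sq_eq T.eventually_g_eq eventually_ge_at_top[of 0]
    proof eventually_elim
      case (elim x)
      then have "l < T.g (x\<^sup>2) / T.g x" by simp
      then show ?case using T.g_pos[of x] elim by (simp add: less_divide_eq less_imp_le)
    qed
    from T.I_lower[OF l0 this] obtain k where k: "0 < k" "\<forall>\<^sub>F x in at_top. k * T.g x \<le> T.I x" by blast
    show ?thesis
    proof (rule equiv[of "2 * d1 * k"])
      show "0 < 2 * d1 * k" using k that by simp
      show "\<forall>\<^sub>F x in at_top. 2 * d1 * k * int_tail F x \<le> R x"
        using k(2) T.eventually_g_eq
      proof eventually_elim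
        case (elim x)
        have "2 * d1 * (k * T.g x) \<le> 2 * d1 * T.I x" using elim that by (intro mult_left_mono) auto
        then show ?case using elim that by (simp add: R_def T.I_def mult.assoc)
      qed
    qed
  qed
  ultimately show ?thesis using small by blast
qed

end
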